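(* Let $R:[0,1]\to[0,\infty)$ be a reward function, let $\mu<\bar\mu_\infty$, and define $R_k:=R(k/n)$ for $k=1,\dots,n$. Let $F^*$ and $u^*$ be the unique mean field equilibrium for $R$ and its value function, and let $F_n^*$ and $u_n^*$ be the unique equilibrium of the $n$-player game with reward vector $(R_1,\dots,R_n)$ and its value function (well-defined for all sufficiently large $n$). Then, as $n\to\infty$, $F_n^*$ converges weakly to $F^*$ and $u_n^*$ converges to $u^*$ uniformly on compact subsets of $[0,\infty)$.
   Context: Increasing/decreasing are understood in the non-strict sense. A reward function is a right-continuous decreasing function $R:[0,1]\to[0,\infty)$ with $R(0)>R(1-)=R(1)$. Write $g(y):=R(1-y)$, $\bar R:=\int_0^1R(r)\,dr$; $g^{-1}(z)=\inf\{y\in[0,1]:g(y)>z\}$ for $z\in[R(1),R(0))$ and $g^{-1}(R(0)):=1$. Fix $x_0\in(0,\infty)$, $\mu\in\mathbb R$, $\sigma\in(0,\infty)$ and set $\bar\mu_\infty:=\frac{\sigma^2}{2x_0}\log\big(\frac{R(0)-R(1)}{R(0)-\bar R}\big)$. Let $X_t=x_0+\mu t+\sigma W_t$ ($W$ standard Brownian motion) with absorption at $0$, and $h(x)=\frac{\exp(-2\mu x/\sigma^2)-1}{\exp(-2\mu x_0/\sigma^2)-1}$ if $\mu\ne0$, $h(x)=x/x_0$ if $\mu=0$. $\mathcal F$ is the set of laws on $[0,\infty)$ of $X_\tau$ for some (possibly randomized) finite stopping time $\tau$; it is known that $\mathcal F$ consists of all distributions $F$ on $[0,\infty)$ with $\int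 h\,dF=1$ if $\mu>0$, respectively $\int h\,dF\le1$ if $\mu\le0$. The same symbol is used for a distribution and its cdf; $F(0-)=0$. Mean field game: for a distribution $F$ on $[0,\infty)$, $\xi^F(x)=g(F(x))$ if $F(x)=F(x-)$ and $\xi^F(x)=\frac1{F(x)-F(x-)}\int_{F(x-)}^{F(x)}g(y)\,dy$ otherwise. $F\in\mathcal F$ is a mean field equilibrium if $\int\xi^F\,dF\ge\int\xi^F\,d\tilde F$ for all $\tilde F\in\mathcal F$. For $\mu<\bar\mu_\infty$ the unique mean field equilibrium is $F^*(x)=g^{-1}(u^*(x))$, where $u^*(x)=[R(1)+(\bar R-R(1))h(x)]\wedge R(0)$ is its value function (the supremal expected reward of a player starting at $x$ when all others use $F^*$). $n$-player game: given a decreasing, non-constant reward vector $(R_1,\dots,R_n)$ ($R_1$ the reward for the best rank), players independently choose distributions in $\mathcal F$, are ranked by their level of stopping (higher is better), and ties are split uniformly at random. If all other $n-1$ players use $F$, the expected payoff for stopping at $x$ is $$\xi_n^F(x)=\sum_{i,j,k\ge0,\ i+j+k=n-1}\frac{R_{i+1}+\cdots+R_{i+k+1}}{k+1}\,\frac{(n-1)!}{i!\,j!\,k!}\,(1-F(x))^iF(x-)^j(F(x)-F(x-))^k,$$ with $0^0=1$. $F\in\mathcal F$ is an equilibrium if $\int\xi_n^F\,dF\ge\int\xi_n^F\,d\tilde F$ for all $\tilde F\in\mathcal F$; its value function at $x$ is the supremal expected payoff of a player starting at $x$ when the others use $F$. Let $\bar R_n=\frac1n\sum_{k=1}^nR_k$.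 It is known that if $\mu<\bar\mu_n:=\frac{\sigma^2}{2x_0}\log\big(\frac{R_1-R_n}{R_1-\bar R_n}\big)$, the $n$-player game has a unique equilibrium $F_n^*(x)=g_n^{-1}(u_n^*(x))$, where $u_n^*(x)=[R_n+(\bar R_n-R_n)h(x)]\wedge R_1$ is its value function and $g_n(y)=\sum_{k=1}^nR_k\binom{n-1}{k-1}y^{n-k}(1-y)^{k-1}$ (strictly increasing on $[0,1]$). *)

theory Defs
  imports "HOL-Probability.Probability"
begin

text \<open>Time is indexed by \<^typ>\<open>ennreal\<close>, so that stopping times may take the value \<open>\<infinity>\<close>.\<close>

definition natural_filtration ::
  "'a measure \<Rightarrow> (real \<Rightarrow> 'a \<Rightarrow> real) \<Rightarrow> ennreal \<Rightarrow> 'a measure"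
where
  "natural_filtration M W t =
    sigma (space M)
      {W s -` A \<inter> space M | s A. 0 \<le> s \<and> ennreal s \<le> t \<and> A \<in> sets borel}"

text \<open>The values of \<open>W\<close> at negative times are irrelevant.\<close>

definition brownian_motion :: "'a measure \<Rightarrow> (real \<Rightarrow> 'a \<Rightarrow> real) \<Rightarrow> bool"
where
  "brownian_motion M W \<longleftrightarrow>
    prob_space M \<and>
    (\<forall>t\<ge>0. W t \<in> borel_measurable M) \<and>
    (\<forall>\<omega>\<in>space M. W 0 \<omega> = 0 \<and> continuous_on {0..} (\<lambda>t. W t \<omega>)) \<and>
    (\<forall>s t. 0 \<le> s \<longrightarrow> s < t \<longrightarrow>
      distributed M lborel (\<lambda>\<omega>. W t \<omega> - W s \<omega>) (normal_density 0 (sqrt (t - s))) \<and>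
      prob_space.indep_set M
        (sets (natural_filtration M W (ennreal s)))
        (sets (vimage_algebra (space M) (\<lambda>\<omega>. W t \<omega> - W s \<omega>) borel)))"

definition drifted_path ::
  "(real \<Rightarrow> 'a \<Rightarrow> real) \<Rightarrow> real \<Rightarrow> real \<Rightarrow> real \<Rightarrow> real \<Rightarrow> 'a \<Rightarrow> real"
where
  "drifted_path W \<mu> \<sigma> x t \<omega> = x + \<mu> * t + \<sigma> * W t \<omega>"

definition absorbed_path ::
  "(real \<Rightarrow> 'a \<Rightarrow> real) \<Rightarrow> real \<Rightarrow> real \<Rightarrow> real \<Rightarrow> real \<Rightarrow> 'a \<Rightarrow> real"
where
  "absorbed_path W \<mu> \<sigma> x t \<omega> =
    (if \<exists>s\<in>{0..t}. drifted_path W \<mu> \<sigma> x s \<omega> = 0 then 0 else drifted_path W \<mu> \<sigma> x t \<omega>)"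

text \<open>
  Randomization: a stopping time may depend on a random variable that is independent of \<open>W\<close>,
  uniform on \<open>[0,1]\<close> and known at time \<open>0\<close>. It is the second component of the sample points.
\<close>

definition randomized_space :: "'a measure \<Rightarrow> ('a \<times> real) measure"
where
  "randomized_space M = M \<Otimes>\<^sub>M uniform_measure lborel {0..1}"

definition finite_randomized_stopping_time ::
  "'a measure \<Rightarrow> (real \<Rightarrow> 'a \<Rightarrow> real) \<Rightarrow> ('a \<times> real \<Rightarrow> ennreal) \<Rightarrow> bool"
where
  "finite_randomized_stopping_time M W \<tau> \<longleftrightarrow>
    stopping_time (\<lambda>t. natural_filtration M W t \<Otimes>\<^sub>M (borel :: real measure)) \<tau> \<and>
    (AE z in randomized_space M. \<tau> z < \<infinity>)"

text \<open>
  The laws of \<open>X\<^sub>\<tau>\<close>, where \<open>X\<close> starts at \<open>x\<close>. They are Borel measures on the real line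
  which are concentrated on \<open>[0,\<infinity>)\<close> if \<open>x \<ge> 0\<close>.
\<close>

definition attainable_laws ::
  "'a measure \<Rightarrow> (real \<Rightarrow> 'a \<Rightarrow> real) \<Rightarrow> real \<Rightarrow> real \<Rightarrow> real \<Rightarrow> real measure set"
where
  "attainable_laws M W \<mu> \<sigma> x =
    {distr (randomized_space M) borel
       (\<lambda>(\<omega>, v). absorbed_path W \<mu> \<sigma> x (enn2real (\<tau> (\<omega>, v))) \<omega>)
     | \<tau>. finite_randomized_stopping_time M W \<tau>}"

definition reward_function :: "(real \<Rightarrow> real) \<Rightarrow> bool"
where
  "reward_function R \<longleftrightarrow>
    (\<forall>r\<in>{0..1}. 0 \<le> R r) \<and>
    antimono_on {0..1} R \<and>
    (\<forall>r\<in>{0..<1}. continuous (at_right r) R) \<and>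
    (R \<longlongrightarrow> R 1) (at_left 1) \<and>
    R 1 < R 0"

definition critical_drift :: "(real \<Rightarrow> real) \<Rightarrow> real \<Rightarrow> real \<Rightarrow> real"
where
  "critical_drift R \<sigma> x0 =
    \<sigma>\<^sup>2 / (2 * x0) * ln ((R 0 - R 1) / (R 0 - integral {0..1} R))"

definition cdf_left :: "real measure \<Rightarrow> real \<Rightarrow> real"
where
  "cdf_left F x = measure F {..<x}"

definition mean_field_payoff :: "(real \<Rightarrow> real) \<Rightarrow> real measure \<Rightarrow> real \<Rightarrow> real"
where
  "mean_field_payoff R F x =
    (let g = (\<lambda>y. R (1 - y)) in
      if cdf F x = cdf_left F x then g (cdf F x)
      else integral {cdf_left F x..cdf F x} g / (cdf F x - cdf_left F x))"

text \<open>The reward vector \<open>r\<close> is used at the indices \<open>1, \<dots>, n\<close>. In the summand, \<open>i\<close> of the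
  other players rank above \<open>x\<close>, \<open>j\<close> below, and \<open>k\<close> are tied.\<close>

definition n_player_payoff :: "nat \<Rightarrow> (nat \<Rightarrow> real) \<Rightarrow> real measure \<Rightarrow> real \<Rightarrow> real"
where
  "n_player_payoff n r F x =
    (\<Sum>(i, j, k)\<in>{(i, j, k). i + j + k = n - 1}.
      (\<Sum>l = i + 1..i + k + 1. r l) / real (k + 1)
      * (fact (n - 1) / (fact i * fact j * fact k))
      * (1 - cdf F x) ^ i * cdf_left F x ^ j * (cdf F x - cdf_left F x) ^ k)"

definition equilibrium ::
  "real measure set \<Rightarrow> (real measure \<Rightarrow> real \<Rightarrow> real) \<Rightarrow> real measure \<Rightarrow> bool"
where
  "equilibrium L \<xi> F \<longleftrightarrow> F \<in> L \<and> (\<forall>G\<in>L. (\<integral>x. \<xi> F x \<partial>F) \<ge> (\<integral>x. \<xi> F x \<partial>G))"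

text \<open>Supremal expected payoff for a player whose attainable laws are \<open>L\<close>, given the payoff \<open>f\<close>
  for stopping at each level.\<close>

definition optimal_value :: "real measure set \<Rightarrow> (real \<Rightarrow> real) \<Rightarrow> real"
where
  "optimal_value L f = (SUP G\<in>L. \<integral>x. f x \<partial>G)"

definition mean_field_equilibrium ::
  "'a measure \<Rightarrow> (real \<Rightarrow> 'a \<Rightarrow> real) \<Rightarrow> real \<Rightarrow> real \<Rightarrow> real \<Rightarrow> (real \<Rightarrow> real)
    \<Rightarrow> real measure \<Rightarrow> bool"
where
  "mean_field_equilibrium M W \<mu> \<sigma> x0 R =
    equilibrium (attainable_laws M W \<mu> \<sigma> x0) (mean_field_payoff R)"

definition mean_field_value ::
  "'a measure \<Rightarrow> (real \<Rightarrow> 'a \<Rightarrow> real) \<Rightarrow> real \<Rightarrow> real \<Rightarrow> (real \<Rightarrow> real)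
    \<Rightarrow> real measure \<Rightarrow> real \<Rightarrow> real"
where
  "mean_field_value M W \<mu> \<sigma> R F x =
    optimal_value (attainable_laws M W \<mu> \<sigma> x) (mean_field_payoff R F)"

definition n_player_equilibrium ::
  "'a measure \<Rightarrow> (real \<Rightarrow> 'a \<Rightarrow> real) \<Rightarrow> real \<Rightarrow> real \<Rightarrow> real \<Rightarrow> nat \<Rightarrow> (nat \<Rightarrow> real)
    \<Rightarrow> real measure \<Rightarrow> bool"
where
  "n_player_equilibrium M W \<mu> \<sigma> x0 n r =
    equilibrium (attainable_laws M W \<mu> \<sigma> x0) (n_player_payoff n r)"

definition n_player_value ::
  "'a measure \<Rightarrow> (real \<Rightarrow> 'a \<Rightarrow> real) \<Rightarrow> real \<Rightarrow> real \<Rightarrow> nat \<Rightarrow> (nat \<Rightarrow> real)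
    \<Rightarrow> real measure \<Rightarrow> real \<Rightarrow> real"
where
  "n_player_value M W \<mu> \<sigma> n r F x =
    optimal_value (attainable_laws M W \<mu> \<sigma> x) (n_player_payoff n r F)"

definition sampled_rewards :: "(real \<Rightarrow> real) \<Rightarrow> nat \<Rightarrow> nat \<Rightarrow> real"
where
  "sampled_rewards R n k = R (real k / real n)"

end

theory Submission
  imports Defs
begin

text \<open>
  The scale function \<open>s\<close> of the drifted Brownian motion turns it into a martingale, so optional
  stopping bounds \<open>\<integral>s dG\<close> for every attainable law \<open>G\<close> by \<open>s x\<close>, with equality if \<open>\<mu> > 0\<close>; conversely,
  randomized exit times from intervals realize all laws that are needed below.

  Breaking ties at random means that a jump of the cdf from \<open>p\<close> to \<open>q\<close> is paid with the mean over
  \<open>[p,q]\<close> of \<open>y \<mapsto> g\<^sub>n(y)\<close>. Hence the \<open>n\<close>-player game is itself a mean field game, for the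
  reward function \<open>r \<mapsto> g\<^sub>n(1 - r)\<close>, and both parts of the theorem are about one kind of game.

  In such a game, let \<open>F\<close> be an equilibrium with payoff \<open>v\<close>. Testing against two-point laws yields a
  supporting line \<open>\<xi>\<^sup>F \<le> v + c (h - 1)\<close>, which is attained \<open>F\<close>-almost everywhere. Atoms of \<open>F\<close> can
  only sit on flat pieces of \<open>g\<close>, so that \<open>g u = v + c (h (Q u) - 1)\<close> for almost all \<open>u\<close>, where \<open>Q\<close> is
  the quantile function of \<open>F\<close>. The limit \<open>u \<rightarrow> 0\<close> and integration over \<open>u\<close> determine \<open>c\<close> and \<open>v\<close>, and
  \<open>F\<close> is the law of \<open>inv h ((g U - R 1) / (Rbar - R 1))\<close> with \<open>U\<close> uniform. Finally \<open>g\<^sub>n \<rightarrow> g\<close> at every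
  continuity point of \<open>g\<close> by Chebyshev's inequality, so the quantile functions converge almost
  everywhere.
\<close>

text \<open>Attainable laws enter only through an upper bound valid for all of them and through a
  few explicit stopping times. A description of all attainable laws is thereby avoided: verification
  needs the bound, the single law \<open>eq_law\<close> and exits from intervals; uniqueness needs
  exits from intervals around \<open>x0\<close> and, for nonpositive drift, point masses below
  \<open>x0\<close>. The obstacle is to embed \<open>eq_law\<close> with the one uniform variable
  that a randomized stopping time may use. Its image under \<open>h\<close> is bounded with mean 1,
  so it is a mixture of exit laws of intervals around 1 once the two endpoints are coupled
  correctly; the matching of a monotone profile provides the coupling. Boundedness is where the
  drift condition enters. It puts (R 0 - R 1) / (Rbar - R 1), the largest value that
  \<open>h\<close> has to take, strictly below the supremum of \<open>h\<close>; for nonpositive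
  drift \<open>h\<close> is unbounded and the condition holds by itself, as the critical drift is
  positive. The inequality is strict, so the sampled games inherit it for large n.\<close>

section \<open>Optional stopping for Brownian motion with drift\<close>

text \<open>For \<open>\<theta> = 2 \<mu> / \<sigma>\<^sup>2\<close> this is the scale function with \<open>s' x = exp (- \<theta> x)\<close>; it is a positive
  multiple of the paper's \<open>h\<close>, and this normalization covers all signs of \<open>\<mu>\<close> at once.\<close>

definition natural_scale :: "real \<Rightarrow> real \<Rightarrow> real" where
  "natural_scale \<theta> x = (if \<theta> = 0 then x else (1 - exp (- \<theta> * x)) / \<theta>)"

lemma natural_scale_0 [simp]: "natural_scale \<theta> 0 = 0"
  by (simp add: natural_scale_def)

text \<open>Cocycle identity: an increment of the scale process factors into a function of the
  present position and a function of the future increment alone, so that independence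
  applies.\<close>

lemma natural_scale_add: "natural_scale \<theta> (x + y) = natural_scale \<theta> x + exp (- \<theta> * x) * natural_scale \<theta> y"
  by (auto simp: natural_scale_def field_simps simp flip: exp_add)

lemma continuous_on_natural_scale [continuous_intros]:
  "continuous_on A f \<Longrightarrow> continuous_on A (\<lambda>x. natural_scale \<theta> (f x))"
  unfolding natural_scale_def by (cases "\<theta> = 0") (auto intro!: continuous_intros)

lemma borel_measurable_natural_scale [measurable]: "natural_scale \<theta> \<in> borel_measurable borel"
  by (intro borel_measurable_continuous_onI continuous_intros)

lemma strict_mono_natural_scale: "strict_mono (natural_scale \<theta>)"
proof (rule strict_monoI)
  fix x y :: real
  assume "x < y"
  have "natural_scale \<theta> (y - x) > 0"
  proof (cases "\<theta> > 0")
    case True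
    then have "exp (- \<theta> * (y - x)) < 1" using \<open>x < y\<close> by (simp add: mult_neg_pos)
    then show ?thesis using True by (simp add: natural_scale_def)
  next
    case False
    show ?thesis
    proof (cases "\<theta> = 0")
      case False
      with \<open>\<not> \<theta> > 0\<close> have "exp (- \<theta> * (y - x)) > 1" using \<open>x < y\<close>
        by (simp add: mult_less_0_iff mult_neg_pos)
      then show ?thesis using \<open>\<not> \<theta> > 0\<close> False by (simp add: natural_scale_def divide_neg_neg)
    qed (use \<open>x < y\<close> in \<open>simp add: natural_scale_def\<close>)
  qed
  then show "natural_scale \<theta> x < natural_scale \<theta> y"
    using natural_scale_add[of \<theta> x "y - x"] by simp
qed

lemma natural_scale_less_iff [simp]: "natural_scale \<theta> x < natural_scale \<theta> y \<longleftrightarrow> x < y"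
  and natural_scale_le_iff [simp]: "natural_scale \<theta> x \<le> natural_scale \<theta> y \<longleftrightarrow> x \<le> y"
  and natural_scale_eq_iff [simp]: "natural_scale \<theta> x = natural_scale \<theta> y \<longleftrightarrow> x = y"
  using strict_mono_natural_scale[of \<theta>]
  by (auto simp: strict_mono_less strict_mono_less_eq strict_mono_eq)

lemma natural_scale_nonneg: "0 \<le> x \<Longrightarrow> 0 \<le> natural_scale \<theta> x"
  using natural_scale_le_iff[of \<theta> 0 x] by (simp del: natural_scale_le_iff)

text \<open>Growth of this kind is integrable against every normal law;
  \<open>martingale_increment\<close> asks for it in the same form.\<close>

lemma natural_scale_bound: obtains C c where "0 \<le> c" "\<And>x. \<bar>natural_scale \<theta> x\<bar> \<le> C * exp (c * \<bar>x\<bar>)"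
proof (cases "\<theta> = 0")
  case True
  have "\<bar>natural_scale \<theta> x\<bar> \<le> 1 * exp (1 * \<bar>x\<bar>)" for x
    using True exp_ge_add_one_self[of "\<bar>x\<bar>"] by (simp add: natural_scale_def del: exp_ge_add_one_self)
  then show ?thesis using that[of 1 1] by simp
next
  case False
  have "\<bar>natural_scale \<theta> x\<bar> \<le> (2 / \<bar>\<theta>\<bar>) * exp (\<bar>\<theta>\<bar> * \<bar>x\<bar>)" for x
  proof -
    have "exp (- \<theta> * x) \<le> exp (\<bar>\<theta>\<bar> * \<bar>x\<bar>)"
      by (simp flip: abs_mult)
    moreover have "1 \<le> exp (\<bar>\<theta>\<bar> * \<bar>x\<bar>)" by simp
    ultimately have "\<bar>1 - exp (- \<theta> * x)\<bar> \<le> 2 * exp (\<bar>\<theta>\<bar> * \<bar>x\<bar>)"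
      using exp_gt_zero[of "- \<theta> * x"] by linarith
    then show ?thesis using False by (simp add: natural_scale_def abs_divide divide_right_mono)
  qed
  then show ?thesis using that[of "\<bar>\<theta>\<bar>" "2 / \<bar>\<theta>\<bar>"] by simp
qed

text \<open>Completing the square: tilting by exp (c x) shifts the mean of the centered density to
  \<open>c * s\<^sup>2\<close> and leaves a constant factor.\<close>

lemma normal_density_exp:
  assumes "s > 0"
  shows "has_bochner_integral lborel (\<lambda>x. normal_density 0 s x * exp (c * x)) (exp (c\<^sup>2 * s\<^sup>2 / 2))"
proof -
  have "normal_density 0 s x * exp (c * x) = exp (c\<^sup>2 * s\<^sup>2 / 2) * normal_density (c * s\<^sup>2) s x" for x
  proof -
    have "- x\<^sup>2 / (2 * s\<^sup>2) + c * x = c\<^sup>2 * s\<^sup>2 / 2 + (- (x - c * s\<^sup>2)\<^sup>2 / (2 * s\<^sup>2))"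
      using assms by (simp add: field_simps power2_eq_square)
    then show ?thesis
      by (simp add: normal_density_def mult_ac flip: exp_add)
  qed
  moreover have "has_bochner_integral lborel (\<lambda>x. exp (c\<^sup>2 * s\<^sup>2 / 2) * normal_density (c * s\<^sup>2) s x)
     (exp (c\<^sup>2 * s\<^sup>2 / 2) * 1)"
    using assms by (intro has_bochner_integral_mult_right)
      (simp add: has_bochner_integral_iff)
  ultimately show ?thesis by simp
qed

text \<open>Bounded second moments give uniform integrability. Fatou bounds the second moment of the
  limit; then |f n - g| is split at a height \<open>K\<close>, where the truncated part vanishes by
  dominated convergence and the rest is at most (f n - g)^2 / K.\<close>

lemma (in prob_space) integral_eq_limit_of_L2_bounded:
  fixes f :: "nat \<Rightarrow> 'a \<Rightarrow> real"
  assumes [measurable]: "\<And>n. f n \<in> borel_measurable M" "\<And>n. integrable M (\<lambda>x. (f n x)\<^sup>2)"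
    and lim: "\<And>x. x \<in> space M \<Longrightarrow> (\<lambda>n. f n x) \<longlonglongrightarrow> g x"
    and bound: "\<And>n. (\<integral>x. (f n x)\<^sup>2 \<partial>M) \<le> C"
    and mean: "\<And>n. (\<integral>x. f n x \<partial>M) = m"
  shows "integrable M g" "(\<integral>x. g x \<partial>M) = m"
proof -
  have gm[measurable]: "g \<in> borel_measurable M"
    using lim by (rule borel_measurable_LIMSEQ_real) measurable
  have C0: "C \<ge> 0" using order_trans[OF Bochner_Integration.integral_nonneg bound[of 0]] by simp
  have fint: "integrable M (f n)" for n
    by (rule square_integrable_imp_integrable[OF assms(1) assms(2)])
  have nn: "(\<integral>\<^sup>+x. ennreal ((f n x)\<^sup>2) \<partial>M) \<le> ennreal C" for n
    using nn_integral_eq_integral[OF assms(2)[of n]] bound[of n] by (simp add: ennreal_leI)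
  have "(\<integral>\<^sup>+x. ennreal ((g x)\<^sup>2) \<partial>M) = (\<integral>\<^sup>+x. liminf (\<lambda>n. ennreal ((f n x)\<^sup>2)) \<partial>M)"
  proof (rule nn_integral_cong)
    fix x assume "x \<in> space M"
    then have "(\<lambda>n. ennreal ((f n x)\<^sup>2)) \<longlonglongrightarrow> ennreal ((g x)\<^sup>2)"
      using lim by (intro tendsto_intros) auto
    then show "ennreal ((g x)\<^sup>2) = liminf (\<lambda>n. ennreal ((f n x)\<^sup>2))"
      by (intro lim_imp_Liminf[symmetric]) auto
  qed
  also have "\<dots> \<le> liminf (\<lambda>n. \<integral>\<^sup>+x. ennreal ((f n x)\<^sup>2) \<partial>M)"
    by (rule nn_integral_liminf) measurable
  also have "\<dots> \<le> ennreal C"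
    using nn by (intro Liminf_le) auto
  finally have gC: "(\<integral>\<^sup>+x. ennreal ((g x)\<^sup>2) \<partial>M) \<le> ennreal C" .
  then have g2: "integrable M (\<lambda>x. (g x)\<^sup>2)"
    by (intro integrableI_bounded) (auto simp: less_top[symmetric] top_unique)
  then show gint: "integrable M g"
    by (rule square_integrable_imp_integrable[OF gm])
  have g2C: "(\<integral>x. (g x)\<^sup>2 \<partial>M) \<le> C"
    using gC nn_integral_eq_integral[OF g2] C0 by (simp add: )
  have "(\<lambda>n. (\<integral>x. f n x \<partial>M) - (\<integral>x. g x \<partial>M)) \<longlonglongrightarrow> 0"
  proof (rule LIMSEQ_I)
    fix e :: real assume "e > 0"
    \<comment> \<open>The part above \<open>K\<close> costs at most 4 C / K, which this choice makes
      at most e / 2; C + 1 keeps \<open>K\<close> positive when C = 0.\<close>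
    define K where "K = 8 * (C + 1) / e"
    have K: "K > 0" using \<open>e > 0\<close> C0 by (simp add: K_def)
    have "(\<lambda>n. \<integral>x. min \<bar>f n x - g x\<bar> K \<partial>M) \<longlonglongrightarrow> (\<integral>x. min 0 K \<partial>M)"
    proof (rule integral_dominated_convergence[where w="\<lambda>_. K"])
      show "AE x in M. (\<lambda>n. min \<bar>f n x - g x\<bar> K) \<longlonglongrightarrow> min 0 K"
      proof (rule AE_I2)
        fix x assume "x \<in> space M"
        then have "(\<lambda>n. f n x - g x) \<longlonglongrightarrow> g x - g x" by (intro tendsto_intros lim)
        then have "(\<lambda>n. \<bar>f n x - g x\<bar>) \<longlonglongrightarrow> 0" by (simp add: tendsto_rabs_zero)
        then show "(\<lambda>n. min \<bar>f n x - g x\<bar> K) \<longlonglongrightarrow> min 0 K" by (intro tendsto_min tendsto_const)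
      qed
    qed (use K in \<open>auto simp: min_def\<close>)
    then have "(\<lambda>n. \<integral>x. min \<bar>f n x - g x\<bar> K \<partial>M) \<longlonglongrightarrow> 0" using K by simp
    from LIMSEQ_D[OF this, of "e/2"] \<open>e > 0\<close>
    obtain n0 where n0: "\<And>n. n \<ge> n0 \<Longrightarrow> \<bar>\<integral>x. min \<bar>f n x - g x\<bar> K \<partial>M\<bar> < e/2" by auto
    show "\<exists>no. \<forall>n\<ge>no. norm ((\<integral>x. f n x \<partial>M) - (\<integral>x. g x \<partial>M) - 0) < e"
    proof (intro exI allI impI)
      fix n assume n: "n \<ge> n0"
      have le: "\<bar>f n x - g x\<bar> \<le> min \<bar>f n x - g x\<bar> K + (2 * (f n x)\<^sup>2 + 2 * (g x)\<^sup>2) / K" for x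
      proof (cases "\<bar>f n x - g x\<bar> \<le> K")
        case True then show ?thesis using K by simp
      next
        case False
        then have "\<bar>f n x - g x\<bar> * K \<le> \<bar>f n x - g x\<bar> * \<bar>f n x - g x\<bar>"
          by (intro mult_left_mono) auto
        also have "\<dots> = (f n x - g x)\<^sup>2" by (simp add: power2_eq_square)
        also have "\<dots> \<le> 2 * (f n x)\<^sup>2 + 2 * (g x)\<^sup>2"
          using zero_le_power2[of "f n x + g x"] by (simp add: power2_eq_square algebra_simps)
        finally have "\<bar>f n x - g x\<bar> \<le> (2 * (f n x)\<^sup>2 + 2 * (g x)\<^sup>2) / K"
          using K by (simp add: pos_le_divide_eq)
        then show ?thesis using K by simp
      qed
      have mi: "integrable M (\<lambda>x. min \<bar>f n x - g x\<bar> K)"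
        using fint gint by (intro integrable_min) auto
      have "\<bar>(\<integral>x. f n x \<partial>M) - (\<integral>x. g x \<partial>M)\<bar> = \<bar>\<integral>x. f n x - g x \<partial>M\<bar>"
        using fint gint by simp
      also have "\<dots> \<le> (\<integral>x. \<bar>f n x - g x\<bar> \<partial>M)"
        using integral_norm_bound[of M "\<lambda>x. f n x - g x"] by simp
      also have "\<dots> \<le> (\<integral>x. min \<bar>f n x - g x\<bar> K + (2 * (f n x)\<^sup>2 + 2 * (g x)\<^sup>2) / K \<partial>M)"
        using fint gint mi assms(2) g2 le by (intro integral_mono) auto
      also have "\<dots> = (\<integral>x. min \<bar>f n x - g x\<bar> K \<partial>M) + (2 * (\<integral>x. (f n x)\<^sup>2 \<partial>M) + 2 * (\<integral>x. (g x)\<^sup>2 \<partial>M)) / K"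
        using mi assms(2) g2 by simp
      also have "\<dots> \<le> (\<integral>x. min \<bar>f n x - g x\<bar> K \<partial>M) + (4 * C) / K"
        using bound[of n] g2C K by (intro add_left_mono divide_right_mono) auto
      also have "\<dots> < e/2 + e/2"
      proof (rule add_less_le_mono)
        show "(\<integral>x. min \<bar>f n x - g x\<bar> K \<partial>M) < e/2" using n0[OF n] by linarith
        have "4 * C * e \<le> 4 * (C + 1) * e" using \<open>e > 0\<close> by simp
        then show "4 * C / K \<le> e/2" using \<open>e > 0\<close> C0 by (simp add: K_def field_simps)
      qed
      finally show "norm ((\<integral>x. f n x \<partial>M) - (\<integral>x. g x \<partial>M) - 0) < e" by simp
    qed
  qed
  then show "(\<integral>x. g x \<partial>M) = m"
    by (simp add: mean LIMSEQ_const_iff)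
qed

section \<open>Brownian filtration and independent increments\<close>

locale brownian = prob_space M for M :: "'a measure" and W :: "real \<Rightarrow> 'a \<Rightarrow> real" +
  assumes bm: "brownian_motion M W"
begin

abbreviation F :: "ennreal \<Rightarrow> 'a measure" where "F \<equiv> natural_filtration M W"

lemma W_meas [measurable]: "0 \<le> t \<Longrightarrow> W t \<in> borel_measurable M"
  using bm by (simp add: brownian_motion_def)

lemma W_0: "\<omega> \<in> space M \<Longrightarrow> W 0 \<omega> = 0"
  using bm by (simp add: brownian_motion_def)

lemma W_cont: "\<omega> \<in> space M \<Longrightarrow> continuous_on {0..} (\<lambda>t. W t \<omega>)"
  using bm by (simp add: brownian_motion_def)

lemma space_F [simp]: "space (F t) = space M"
  by (auto simp: natural_filtration_def intro!: space_measure_of)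

lemma sets_F: "sets (F t) = sigma_sets (space M)
      {W s -` A \<inter> space M | s A. 0 \<le> s \<and> ennreal s \<le> t \<and> A \<in> sets borel}"
  by (auto simp: natural_filtration_def intro!: sets_measure_of)

lemma sets_F_subset: "sets (F t) \<subseteq> sets M"
  unfolding sets_F by (rule sets.sigma_sets_subset) (auto intro!: measurable_sets)

lemma sets_F_mono: "s \<le> t \<Longrightarrow> sets (F s) \<subseteq> sets (F t)"
  unfolding sets_F by (rule sigma_sets_mono') (blast intro: order_trans)

lemma W_F [measurable]: "0 \<le> s \<Longrightarrow> ennreal s \<le> t \<Longrightarrow> W s \<in> borel_measurable (F t)"
  by (rule measurableI) (auto simp: sets_F intro!: sigma_sets.Basic)

lemma measurable_F: "f \<in> measurable (F t) N \<Longrightarrow> f \<in> measurable M N"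
  using sets_F_subset by (auto simp: measurable_def)

lemma distr_increment: "0 \<le> s \<Longrightarrow> s < t \<Longrightarrow>
  distributed M lborel (\<lambda>\<omega>. W t \<omega> - W s \<omega>) (normal_density 0 (sqrt (t - s)))"
  using bm by (simp add: brownian_motion_def)

lemma indep_increment:
  fixes f :: "'a \<Rightarrow> real" and g :: "real \<Rightarrow> real"
  assumes "0 \<le> s" "s < t" "f \<in> borel_measurable (F s)" "g \<in> borel_measurable borel"
  shows "indep_var borel f borel (\<lambda>\<omega>. g (W t \<omega> - W s \<omega>))"
proof -
  let ?D = "\<lambda>\<omega>. W t \<omega> - W s \<omega>"
  have [measurable]: "?D \<in> borel_measurable M" using assms by (intro borel_measurable_diff W_meas) auto
  have "indep_set (sets (F s)) (sets (vimage_algebra (space M) ?D borel))"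
    using bm assms by (simp add: brownian_motion_def)
  moreover have "sigma_sets (space M) {f -` A \<inter> space M | A. A \<in> sets borel} \<subseteq> sets (F s)"
    using measurable_sets[OF assms(3)] by (intro sets.sigma_sets_subset[of _ "F s", simplified]) auto
  moreover have "sigma_sets (space M) {?D -` A \<inter> space M | A. A \<in> sets borel} = sets (vimage_algebra (space M) ?D borel)"
    by (simp add: sets_vimage_algebra)
  ultimately have "indep_set (sigma_sets (space M) {f -` A \<inter> space M | A. A \<in> sets borel})
     (sigma_sets (space M) {?D -` A \<inter> space M | A. A \<in> sets borel})"
    unfolding indep_set_def by (elim indep_sets_mono_sets) (simp split: bool.split)
  then have "indep_var borel f borel ?D"
    using measurable_F[OF assms(3)] by (simp add: indep_var_eq)
  then have "indep_var borel ((\<lambda>x. x) \<circ> f) borel (g \<circ> ?D)"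
    by (rule indep_var_compose) (use assms in auto)
  then show ?thesis by (simp add: o_def)
qed

lemma integrable_exp_bounded:
  assumes "0 \<le> s" and [measurable]: "f \<in> borel_measurable borel" and "0 \<le> c"
    and b: "\<And>w. \<bar>f w\<bar> \<le> C * exp (c * \<bar>w\<bar>)"
  shows "integrable M (\<lambda>\<omega>. f (W s \<omega>))"
\<comment> \<open>At time 0 the law of \<open>W\<close> is a point mass and has no density.\<close>
proof (cases "s = 0")
  case True
  then have "integrable M (\<lambda>\<omega>. f (W s \<omega>)) \<longleftrightarrow> integrable M (\<lambda>\<omega>. f 0)"
    by (intro Bochner_Integration.integrable_cong) (auto simp: W_0)
  then show ?thesis by simp
next
  case False
  with assms have "s > 0" by simp
  then have d: "distributed M lborel (\<lambda>\<omega>. W s \<omega> - W 0 \<omega>) (normal_density 0 (sqrt s))"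
    using distr_increment[of 0 s] by simp
  have "integrable lborel (\<lambda>x. normal_density 0 (sqrt s) x * f x)"
  proof (rule Bochner_Integration.integrable_bound)
    show "integrable lborel (\<lambda>x. \<bar>C\<bar> * (normal_density 0 (sqrt s) x * exp (c * x) + normal_density 0 (sqrt s) x * exp (- c * x)))"
      using normal_density_exp[of "sqrt s" c] normal_density_exp[of "sqrt s" "-c"] \<open>s > 0\<close>
      by (intro integrable_mult_right Bochner_Integration.integrable_add) (simp_all add: has_bochner_integral_iff)
    have "\<bar>f x\<bar> \<le> \<bar>C\<bar> * (exp (c * x) + exp (- c * x))" for x
    proof -
      have "\<bar>f x\<bar> \<le> \<bar>C\<bar> * exp (c * \<bar>x\<bar>)"
        using b[of x] by (rule order_trans) (intro mult_right_mono, auto)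
      also have "\<dots> \<le> \<bar>C\<bar> * (exp (c * x) + exp (- c * x))"
        by (intro mult_left_mono) (auto simp: abs_if)
      finally show ?thesis .
    qed
    then have "normal_density 0 (sqrt s) x * \<bar>f x\<bar> \<le> normal_density 0 (sqrt s) x * (\<bar>C\<bar> * (exp (c * x) + exp (- c * x)))" for x
      by (intro mult_left_mono) auto
    then show "AE x in lborel. norm (normal_density 0 (sqrt s) x * f x) \<le>
        norm (\<bar>C\<bar> * (normal_density 0 (sqrt s) x * exp (c * x) + normal_density 0 (sqrt s) x * exp (- c * x)))"
      by (auto simp: abs_mult algebra_simps)
  qed measurable
  then have "integrable M (\<lambda>\<omega>. f (W s \<omega> - W 0 \<omega>))"
    using distributed_integrable[OF d, of f] by simp
  also have "?this \<longleftrightarrow> ?thesis"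
    by (intro Bochner_Integration.integrable_cong) (auto simp: W_0)
  finally show ?thesis .
qed

end

section \<open>The scale of the drifted path as a martingale\<close>

locale drifted_brownian = brownian +
  fixes \<mu> \<sigma> x \<theta> :: real
  assumes \<sigma>: "\<sigma> > 0" and \<theta>: "\<theta> = 2 * \<mu> / \<sigma>\<^sup>2"
begin

abbreviation X :: "real \<Rightarrow> 'a \<Rightarrow> real" where "X \<equiv> drifted_path W \<mu> \<sigma> x"

lemma X_F [measurable]: "0 \<le> s \<Longrightarrow> ennreal s \<le> t \<Longrightarrow> X s \<in> borel_measurable (F t)"
  unfolding drifted_path_def by measurable

lemma X_meas [measurable]: "0 \<le> s \<Longrightarrow> X s \<in> borel_measurable M"
  unfolding drifted_path_def by measurable

lemma X_0: "\<omega> \<in> space M \<Longrightarrow> X 0 \<omega> = x"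
  by (simp add: drifted_path_def W_0)

lemma X_cont: "\<omega> \<in> space M \<Longrightarrow> continuous_on {0..} (\<lambda>t. X t \<omega>)"
  unfolding drifted_path_def by (intro continuous_intros W_cont)

lemma integrable_of_X:
  assumes "0 \<le> s" and [measurable]: "f \<in> borel_measurable borel" and c: "0 \<le> c"
    and b: "\<And>w. \<bar>f w\<bar> \<le> C * exp (c * \<bar>w\<bar>)"
  shows "integrable M (\<lambda>\<omega>. f (X s \<omega>))"
  unfolding drifted_path_def
proof (rule integrable_exp_bounded[OF assms(1), where f="\<lambda>w. f (x + \<mu> * s + \<sigma> * w)"])
  show "0 \<le> c * \<sigma>" using c \<sigma> by simp
  fix w
  have "\<bar>f (x + \<mu> * s + \<sigma> * w)\<bar> \<le> \<bar>C\<bar> * exp (c * \<bar>x + \<mu> * s + \<sigma> * w\<bar>)"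
    using b by (rule order_trans) (intro mult_right_mono, auto)
  also have "\<dots> \<le> \<bar>C\<bar> * exp (c * (\<bar>x + \<mu> * s\<bar> + \<sigma> * \<bar>w\<bar>))"
    using c \<sigma> abs_triangle_ineq[of "x + \<mu> * s" "\<sigma> * w"]
    by (intro mult_left_mono) (auto simp: abs_mult intro!: mult_left_mono)
  also have "\<dots> = \<bar>C\<bar> * exp (c * \<bar>x + \<mu> * s\<bar>) * exp (c * \<sigma> * \<bar>w\<bar>)"
    by (simp add: algebra_simps exp_add)
  finally show "\<bar>f (x + \<mu> * s + \<sigma> * w)\<bar> \<le> \<bar>C\<bar> * exp (c * \<bar>x + \<mu> * s\<bar>) * exp (c * \<sigma> * \<bar>w\<bar>)" .
qed measurable

abbreviation Y :: "real \<Rightarrow> 'a \<Rightarrow> real" where "Y t \<omega> \<equiv> natural_scale \<theta> (X t \<omega>)"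

text \<open>Here \<theta> = 2 \<mu> / \<sigma>^2 is forced: only then do the drift and the exponent
  of the normal moment generating function cancel.\<close>

lemma increment_mean_zero:
  assumes "0 \<le> s" "s < t"
  shows "integrable M (\<lambda>\<omega>. natural_scale \<theta> (\<mu> * (t - s) + \<sigma> * (W t \<omega> - W s \<omega>)))"
    and "(\<integral>\<omega>. natural_scale \<theta> (\<mu> * (t - s) + \<sigma> * (W t \<omega> - W s \<omega>)) \<partial>M) = 0"
proof -
  let ?d = "t - s"
  let ?f = "\<lambda>w. natural_scale \<theta> (\<mu> * ?d + \<sigma> * w)"
  note d = distr_increment[OF assms]
  have "has_bochner_integral lborel (\<lambda>w. normal_density 0 (sqrt ?d) w * ?f w) 0"
  proof (cases "\<theta> = 0")
    case True
    with \<theta> \<sigma> have "\<mu> = 0" by simp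
    then have "has_bochner_integral lborel (\<lambda>w. \<sigma> * (normal_density 0 (sqrt ?d) w * w)) (\<sigma> * 0)"
      using assms by (intro has_bochner_integral_mult_right normal_moment_nz_1) auto
    then show ?thesis using True \<open>\<mu> = 0\<close> by (simp add: natural_scale_def mult_ac)
  next
    case False
    have "has_bochner_integral lborel (normal_density 0 (sqrt ?d)) 1"
      using assms by (simp add: has_bochner_integral_iff)
    moreover have "has_bochner_integral lborel (\<lambda>w. normal_density 0 (sqrt ?d) w * exp ((- \<theta> * \<sigma>) * w))
        (exp ((- \<theta> * \<sigma>)\<^sup>2 * (sqrt ?d)\<^sup>2 / 2))"
      using assms by (intro normal_density_exp) auto
    ultimately have "has_bochner_integral lborel
       (\<lambda>w. (1 / \<theta>) * (normal_density 0 (sqrt ?d) w - exp (- \<theta> * \<mu> * ?d) * (normal_density 0 (sqrt ?d) w * exp ((- \<theta> * \<sigma>) * w))))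
       ((1 / \<theta>) * (1 - exp (- \<theta> * \<mu> * ?d) * exp ((- \<theta> * \<sigma>)\<^sup>2 * (sqrt ?d)\<^sup>2 / 2)))"
      by (intro has_bochner_integral_mult_right has_bochner_integral_diff)
    moreover have "- \<theta> * \<mu> * ?d + (- \<theta> * \<sigma>)\<^sup>2 * (sqrt ?d)\<^sup>2 / 2 = 0"
      using assms \<sigma> by (simp add: \<theta> field_simps power2_eq_square)
    then have "exp (- \<theta> * \<mu> * ?d) * exp ((- \<theta> * \<sigma>)\<^sup>2 * (sqrt ?d)\<^sup>2 / 2) = 1"
      by (simp only: exp_add[symmetric] exp_zero)
    moreover have "(1 / \<theta>) * (normal_density 0 (sqrt ?d) w - exp (- \<theta> * \<mu> * ?d) * (normal_density 0 (sqrt ?d) w * exp ((- \<theta> * \<sigma>) * w)))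
      = normal_density 0 (sqrt ?d) w * ?f w" for w
    proof -
      have "exp (- \<theta> * (\<mu> * ?d + \<sigma> * w)) = exp (- \<theta> * \<mu> * ?d) * exp ((- \<theta> * \<sigma>) * w)"
        by (simp add: algebra_simps flip: exp_add)
      then have "?f w = (1 / \<theta>) * (1 - exp (- \<theta> * \<mu> * ?d) * exp ((- \<theta> * \<sigma>) * w))"
        using False by (simp only: natural_scale_def if_False) simp
      then show ?thesis by (simp only: right_diff_distrib) (simp only: mult_ac mult_1_right)
    qed
    ultimately show ?thesis by simp
  qed
  then show "integrable M (\<lambda>\<omega>. ?f (W t \<omega> - W s \<omega>))" "(\<integral>\<omega>. ?f (W t \<omega> - W s \<omega>) \<partial>M) = 0"
    using distributed_integrable[OF d, of ?f] distributed_integral[OF d, of ?f]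
    by (auto simp: has_bochner_integral_iff)
qed

text \<open>Martingale property on an event of the past, weighted by a function of the present. The
  weight 1 gives constant means; the weight \<open>natural_scale \<theta>\<close> gives the
  orthogonality of increments that controls second moments.\<close>

lemma martingale_increment:
  assumes "0 \<le> s" "s \<le> t" and [measurable]: "A \<in> sets (F s)" "\<phi> \<in> borel_measurable borel"
    and "0 \<le> c" and b: "\<And>w. \<bar>\<phi> w\<bar> \<le> C * exp (c * \<bar>w\<bar>)"
  shows "integrable M (\<lambda>\<omega>. indicator A \<omega> * \<phi> (X s \<omega>) * (Y t \<omega> - Y s \<omega>))"
    and "(\<integral>\<omega>. indicator A \<omega> * \<phi> (X s \<omega>) * (Y t \<omega> - Y s \<omega>) \<partial>M) = 0"
proof -
  let ?f = "\<lambda>\<omega>. indicator A \<omega> * (\<phi> (X s \<omega>) * exp (- \<theta> * X s \<omega>))"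
  let ?g = "\<lambda>w. natural_scale \<theta> (\<mu> * (t - s) + \<sigma> * w)"
  have A[measurable]: "A \<in> sets M" using assms(3) sets_F_subset by blast
  have eq: "indicator A \<omega> * \<phi> (X s \<omega>) * (Y t \<omega> - Y s \<omega>) = ?f \<omega> * ?g (W t \<omega> - W s \<omega>)" for \<omega>
  proof -
    have "X t \<omega> = X s \<omega> + (\<mu> * (t - s) + \<sigma> * (W t \<omega> - W s \<omega>))"
      by (simp add: drifted_path_def algebra_simps)
    then have "Y t \<omega> - Y s \<omega> = exp (- \<theta> * X s \<omega>) * ?g (W t \<omega> - W s \<omega>)"
      by (simp only: natural_scale_add)
    then show ?thesis by (simp add: mult_ac)
  qed
  have "integrable M (\<lambda>\<omega>. (\<lambda>w. \<phi> w * exp (- \<theta> * w)) (X s \<omega>))"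
  proof (rule integrable_of_X[OF assms(1)])
    show "0 \<le> c + \<bar>\<theta>\<bar>" using \<open>0 \<le> c\<close> by simp
    fix w
    have "exp (- \<theta> * w) \<le> exp (\<bar>\<theta>\<bar> * \<bar>w\<bar>)" by (simp flip: abs_mult)
    then have "\<bar>\<phi> w\<bar> * exp (- \<theta> * w) \<le> (C * exp (c * \<bar>w\<bar>)) * exp (\<bar>\<theta>\<bar> * \<bar>w\<bar>)"
      by (intro mult_mono b order_trans[OF abs_ge_zero b]) auto
    also have "\<dots> = C * exp ((c + \<bar>\<theta>\<bar>) * \<bar>w\<bar>)"
      by (simp add: algebra_simps exp_add)
    finally show "\<bar>\<phi> w * exp (- \<theta> * w)\<bar> \<le> C * exp ((c + \<bar>\<theta>\<bar>) * \<bar>w\<bar>)"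
      by (simp add: abs_mult)
  qed measurable
  then have "integrable M (\<lambda>\<omega>. indicator A \<omega> *\<^sub>R (\<lambda>w. \<phi> w * exp (- \<theta> * w)) (X s \<omega>))"
    by (intro integrable_mult_indicator[OF A])
  then have fi: "integrable M ?f" by (simp add: mult_ac)
  have "integrable M (\<lambda>\<omega>. ?f \<omega> * ?g (W t \<omega> - W s \<omega>)) \<and> (\<integral>\<omega>. ?f \<omega> * ?g (W t \<omega> - W s \<omega>) \<partial>M) = 0"
  proof (cases "s = t")
    case False
    then have "s < t" using assms by simp
    have fm: "?f \<in> borel_measurable (F s)" using assms(1) by measurable
    have iv: "indep_var borel ?f borel (\<lambda>\<omega>. ?g (W t \<omega> - W s \<omega>))"
      by (rule indep_increment[OF assms(1) \<open>s < t\<close> fm]) measurable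
    note inc = increment_mean_zero[OF assms(1) \<open>s < t\<close>]
    have i0: "(\<integral>\<omega>. ?f \<omega> * ?g (W t \<omega> - W s \<omega>) \<partial>M) = 0"
      using indep_var_lebesgue_integral[OF iv fi inc(1)] inc(2) by simp
    have i1: "integrable M (\<lambda>\<omega>. ?f \<omega> * ?g (W t \<omega> - W s \<omega>))"
      using indep_var_integrable[OF iv fi inc(1)] .
    show ?thesis using i0 i1 by blast
  qed simp
  then show "integrable M (\<lambda>\<omega>. indicator A \<omega> * \<phi> (X s \<omega>) * (Y t \<omega> - Y s \<omega>))"
    "(\<integral>\<omega>. indicator A \<omega> * \<phi> (X s \<omega>) * (Y t \<omega> - Y s \<omega>) \<partial>M) = 0"
    unfolding eq by blast+
qed

lemma integrable_Y: "0 \<le> t \<Longrightarrow> integrable M (Y t)"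
  and integrable_Y2: "0 \<le> t \<Longrightarrow> integrable M (\<lambda>\<omega>. (Y t \<omega>)\<^sup>2)"
proof -
  assume t: "0 \<le> t"
  obtain C c where C: "0 \<le> c" "\<And>x. \<bar>natural_scale \<theta> x\<bar> \<le> C * exp (c * \<bar>x\<bar>)" using natural_scale_bound by blast
  show "integrable M (Y t)"
    using integrable_of_X[OF t _ C] by simp
  have "\<bar>(natural_scale \<theta> w)\<^sup>2\<bar> \<le> C\<^sup>2 * exp (2 * c * \<bar>w\<bar>)" for w
  proof -
    have "\<bar>natural_scale \<theta> w\<bar>\<^sup>2 \<le> (C * exp (c * \<bar>w\<bar>))\<^sup>2" using C(2) by (intro power_mono) auto
    also have "\<dots> = C\<^sup>2 * exp (2 * c * \<bar>w\<bar>)"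
      by (simp add: power_mult_distrib mult_ac exp_double[symmetric])
    finally show ?thesis by simp
  qed
  then show "integrable M (\<lambda>\<omega>. (Y t \<omega>)\<^sup>2)"
    using C(1) by (intro integrable_of_X[OF t, where f="\<lambda>w. (natural_scale \<theta> w)\<^sup>2" and c="2*c" and C="C\<^sup>2"]) auto
qed

lemma integral_Y: "0 \<le> t \<Longrightarrow> (\<integral>\<omega>. Y t \<omega> \<partial>M) = natural_scale \<theta> x"
proof -
  assume t: "0 \<le> t"
  have "(\<integral>\<omega>. indicator (space M) \<omega> * 1 * (Y t \<omega> - Y 0 \<omega>) \<partial>M) = 0"
    using martingale_increment(2)[OF _ t, of "space M" "\<lambda>_. 1" 0 1] sets.top[of "F (ennreal 0)"] by simp
  also have "(\<integral>\<omega>. indicator (space M) \<omega> * 1 * (Y t \<omega> - Y 0 \<omega>) \<partial>M) = (\<integral>\<omega>. Y t \<omega> - natural_scale \<theta> x \<partial>M)"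
    by (rule Bochner_Integration.integral_cong) (auto simp: X_0)
  also have "\<dots> = (\<integral>\<omega>. Y t \<omega> \<partial>M) - natural_scale \<theta> x"
    using integrable_Y[OF t] by (simp add: prob_space)
  finally show ?thesis by simp
qed

text \<open>Splitting over the finitely many values of \<open>S\<close> reduces everything to fixed
  times s, where \<open>Y s\<close> can be exchanged for \<open>Y T\<close> on the event S =
  s.\<close>

lemma discrete_optional_stopping:
  fixes S :: "'a \<Rightarrow> real"
  assumes I: "finite I" "I \<subseteq> {0..T}" and S: "\<And>\<omega>. \<omega> \<in> space M \<Longrightarrow> S \<omega> \<in> I"
    and A: "\<And>s. s \<in> I \<Longrightarrow> {\<omega> \<in> space M. S \<omega> = s} \<in> sets (F (ennreal s))" and T: "0 \<le> T"
  shows "(\<lambda>\<omega>. Y (S \<omega>) \<omega>) \<in> borel_measurable M"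
    and "integrable M (\<lambda>\<omega>. (Y (S \<omega>) \<omega>)\<^sup>2)"
    and "(\<integral>\<omega>. (Y (S \<omega>) \<omega>)\<^sup>2 \<partial>M) \<le> (\<integral>\<omega>. (Y T \<omega>)\<^sup>2 \<partial>M)"
    and "(\<integral>\<omega>. Y (S \<omega>) \<omega> \<partial>M) = natural_scale \<theta> x"
proof -
  define A where "A s = {\<omega> \<in> space M. S \<omega> = s}" for s
  have AF: "A s \<in> sets (F s)" if "s \<in> I" for s using assms(4)[OF that] by (simp add: A_def)
  have AM[measurable]: "A s \<in> sets M" if "s \<in> I" for s using AF[OF that] sets_F_subset by blast
  have I0: "0 \<le> s" "s \<le> T" if "s \<in> I" for s using I that by auto
  have split: "f (S \<omega>) \<omega> = (\<Sum>s\<in>I. indicator (A s) \<omega> * f s \<omega>)" if "\<omega> \<in> space M" for \<omega> and f :: "real \<Rightarrow> 'a \<Rightarrow> real"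
  proof -
    have "(\<Sum>s\<in>I. indicator (A s) \<omega> * f s \<omega>) = (\<Sum>s\<in>I. if s = S \<omega> then f s \<omega> else 0)"
      using that by (intro sum.cong) (auto simp: A_def indicator_def)
    then show ?thesis using I S[OF that] by simp
  qed
  obtain C c where C: "0 \<le> c" "\<And>x. \<bar>natural_scale \<theta> x\<bar> \<le> C * exp (c * \<bar>x\<bar>)" using natural_scale_bound by blast
  have iA: "integrable M (\<lambda>\<omega>. indicator (A s) \<omega> * f \<omega>)" if "s \<in> I" "integrable M f" for s and f :: "'a \<Rightarrow> real"
    using integrable_mult_indicator[OF AM[OF that(1)] that(2)] by simp
  show "(\<lambda>\<omega>. Y (S \<omega>) \<omega>) \<in> borel_measurable M"
  proof (subst measurable_cong[OF split[of _ Y]])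
    show "(\<lambda>\<omega>. \<Sum>s\<in>I. indicator (A s) \<omega> * Y s \<omega>) \<in> borel_measurable M"
      using I0 by (intro borel_measurable_sum) measurable
  qed
  have "integrable M (\<lambda>\<omega>. (Y (S \<omega>) \<omega>)\<^sup>2) \<longleftrightarrow> integrable M (\<lambda>\<omega>. \<Sum>s\<in>I. indicator (A s) \<omega> * (Y s \<omega>)\<^sup>2)"
    by (intro Bochner_Integration.integrable_cong refl split[of _ "\<lambda>s \<omega>. (Y s \<omega>)\<^sup>2"])
  moreover have "integrable M (\<lambda>\<omega>. \<Sum>s\<in>I. indicator (A s) \<omega> * (Y s \<omega>)\<^sup>2)"
    using I0 by (intro Bochner_Integration.integrable_sum iA integrable_Y2) auto
  ultimately show i2: "integrable M (\<lambda>\<omega>. (Y (S \<omega>) \<omega>)\<^sup>2)" by simp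
  have iY: "integrable M (\<lambda>\<omega>. indicator (A s) \<omega> * Y s \<omega>)" "integrable M (\<lambda>\<omega>. indicator (A s) \<omega> * Y T \<omega>)"
    "integrable M (\<lambda>\<omega>. indicator (A s) \<omega> * (Y s \<omega>)\<^sup>2)" "integrable M (\<lambda>\<omega>. indicator (A s) \<omega> * (Y T \<omega>)\<^sup>2)"
    if "s \<in> I" for s
    using that I0 T by (auto intro!: iA integrable_Y integrable_Y2)
  have "(\<integral>\<omega>. Y (S \<omega>) \<omega> \<partial>M) = (\<integral>\<omega>. (\<Sum>s\<in>I. indicator (A s) \<omega> * Y s \<omega>) \<partial>M)"
    by (intro Bochner_Integration.integral_cong refl split[of _ Y])
  also have "\<dots> = (\<Sum>s\<in>I. \<integral>\<omega>. indicator (A s) \<omega> * Y s \<omega> \<partial>M)"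
    using iY by (intro Bochner_Integration.integral_sum)
  also have "\<dots> = (\<Sum>s\<in>I. \<integral>\<omega>. indicator (A s) \<omega> * Y T \<omega> \<partial>M)"
  proof (rule sum.cong[OF refl])
    fix s assume s: "s \<in> I"
    have "(\<integral>\<omega>. indicator (A s) \<omega> * 1 * (Y T \<omega> - Y s \<omega>) \<partial>M) = 0"
      using martingale_increment(2)[OF I0[OF s] AF[OF s], of "\<lambda>_. 1" 0 1] by simp
    then show "(\<integral>\<omega>. indicator (A s) \<omega> * Y s \<omega> \<partial>M) = (\<integral>\<omega>. indicator (A s) \<omega> * Y T \<omega> \<partial>M)"
      using iY[OF s] by (simp add: right_diff_distrib)
  qed
  also have "\<dots> = (\<integral>\<omega>. (\<Sum>s\<in>I. indicator (A s) \<omega> * Y T \<omega>) \<partial>M)"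
    using iY by (intro Bochner_Integration.integral_sum[symmetric])
  also have "\<dots> = (\<integral>\<omega>. Y T \<omega> \<partial>M)"
    by (intro Bochner_Integration.integral_cong refl split[of _ "\<lambda>_. Y T", symmetric])
  finally show "(\<integral>\<omega>. Y (S \<omega>) \<omega> \<partial>M) = natural_scale \<theta> x" using integral_Y[OF T] by simp
  have "(\<integral>\<omega>. (Y (S \<omega>) \<omega>)\<^sup>2 \<partial>M) = (\<integral>\<omega>. (\<Sum>s\<in>I. indicator (A s) \<omega> * (Y s \<omega>)\<^sup>2) \<partial>M)"
    by (intro Bochner_Integration.integral_cong refl split[of _ "\<lambda>s \<omega>. (Y s \<omega>)\<^sup>2"])
  also have "\<dots> = (\<Sum>s\<in>I. \<integral>\<omega>. indicator (A s) \<omega> * (Y s \<omega>)\<^sup>2 \<partial>M)"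
    using iY by (intro Bochner_Integration.integral_sum)
  also have "\<dots> \<le> (\<Sum>s\<in>I. \<integral>\<omega>. indicator (A s) \<omega> * (Y T \<omega>)\<^sup>2 \<partial>M)"
  proof (rule sum_mono)
    fix s assume s: "s \<in> I"
    \<comment> \<open>The added cross term has integral 0, and (Y T - Y s)^2 >= 0 turns the sum into
      the pointwise bound by the square of Y T.\<close>
    note inc = martingale_increment[OF I0[OF s] AF[OF s] borel_measurable_natural_scale C]
    have "(\<integral>\<omega>. indicator (A s) \<omega> * (Y s \<omega>)\<^sup>2 \<partial>M)
        = (\<integral>\<omega>. indicator (A s) \<omega> * (Y s \<omega>)\<^sup>2 + 2 * (indicator (A s) \<omega> * Y s \<omega> * (Y T \<omega> - Y s \<omega>)) \<partial>M)"
      using inc iY(3)[OF s] by simp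
    also have "\<dots> \<le> (\<integral>\<omega>. indicator (A s) \<omega> * (Y T \<omega>)\<^sup>2 \<partial>M)"
    proof (rule integral_mono)
      show "integrable M (\<lambda>\<omega>. indicator (A s) \<omega> * (Y s \<omega>)\<^sup>2 + 2 * (indicator (A s) \<omega> * Y s \<omega> * (Y T \<omega> - Y s \<omega>)))"
        by (intro Bochner_Integration.integrable_add iY(3)[OF s] integrable_mult_right inc(1))
      fix \<omega>
      have "(Y s \<omega>)\<^sup>2 + 2 * (Y s \<omega> * (Y T \<omega> - Y s \<omega>)) \<le> (Y T \<omega>)\<^sup>2"
        using zero_le_power2[of "Y T \<omega> - Y s \<omega>"] by (simp add: power2_eq_square algebra_simps)
      then show "indicator (A s) \<omega> * (Y s \<omega>)\<^sup>2 + 2 * (indicator (A s) \<omega> * Y s \<omega> * (Y T \<omega> - Y s \<omega>))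
        \<le> indicator (A s) \<omega> * (Y T \<omega>)\<^sup>2"
        by (simp add: indicator_def)
    qed (rule iY(4)[OF s])
    finally show "(\<integral>\<omega>. indicator (A s) \<omega> * (Y s \<omega>)\<^sup>2 \<partial>M) \<le> (\<integral>\<omega>. indicator (A s) \<omega> * (Y T \<omega>)\<^sup>2 \<partial>M)" .
  qed
  also have "\<dots> = (\<integral>\<omega>. (\<Sum>s\<in>I. indicator (A s) \<omega> * (Y T \<omega>)\<^sup>2) \<partial>M)"
    using iY by (intro Bochner_Integration.integral_sum[symmetric])
  also have "\<dots> = (\<integral>\<omega>. (Y T \<omega>)\<^sup>2 \<partial>M)"
    by (intro Bochner_Integration.integral_cong refl split[of _ "\<lambda>_ \<omega>. (Y T \<omega>)\<^sup>2", symmetric])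
  finally show "(\<integral>\<omega>. (Y (S \<omega>) \<omega>)\<^sup>2 \<partial>M) \<le> (\<integral>\<omega>. (Y T \<omega>)\<^sup>2 \<partial>M)" .
qed

lemma grid_tendsto: "(\<lambda>n. real_of_int \<lceil>s * real (Suc n)\<rceil> / real (Suc n)) \<longlonglongrightarrow> (s::real)"
proof (rule tendsto_sandwich)
  show "\<forall>\<^sub>F n in sequentially. s \<le> real_of_int \<lceil>s * real (Suc n)\<rceil> / real (Suc n)"
    by (intro always_eventually allI) (simp add: pos_le_divide_eq)
  show "\<forall>\<^sub>F n in sequentially. real_of_int \<lceil>s * real (Suc n)\<rceil> / real (Suc n) \<le> s + inverse (real (Suc n))"
  proof (intro always_eventually allI)
    fix n
    have "real_of_int \<lceil>s * real (Suc n)\<rceil> \<le> s * real (Suc n) + 1" by linarith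
    then have "real_of_int \<lceil>s * real (Suc n)\<rceil> / real (Suc n) \<le> (s * real (Suc n) + 1) / real (Suc n)"
      by (intro divide_right_mono) auto
    also have "\<dots> = s + inverse (real (Suc n))" by (simp add: field_simps)
    finally show "real_of_int \<lceil>s * real (Suc n)\<rceil> / real (Suc n) \<le> s + inverse (real (Suc n))" .
  qed
  show "(\<lambda>n. s + inverse (real (Suc n))) \<longlonglongrightarrow> s"
    using tendsto_add[OF tendsto_const LIMSEQ_inverse_real_of_nat, of s] by simp
qed auto

text \<open>The stopping time is approximated from above on finite grids. The second moments of the stopped
  discrete martingales are bounded by the one at the terminal time, which gives uniform integrability
  without a maximal inequality.\<close>

lemma optional_stopping:
  fixes S :: "'a \<Rightarrow> real"
  assumes S: "\<And>\<omega>. \<omega> \<in> space M \<Longrightarrow> 0 \<le> S \<omega>" "\<And>\<omega>. \<omega> \<in> space M \<Longrightarrow> S \<omega> \<le> real m"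
    and st: "\<And>t. 0 \<le> t \<Longrightarrow> {\<omega> \<in> space M. S \<omega> \<le> t} \<in> sets (F (ennreal t))"
  shows "integrable M (\<lambda>\<omega>. Y (S \<omega>) \<omega>)" and "(\<integral>\<omega>. Y (S \<omega>) \<omega> \<partial>M) = natural_scale \<theta> x"
proof -
  define G where "G n \<omega> = real_of_int \<lceil>S \<omega> * real (Suc n)\<rceil> / real (Suc n)" for n \<omega>
  define I where "I n = (\<lambda>j::nat. real j / real (Suc n)) ` {..m * Suc n}" for n
  have "G n \<omega> \<in> I n" if "\<omega> \<in> space M" for n \<omega>
  proof -
    have a: "0 \<le> S \<omega> * real (Suc n)" "S \<omega> * real (Suc n) \<le> real (m * Suc n)"
      using S(1)[OF that] mult_right_mono[OF S(2)[OF that], of "real (Suc n)"] by (simp_all add: algebra_simps)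
    have "\<lceil>S \<omega> * real (Suc n)\<rceil> \<ge> 0" using a(1) by linarith
    moreover have "\<lceil>S \<omega> * real (Suc n)\<rceil> \<le> int (m * Suc n)" using a(2) by (simp only: ceiling_le_iff of_int_of_nat_eq)
    ultimately have "nat \<lceil>S \<omega> * real (Suc n)\<rceil> \<le> m * Suc n"
      "real (nat \<lceil>S \<omega> * real (Suc n)\<rceil>) = real_of_int \<lceil>S \<omega> * real (Suc n)\<rceil>" by linarith+
    then show ?thesis
      unfolding I_def G_def by (intro image_eqI[of _ _ "nat \<lceil>S \<omega> * real (Suc n)\<rceil>"]) (simp_all only: atMost_iff)
  qed note GI = this
  have Gev: "{\<omega> \<in> space M. G n \<omega> = s} \<in> sets (F (ennreal s))" if "s \<in> I n" for n s
  proof -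
    from that obtain j where j: "s = real j / real (Suc n)" by (auto simp: I_def)
    have s0: "0 \<le> s" using j by simp
    have le: "G n \<omega> = s \<longleftrightarrow> \<lceil>S \<omega> * real (Suc n)\<rceil> = int j" for \<omega>
      unfolding G_def j by (simp add: divide_eq_eq del: of_nat_Suc) (metis of_int_eq_iff of_int_of_nat_eq)
    \<comment> \<open>The ceiling equals j exactly when S lies in the cell ((j - 1) / (n + 1), j /
      (n + 1)], which is known at time s; for j = 0 nonnegativity leaves only S = 0.\<close>
    show ?thesis
    proof (cases j)
      case 0
      have "G n \<omega> = s \<longleftrightarrow> S \<omega> \<le> 0" if "\<omega> \<in> space M" for \<omega>
        using S(1)[OF that] by (auto simp: le 0 ceiling_eq_iff mult_le_0_iff zero_less_mult_iff)
      then have "{\<omega> \<in> space M. G n \<omega> = s} = {\<omega> \<in> space M. S \<omega> \<le> 0}" by auto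
      then show ?thesis using st[of 0] sets_F_mono[of "ennreal 0" s] by auto
    next
      case (Suc i)
      let ?r = "real i / real (Suc n)"
      have "G n \<omega> = s \<longleftrightarrow> S \<omega> \<le> s \<and> \<not> S \<omega> \<le> ?r" for \<omega>
        unfolding le using Suc j
        by (auto simp: ceiling_eq_iff pos_le_divide_eq pos_divide_less_eq not_le simp del: of_nat_Suc)
      then have "{\<omega> \<in> space M. G n \<omega> = s} = {\<omega> \<in> space M. S \<omega> \<le> s} - {\<omega> \<in> space M. S \<omega> \<le> ?r}" by auto
      moreover have "?r \<le> s" using j Suc by (simp add: divide_right_mono)
      then have "{\<omega> \<in> space M. S \<omega> \<le> ?r} \<in> sets (F (ennreal s))"
        using st[of ?r] sets_F_mono[of "ennreal ?r" s] by (auto simp: ennreal_leI)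
      ultimately show ?thesis using st[OF s0] by auto
    qed
  qed
  have I: "finite (I n)" "I n \<subseteq> {0..real m}" for n
  proof -
    show "I n \<subseteq> {0..real m}"
    proof
      fix s assume "s \<in> I n"
      then obtain j where j: "j \<le> m * Suc n" "s = real j / real (Suc n)" by (auto simp: I_def)
      have "real j \<le> real (m * Suc n)" using j(1) by (simp only: of_nat_le_iff)
      then show "s \<in> {0..real m}" unfolding j(2) by (simp add: divide_le_eq distrib_left add.commute)
    qed
  qed (simp add: I_def)
  have lim: "(\<lambda>n. Y (G n \<omega>) \<omega>) \<longlonglongrightarrow> Y (S \<omega>) \<omega>" if \<omega>: "\<omega> \<in> space M" for \<omega>
  proof -
    have "continuous_on {0..} (\<lambda>t. Y t \<omega>)" by (intro continuous_intros X_cont[OF \<omega>])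
    moreover have "(\<lambda>n. G n \<omega>) \<longlonglongrightarrow> S \<omega>" unfolding G_def by (rule grid_tendsto)
    moreover have "\<forall>\<^sub>F n in sequentially. G n \<omega> \<in> {0..}" using GI[OF \<omega>] I(2) by (intro always_eventually) fastforce
    ultimately show ?thesis using S(1)[OF \<omega>] by (intro continuous_on_tendsto_compose[where f="\<lambda>t. Y t \<omega>" and s="{0..}"]) auto
  qed
  show "integrable M (\<lambda>\<omega>. Y (S \<omega>) \<omega>)" and "(\<integral>\<omega>. Y (S \<omega>) \<omega> \<partial>M) = natural_scale \<theta> x"
    using integral_eq_limit_of_L2_bounded[where f="\<lambda>n \<omega>. Y (G n \<omega>) \<omega>" and g="\<lambda>\<omega>. Y (S \<omega>) \<omega>" and m="natural_scale \<theta> x"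
        and C="\<integral>\<omega>. (Y (real m) \<omega>)\<^sup>2 \<partial>M"]
      discrete_optional_stopping[OF I GI Gev] lim by auto
qed

end

section \<open>Hitting times and absorption\<close>

text \<open>First passage to (-inf, 0]. Ruin, exit and lower passage times all arise by the choice
  of \<open>Z\<close>, and the free type of the sample point lets \<open>Z\<close> depend on the
  randomization too. The case distinction is there because \<open>Inf\<close> of the empty set
  carries no meaning.\<close>

definition hitting_time :: "(real \<Rightarrow> 'c \<Rightarrow> real) \<Rightarrow> 'c \<Rightarrow> ennreal" where
  "hitting_time Z z = (if \<exists>s\<ge>0. Z s z \<le> 0 then ennreal (Inf {s. 0 \<le> s \<and> Z s z \<le> 0}) else \<infinity>)"

lemma hitting_time_attained:
  assumes cont: "continuous_on {0..} (\<lambda>s. Z s z)" and ex: "0 \<le> s0" "Z s0 z \<le> 0"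
  obtains s where "0 \<le> s" "s \<le> s0" "hitting_time Z z = ennreal s" "Z s z \<le> 0" "\<And>r. 0 \<le> r \<Longrightarrow> r < s \<Longrightarrow> 0 < Z r z"
proof -
  let ?A = "{s. 0 \<le> s \<and> Z s z \<le> 0}"
  have "closed ({0..} \<inter> (\<lambda>s. Z s z) -` {..0})"
    by (intro continuous_closed_preimage cont) auto
  moreover have "{0..} \<inter> (\<lambda>s. Z s z) -` {..0} = ?A" by auto
  ultimately have "closed ?A" by simp
  moreover have ne: "?A \<noteq> {}" and bd: "bdd_below ?A" using ex by (auto intro: bdd_belowI[of _ 0])
  ultimately have "Inf ?A \<in> ?A" by (intro closed_contains_Inf)
  moreover have "0 < Z r z" if "0 \<le> r" "r < Inf ?A" for r
    using cInf_lower[OF _ bd, of r] that by (force simp: not_le[symmetric])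
  moreover have "hitting_time Z z = ennreal (Inf ?A)" using ex by (auto simp: hitting_time_def)
  moreover have "Inf ?A \<le> s0" using ex bd by (intro cInf_lower) auto
  ultimately show ?thesis using that[of "Inf ?A"] by auto
qed

text \<open>Continuity makes the infimum attained, so the event that the time is at most
  \<open>t\<close> depends on the path on [0, t] only, and the time is adapted without enlarging the
  filtration.\<close>

lemma hitting_time_le_iff:
  assumes cont: "continuous_on {0..} (\<lambda>s. Z s z)" and "0 \<le> t"
  shows "hitting_time Z z \<le> ennreal t \<longleftrightarrow> (\<exists>s\<in>{0..t}. Z s z \<le> 0)"
proof
  assume le: "hitting_time Z z \<le> ennreal t"
  then obtain s0 where s0: "0 \<le> s0" "Z s0 z \<le> 0"
    by (auto simp: hitting_time_def top_unique split: if_splits)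
  obtain s where "0 \<le> s" "hitting_time Z z = ennreal s" "Z s z \<le> 0"
    using hitting_time_attained[where Z=Z and z=z, OF cont s0] by metis
  then show "\<exists>s\<in>{0..t}. Z s z \<le> 0" using le \<open>0 \<le> t\<close> by auto
next
  assume "\<exists>s\<in>{0..t}. Z s z \<le> 0"
  then obtain s0 where s0: "0 \<le> s0" "s0 \<le> t" "Z s0 z \<le> 0" by auto
  then obtain s where "s \<le> s0" "hitting_time Z z = ennreal s"
    using hitting_time_attained[where Z=Z and z=z, OF cont] by metis
  then show "hitting_time Z z \<le> ennreal t" using s0 by (auto intro!: ennreal_leI)
qed

lemma hitting_time_zero:
  assumes cont: "continuous_on {0..} (\<lambda>s. Z s z)" and "0 \<le> Z 0 z" and fin: "hitting_time Z z < \<infinity>"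
  obtains s where "0 \<le> s" "hitting_time Z z = ennreal s" "Z s z = 0" "\<And>r. 0 \<le> r \<Longrightarrow> r < s \<Longrightarrow> 0 < Z r z"
proof -
  obtain s0 where s0: "0 \<le> s0" "Z s0 z \<le> 0"
    using fin by (auto simp: hitting_time_def split: if_splits)
  obtain s where s: "0 \<le> s" "hitting_time Z z = ennreal s" "Z s z \<le> 0" "\<And>r. 0 \<le> r \<Longrightarrow> r < s \<Longrightarrow> 0 < Z r z"
    using hitting_time_attained[where Z=Z and z=z, OF cont s0] by metis
  have "continuous_on {0..s} (\<lambda>s. Z s z)" by (rule continuous_on_subset[OF cont]) auto
  then obtain r where r: "0 \<le> r" "r \<le> s" "Z r z = 0"
    using IVT2'[of "\<lambda>s. Z s z" s 0 0] s assms(2) by auto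
  then have "r = s" using s(4)[of r] by (cases "r = s") auto
  then show ?thesis using that[of s] s r by auto
qed

text \<open>By compactness a continuous path reaches (-inf, 0] iff it falls below every 1 / (k + 1)
  somewhere, and by continuity rational times suffice for that. The endpoint \<open>t\<close> is
  added to the rationals so that it needs no approximation.\<close>

lemma pred_hits:
  fixes Z :: "real \<Rightarrow> 'c \<Rightarrow> real"
  assumes [measurable]: "\<And>s. 0 \<le> s \<Longrightarrow> s \<le> t \<Longrightarrow> Z s \<in> borel_measurable N" and t: "0 \<le> t"
    and cont: "\<And>z. z \<in> space N \<Longrightarrow> continuous_on {0..t} (\<lambda>s. Z s z)"
  shows "Measurable.pred N (\<lambda>z. \<exists>s\<in>{0..t}. Z s z \<le> 0)"
proof -
  let ?D = "insert t ({0..t} \<inter> \<rat>)"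
  have D: "countable ?D" "?D \<subseteq> {0..t}" using countable_rat t by auto
  have "(\<exists>s\<in>{0..t}. Z s z \<le> 0) \<longleftrightarrow> (\<forall>k::nat. \<exists>r\<in>?D. Z r z < 1 / real (Suc k))" if z: "z \<in> space N" for z
  proof
    assume "\<exists>s\<in>{0..t}. Z s z \<le> 0"
    then obtain s where s: "0 \<le> s" "s \<le> t" "Z s z \<le> 0" by auto
    show "\<forall>k::nat. \<exists>r\<in>?D. Z r z < 1 / real (Suc k)"
    proof
      fix k :: nat
      show "\<exists>r\<in>?D. Z r z < 1 / real (Suc k)"
      proof (cases "s = t")
        case True
        have "Z t z < 1 / real (Suc k)" using s True by (smt (verit) divide_pos_pos of_nat_0_less_iff zero_less_Suc)
        then show ?thesis by blast
      next
        case False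
        obtain d where d: "d > 0" "\<And>r. r \<in> {0..t} \<Longrightarrow> dist r s < d \<Longrightarrow> dist (Z r z) (Z s z) < 1 / real (Suc k)"
          using cont[OF z] s unfolding continuous_on_iff by (metis atLeastAtMost_iff divide_pos_pos of_nat_0_less_iff zero_less_Suc zero_less_one)
        obtain q where q: "q \<in> \<rat>" "s < q" "q < min (s + d) t"
          using Rats_dense_in_real[of s "min (s + d) t"] d s False by auto
        then have "Z q z < 1 / real (Suc k)" using d(2)[of q] s by (auto simp: dist_real_def)
        then show ?thesis using q s by (intro bexI[of _ q]) auto
      qed
    qed
  next
    assume r: "\<forall>k::nat. \<exists>r\<in>?D. Z r z < 1 / real (Suc k)"
    obtain s where s: "s \<in> {0..t}" "\<And>r. r \<in> {0..t} \<Longrightarrow> Z s z \<le> Z r z"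
      using continuous_attains_inf[OF _ _ cont[OF z]] t by auto
    have "Z s z \<le> 0"
    proof (rule ccontr)
      assume "\<not> Z s z \<le> 0"
      then obtain k where "1 / real (Suc k) < Z s z" using nat_approx_posE[of "Z s z"] by auto
      moreover obtain r where "r \<in> ?D" "Z r z < 1 / real (Suc k)" using r by blast
      ultimately show False using s(2)[of r] D by fastforce
    qed
    then show "\<exists>s\<in>{0..t}. Z s z \<le> 0" using s by blast
  qed
  then have "Measurable.pred N (\<lambda>z. \<exists>s\<in>{0..t}. Z s z \<le> 0) \<longleftrightarrow>
      Measurable.pred N (\<lambda>z. \<forall>k::nat. \<exists>r\<in>?D. Z r z < 1 / real (Suc k))"
    by (intro measurable_cong)
  moreover have "Measurable.pred N (\<lambda>z. \<exists>r\<in>?D. Z r z < 1 / real (Suc k))" for k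
  proof -
    have "(\<Union>r\<in>?D. {z \<in> space N. Z r z < 1 / real (Suc k)}) \<in> sets N"
    proof (rule sets.countable_UN''[OF D(1)])
      fix r assume "r \<in> ?D"
      then have [measurable]: "Z r \<in> borel_measurable N" using D by (intro assms) auto
      show "{z \<in> space N. Z r z < 1 / real (Suc k)} \<in> sets N" by measurable
    qed
    also have "(\<Union>r\<in>?D. {z \<in> space N. Z r z < 1 / real (Suc k)}) = {z \<in> space N. \<exists>r\<in>?D. Z r z < 1 / real (Suc k)}"
      by blast
    finally show ?thesis by (simp only: pred_def)
  qed
  ultimately show ?thesis by (simp only:) (rule pred_intros_countable)
qed

abbreviation uniform01 :: "real measure" where "uniform01 \<equiv> uniform_measure lborel {0..1}"

lemma prob_space_uniform01: "prob_space uniform01"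
  by (intro prob_space_uniform_measure) auto

section \<open>Absorption as stopping at ruin\<close>

context drifted_brownian
begin

abbreviation absorbed :: "real \<Rightarrow> 'a \<Rightarrow> real" where "absorbed \<equiv> absorbed_path W \<mu> \<sigma> x"
abbreviation ruin :: "'a \<Rightarrow> ennreal" where "ruin \<equiv> hitting_time X"

lemma hitting_time_meas:
  fixes Z :: "real \<Rightarrow> 'a \<Rightarrow> real"
  assumes "\<And>s t. 0 \<le> s \<Longrightarrow> ennreal s \<le> t \<Longrightarrow> Z s \<in> borel_measurable (F t)"
    and cont: "\<And>\<omega>. \<omega> \<in> space M \<Longrightarrow> continuous_on {0..} (\<lambda>s. Z s \<omega>)" and t: "0 \<le> t"
  shows "{\<omega> \<in> space M. hitting_time Z \<omega> \<le> ennreal t} \<in> sets (F (ennreal t))"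
proof -
  have "Measurable.pred (F (ennreal t)) (\<lambda>z. \<exists>s\<in>{0..t}. Z s z \<le> 0)"
    using assms continuous_on_subset[OF cont, of _ "{0..t}"] by (intro pred_hits) (auto simp: ennreal_leI)
  then have "{\<omega> \<in> space M. \<exists>s\<in>{0..t}. Z s \<omega> \<le> 0} \<in> sets (F (ennreal t))"
    by (simp add: pred_def)
  moreover have "{\<omega> \<in> space M. \<exists>s\<in>{0..t}. Z s \<omega> \<le> 0} = {\<omega> \<in> space M. hitting_time Z \<omega> \<le> ennreal t}"
    using hitting_time_le_iff[where Z=Z, OF cont t] by auto
  ultimately show ?thesis by simp
qed

lemma hitting_time_randomized:
  fixes Z :: "real \<Rightarrow> 'a \<times> real \<Rightarrow> real"
  assumes "\<And>s t. 0 \<le> s \<Longrightarrow> ennreal s \<le> t \<Longrightarrow> Z s \<in> borel_measurable (F t \<Otimes>\<^sub>M borel)"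
    and cont: "\<And>z. fst z \<in> space M \<Longrightarrow> continuous_on {0..} (\<lambda>s. Z s z)"
  shows "stopping_time (\<lambda>t. F t \<Otimes>\<^sub>M (borel :: real measure)) (hitting_time Z)"
proof (rule stopping_timeI)
  fix t :: ennreal
  show "Measurable.pred (F t \<Otimes>\<^sub>M (borel :: real measure)) (\<lambda>z. hitting_time Z z \<le> t)"
  proof (cases t)
    case (real r)
    have c: "continuous_on {0..} (\<lambda>s. Z s z)" if "z \<in> space (F t \<Otimes>\<^sub>M (borel :: real measure))" for z
      using that by (intro cont) (auto simp: space_pair_measure)
    have "Measurable.pred (F t \<Otimes>\<^sub>M borel) (\<lambda>z. \<exists>s\<in>{0..r}. Z s z \<le> 0)"
      using assms(1) real continuous_on_subset[OF c, of _ "{0..r}"] by (intro pred_hits) (auto simp: ennreal_leI)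
    moreover have "(\<exists>s\<in>{0..r}. Z s z \<le> 0) \<longleftrightarrow> hitting_time Z z \<le> t" if "z \<in> space (F t \<Otimes>\<^sub>M (borel :: real measure))" for z
      using hitting_time_le_iff[where Z=Z and z=z, OF c[OF that] real(1)] real by simp
    ultimately show ?thesis by (subst measurable_cong) auto
  qed simp
qed

text \<open>Reduces absorption to stopping, so that optional stopping applies. The absorbed path
  tests for the value 0 and \<open>ruin\<close> for values at most 0; a continuous path started at x
  >= 0 meets both at the same time.\<close>

lemma absorbed_eq:
  assumes \<omega>: "\<omega> \<in> space M" and x: "0 \<le> x" and r: "0 \<le> r"
  shows "absorbed r \<omega> = X (enn2real (min (ennreal r) (ruin \<omega>))) \<omega>"
proof (cases "\<exists>s\<in>{0..r}. X s \<omega> = 0")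
  case True
  then have le: "ruin \<omega> \<le> ennreal r"
    using hitting_time_le_iff[where Z=X and z=\<omega>, OF X_cont[OF \<omega>] r] by force
  then have "ruin \<omega> < \<infinity>" by (auto simp: less_top[symmetric] top_unique)
  then obtain s where "0 \<le> s" "ruin \<omega> = ennreal s" "X s \<omega> = 0"
    using hitting_time_zero[where Z=X and z=\<omega>, OF X_cont[OF \<omega>]] x X_0[OF \<omega>] by metis
  then show ?thesis using True le r by (auto simp: absorbed_path_def min_def ennreal_le_iff intro!: arg_cong[where f="\<lambda>s. X s \<omega>"])
next
  case False
  have "\<not> ruin \<omega> \<le> ennreal r"
  proof
    assume le: "ruin \<omega> \<le> ennreal r"
    then have "ruin \<omega> < \<infinity>" by (auto simp: less_top[symmetric] top_unique)
    then obtain s where s: "0 \<le> s" "ruin \<omega> = ennreal s" "X s \<omega> = 0"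
      using hitting_time_zero[where Z=X and z=\<omega>, OF X_cont[OF \<omega>]] x X_0[OF \<omega>] by metis
    then show False using False le r by auto
  qed
  then have "min (ennreal r) (ruin \<omega>) = ennreal r" by (auto simp: min_def not_le)
  then show ?thesis using False r by (simp add: absorbed_path_def)
qed

lemma absorbed_nonneg:
  assumes \<omega>: "\<omega> \<in> space M" and x: "0 \<le> x" and r: "0 \<le> r"
  shows "0 \<le> absorbed r \<omega>"
proof (cases "\<exists>s\<in>{0..r}. X s \<omega> = 0")
  case False
  have "\<not> X r \<omega> < 0"
  proof
    assume "X r \<omega> < 0"
    moreover have "continuous_on {0..r} (\<lambda>s. X s \<omega>)"
      by (rule continuous_on_subset[OF X_cont[OF \<omega>]]) auto
    ultimately obtain s where "0 \<le> s" "s \<le> r" "X s \<omega> = 0"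
      using IVT2'[of "\<lambda>s. X s \<omega>" r 0 0] x X_0[OF \<omega>] r by auto
    then show False using False by auto
  qed
  then show ?thesis using False by (simp add: absorbed_path_def)
qed (simp add: absorbed_path_def)

text \<open>Allows evaluation along times that approach a random time from above: a path that has
  not touched 0 by time \<open>r\<close> stays away from 0 for a short while after.\<close>

lemma absorbed_right_cont:
  assumes \<omega>: "\<omega> \<in> space M" and r: "0 \<le> r" and q: "q \<longlonglongrightarrow> r" "\<And>n. r \<le> q n"
  shows "(\<lambda>n. absorbed (q n) \<omega>) \<longlonglongrightarrow> absorbed r \<omega>"
proof (cases "\<exists>s\<in>{0..r}. X s \<omega> = 0")
  case True
  then have "absorbed (q n) \<omega> = absorbed r \<omega>" for n
    using q(2)[of n] by (force simp: absorbed_path_def)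
  then show ?thesis by simp
next
  case False
  have Xq: "(\<lambda>n. X (q n) \<omega>) \<longlonglongrightarrow> X r \<omega>"
    using q r order_trans[OF r q(2)]
    by (intro continuous_on_tendsto_compose[OF X_cont[OF \<omega>]]) auto
  have Xr: "X r \<omega> \<noteq> 0" using False r by auto
  obtain d where d: "d > 0" "\<And>s. 0 \<le> s \<Longrightarrow> dist s r < d \<Longrightarrow> dist (X s \<omega>) (X r \<omega>) < \<bar>X r \<omega>\<bar>"
    using X_cont[OF \<omega>] r Xr unfolding continuous_on_iff by (metis atLeast_iff zero_less_abs_iff)
  have "\<forall>\<^sub>F n in sequentially. dist (q n) r < d" using q(1) d(1) by (rule tendstoD)
  then have "\<forall>\<^sub>F n in sequentially. X (q n) \<omega> = absorbed (q n) \<omega>"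
  proof eventually_elim
    case (elim n)
    have "X s \<omega> \<noteq> 0" if "s \<in> {0..q n}" for s
    proof (cases "s \<le> r")
      case True then show ?thesis using False that by auto
    next
      case F: False
      then have "dist s r < d" using elim that by (auto simp: dist_real_def)
      then show ?thesis using d(2)[of s] that by (auto simp: dist_real_def)
    qed
    then show ?case by (auto simp: absorbed_path_def)
  qed
  moreover have "absorbed r \<omega> = X r \<omega>" using False by (simp add: absorbed_path_def)
  ultimately show ?thesis using Xq by (simp add: filterlim_cong)
qed

lemma absorbed_meas [measurable]:
  assumes r: "0 \<le> r" shows "absorbed r \<in> borel_measurable M"
proof -
  have "Measurable.pred M (\<lambda>\<omega>. \<exists>s\<in>{0..r}. \<bar>X s \<omega>\<bar> \<le> 0)"
    using continuous_on_subset[OF X_cont, of _ "{0..r}"]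
    by (intro pred_hits r) (auto intro!: continuous_intros)
  then have [measurable]: "Measurable.pred M (\<lambda>\<omega>. \<exists>s\<in>{0..r}. X s \<omega> = 0)" by simp
  show ?thesis using r unfolding absorbed_path_def by measurable
qed

text \<open>Evaluation at a random time is the limit of evaluations at grid times above it, of which
  there are countably many. The map \<open>p\<close> is the identity for ordinary stopping times and
  \<open>fst\<close> for randomized ones. Where the time is infinite, \<open>enn2real\<close> yields
  time 0; the stopping times in use are finite almost surely.\<close>

lemma absorbed_joint_meas:
  assumes N: "p \<in> measurable N M" and [measurable]: "\<tau> \<in> borel_measurable N"
  shows "(\<lambda>z. absorbed (enn2real (\<tau> z)) (p z)) \<in> borel_measurable N"
proof (rule borel_measurable_LIMSEQ_real)
  let ?q = "\<lambda>n z. real_of_int \<lceil>enn2real (\<tau> z) * real (Suc n)\<rceil> / real (Suc n)"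
  fix z assume "z \<in> space N"
  then have "p z \<in> space M" using N by (auto dest: measurable_space)
  then show "(\<lambda>n. absorbed (?q n z) (p z)) \<longlonglongrightarrow> absorbed (enn2real (\<tau> z)) (p z)"
    by (intro absorbed_right_cont grid_tendsto) (simp_all add: pos_le_divide_eq)
next
  fix n
  let ?q = "\<lambda>z. real_of_int \<lceil>enn2real (\<tau> z) * real (Suc n)\<rceil> / real (Suc n)"
  let ?k = "\<lambda>z. nat \<lceil>enn2real (\<tau> z) * real (Suc n)\<rceil>"
  have [measurable]: "?k \<in> measurable N (count_space UNIV)" by measurable
  have "(\<lambda>z. absorbed (real (?k z) / real (Suc n)) (p z)) \<in> borel_measurable N"
  proof (rule measurable_compose_countable[where g="?k"])
    fix i :: nat
    show "(\<lambda>z. absorbed (real i / real (Suc n)) (p z)) \<in> borel_measurable N"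
      by (rule measurable_compose[OF N]) measurable
  qed measurable
  moreover have "real (?k z) = real_of_int \<lceil>enn2real (\<tau> z) * real (Suc n)\<rceil>" for z
  proof -
    have "0 \<le> enn2real (\<tau> z) * real (Suc n)" by simp
    then have "0 \<le> \<lceil>enn2real (\<tau> z) * real (Suc n)\<rceil>" by linarith
    then show ?thesis by simp
  qed
  ultimately show "(\<lambda>z. absorbed (?q z) (p z)) \<in> borel_measurable N" by simp
qed

lemma stopped_scale:
  assumes x: "0 \<le> x" and st: "\<And>t. 0 \<le> t \<Longrightarrow> {\<omega> \<in> space M. \<tau> \<omega> \<le> ennreal t} \<in> sets (F (ennreal t))"
  shows "integrable M (\<lambda>\<omega>. natural_scale \<theta> (absorbed (enn2real (min (\<tau> \<omega>) (of_nat n))) \<omega>))" (is "integrable M ?f")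
    and "(\<integral>\<omega>. natural_scale \<theta> (absorbed (enn2real (min (\<tau> \<omega>) (of_nat n))) \<omega>) \<partial>M) = natural_scale \<theta> x"
proof -
  let ?S = "\<lambda>\<omega>. enn2real (min (min (\<tau> \<omega>) (of_nat n)) (ruin \<omega>))"
  have eq: "?f \<omega> = Y (?S \<omega>) \<omega>" if "\<omega> \<in> space M" for \<omega>
  proof -
    have "min (\<tau> \<omega>) (of_nat n) < top" by (simp add: min_less_iff_disj of_nat_less_top)
    then show ?thesis using absorbed_eq[OF that x, of "enn2real (min (\<tau> \<omega>) (of_nat n))"]
      by (simp add: ennreal_enn2real)
  qed
  have S: "?S \<omega> \<le> real n" for \<omega>
    by (rule enn2real_leI) (auto simp: min_def ennreal_of_nat_eq_real_of_nat)
  have "{\<omega> \<in> space M. ?S \<omega> \<le> t} \<in> sets (F (ennreal t))" if t: "0 \<le> t" for t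
  proof (cases "real n \<le> t")
    case True
    then have "{\<omega> \<in> space M. ?S \<omega> \<le> t} = space (F (ennreal t))" using S order_trans by auto
    then show ?thesis by (simp only: sets.top)
  next
    case False
    \<comment> \<open>Strictly before the horizon \<open>n\<close> the truncation is
      invisible.\<close>
    have "?S \<omega> \<le> t \<longleftrightarrow> \<tau> \<omega> \<le> ennreal t \<or> ruin \<omega> \<le> ennreal t" for \<omega>
    proof -
      have "min (min (\<tau> \<omega>) (of_nat n)) (ruin \<omega>) < top" by (simp add: min_less_iff_disj of_nat_less_top)
      then have "?S \<omega> \<le> t \<longleftrightarrow> min (min (\<tau> \<omega>) (of_nat n)) (ruin \<omega>) \<le> ennreal t"
        using t by (metis enn2real_leI ennreal_enn2real ennreal_leI)
      also have "\<dots> \<longleftrightarrow> \<tau> \<omega> \<le> ennreal t \<or> (of_nat n :: ennreal) \<le> ennreal t \<or> ruin \<omega> \<le> ennreal t"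
        by (simp add: min_le_iff_disj)
      also have "(of_nat n :: ennreal) \<le> ennreal t \<longleftrightarrow> False"
        using False t by (simp add: ennreal_of_nat_eq_real_of_nat)
      finally show ?thesis by simp
    qed
    then have "{\<omega> \<in> space M. ?S \<omega> \<le> t} = {\<omega> \<in> space M. \<tau> \<omega> \<le> ennreal t} \<union> {\<omega> \<in> space M. ruin \<omega> \<le> ennreal t}" by auto
    then show ?thesis using st[OF t] hitting_time_meas[where Z=X, OF X_F X_cont t] by auto
  qed
  note os = optional_stopping[where S="?S" and m=n, OF _ S this]
  show "integrable M ?f" using os(1) by (subst Bochner_Integration.integrable_cong[OF refl eq]) auto
  show "(\<integral>\<omega>. ?f \<omega> \<partial>M) = natural_scale \<theta> x"
    using os(2) by (subst Bochner_Integration.integral_cong[OF refl eq]) auto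
qed

lemma eventually_stopped:
  fixes f :: "'a \<Rightarrow> ennreal"
  assumes "f \<omega> < \<infinity>"
  shows "\<forall>\<^sub>F n in sequentially. enn2real (min (f \<omega>) (of_nat n)) = enn2real (f \<omega>)"
proof -
  from assms obtain r where r: "0 \<le> r" "f \<omega> = ennreal r" by (cases "f \<omega>") auto
  obtain k where k: "r \<le> real k" using real_arch_simple by blast
  have "\<forall>n\<ge>k. min (f \<omega>) (of_nat n) = f \<omega>"
    using k r by (auto simp: min_def ennreal_of_nat_eq_real_of_nat)
  then show ?thesis unfolding eventually_sequentially by (intro exI[of _ k]) simp
qed

text \<open>At each finite horizon the mean is exact. Fatou keeps an inequality in the limit, since
  mass may escape; equality survives if the stopped scale stays below a constant, as for exits from
  an interval or for positive \<theta>.\<close>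

lemma
  assumes x: "0 \<le> x" and st: "\<And>t. 0 \<le> t \<Longrightarrow> {\<omega> \<in> space M. \<tau> \<omega> \<le> ennreal t} \<in> sets (F (ennreal t))"
    and fin: "AE \<omega> in M. \<tau> \<omega> < \<infinity>"
  shows stopped_scale_le: "(\<integral>\<^sup>+\<omega>. ennreal (natural_scale \<theta> (absorbed (enn2real (\<tau> \<omega>)) \<omega>)) \<partial>M) \<le> ennreal (natural_scale \<theta> x)" (is "?I \<le> _")
    and stopped_scale_eq: "(\<And>\<omega> n. \<omega> \<in> space M \<Longrightarrow> natural_scale \<theta> (absorbed (enn2real (min (\<tau> \<omega>) (of_nat n))) \<omega>) \<le> K)
      \<Longrightarrow> (\<integral>\<^sup>+\<omega>. ennreal (natural_scale \<theta> (absorbed (enn2real (\<tau> \<omega>)) \<omega>)) \<partial>M) = ennreal (natural_scale \<theta> x)"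
proof -
  let ?f = "\<lambda>n \<omega>. natural_scale \<theta> (absorbed (enn2real (min (\<tau> \<omega>) (of_nat n))) \<omega>)"
  let ?g = "\<lambda>\<omega>. natural_scale \<theta> (absorbed (enn2real (\<tau> \<omega>)) \<omega>)"
  have int: "(\<integral>\<^sup>+\<omega>. ennreal (?f n \<omega>) \<partial>M) = ennreal (natural_scale \<theta> x)" for n
    using stopped_scale[OF x st, of n] absorbed_nonneg[OF _ x]
    by (subst nn_integral_eq_integral) (auto intro!: AE_I2 natural_scale_nonneg)
  have fm[measurable]: "?f n \<in> borel_measurable M" for n using stopped_scale(1)[OF x st] by auto
  have lim: "AE \<omega> in M. (\<lambda>n. ennreal (?f n \<omega>)) \<longlonglongrightarrow> ennreal (?g \<omega>)"
    using fin
  proof eventually_elim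
    case (elim \<omega>)
    have "\<forall>\<^sub>F n in sequentially. ennreal (?f n \<omega>) = ennreal (?g \<omega>)"
      using eventually_stopped[of \<tau> \<omega>, OF elim] by eventually_elim simp
    then show ?case by (rule tendsto_eventually)
  qed
  have "?I = (\<integral>\<^sup>+\<omega>. liminf (\<lambda>n. ennreal (?f n \<omega>)) \<partial>M)"
    using lim by (intro nn_integral_cong_AE) (auto elim!: eventually_mono intro!: lim_imp_Liminf[symmetric])
  also have "\<dots> \<le> liminf (\<lambda>n. \<integral>\<^sup>+\<omega>. ennreal (?f n \<omega>) \<partial>M)"
    by (rule nn_integral_liminf) measurable
  also have "\<dots> = ennreal (natural_scale \<theta> x)" by (simp add: int Liminf_const)
  finally show "?I \<le> ennreal (natural_scale \<theta> x)" .
  assume K: "\<And>\<omega> n. \<omega> \<in> space M \<Longrightarrow> ?f n \<omega> \<le> K"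
  have gm: "?g \<in> borel_measurable M"
  proof -
    have tm: "\<tau> \<in> borel_measurable M"
    proof (rule borel_measurableI_le)
      fix y show "{\<omega> \<in> space M. \<tau> \<omega> \<le> y} \<in> sets M"
        using st sets_F_subset by (cases y) auto
    qed
    have "(\<lambda>\<omega>. absorbed (enn2real (\<tau> \<omega>)) \<omega>) \<in> borel_measurable M"
      by (intro absorbed_joint_meas tm) simp
    then show ?thesis by measurable
  qed
  have "(\<lambda>n. \<integral>\<^sup>+\<omega>. ennreal (?f n \<omega>) \<partial>M) \<longlonglongrightarrow> ?I"
  proof (rule nn_integral_dominated_convergence[where w="\<lambda>_. ennreal K"])
    show "AE \<omega> in M. ennreal (?f j \<omega>) \<le> ennreal K" for j
      using K by (intro AE_I2 ennreal_leI) auto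
    show "(\<integral>\<^sup>+ _. ennreal K \<partial>M) < \<infinity>" by (simp add: emeasure_space_1)
    show "(\<lambda>x. ennreal (?g x)) \<in> borel_measurable M" using gm by measurable
  qed (use lim in auto)
  then show "?I = ennreal (natural_scale \<theta> x)" by (simp add: int LIMSEQ_const_iff)
qed

end

section \<open>Attainable laws\<close>

lemma hitting_time_before:
  assumes "continuous_on {0..} (\<lambda>s. Z s z)" "0 \<le> r" "ennreal r < hitting_time Z z"
  shows "0 < Z r z"
  using hitting_time_le_iff[where Z=Z and z=z, OF assms(1,2)] assms(2,3)
  by (metis atLeastAtMost_iff linorder_not_le order_refl)

lemma hitting_time_upto:
  assumes cont: "continuous_on {0..} (\<lambda>s. Z s z)" "0 \<le> Z 0 z" and r: "0 \<le> r" "ennreal r \<le> hitting_time Z z"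
  shows "0 \<le> Z r z"
proof (cases "ennreal r < hitting_time Z z")
  case True
  then show ?thesis using hitting_time_before[where Z=Z and z=z, OF cont(1) r(1)] by simp
next
  case False
  with r have eq: "hitting_time Z z = ennreal r" by simp
  then have fin: "hitting_time Z z < \<infinity>" by simp
  obtain s where "0 \<le> s" "hitting_time Z z = ennreal s" "Z s z = 0"
    by (rule hitting_time_zero[where Z=Z and z=z, OF cont fin]) (rule that)
  then show ?thesis using eq r by simp
qed

section \<open>Exit from intervals and passage to lower levels\<close>

context drifted_brownian
begin

lemma stopping_time_borel:
  assumes st: "\<And>t. 0 \<le> t \<Longrightarrow> {\<omega> \<in> space M. \<tau> \<omega> \<le> ennreal t} \<in> sets (F (ennreal t))"
  shows "\<tau> \<in> borel_measurable M"
proof (rule borel_measurableI_le)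
  fix y show "{\<omega> \<in> space M. \<tau> \<omega> \<le> y} \<in> sets M"
    using st sets_F_subset by (cases y) auto
qed

text \<open>Positive exactly inside the open interval, so that leaving it becomes a hitting time of
  (-inf, 0].\<close>

abbreviation exit_dist :: "real \<Rightarrow> real \<Rightarrow> real \<Rightarrow> 'a \<Rightarrow> real" where
  "exit_dist a b s \<omega> \<equiv> min (X s \<omega> - a) (b - X s \<omega>)"

abbreviation exit_time :: "real \<Rightarrow> real \<Rightarrow> 'a \<Rightarrow> ennreal" where
  "exit_time a b \<equiv> hitting_time (exit_dist a b)"

definition lower_time :: "real \<Rightarrow> 'a \<Rightarrow> ennreal" where
  "lower_time a = hitting_time (\<lambda>s \<omega>. X s \<omega> - a)"

lemma exit_dist_cont: "\<omega> \<in> space M \<Longrightarrow> continuous_on {0..} (\<lambda>s. exit_dist a b s \<omega>)"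
  by (intro continuous_intros X_cont)

lemma exit_time_F: "0 \<le> t \<Longrightarrow> {\<omega> \<in> space M. exit_time a b \<omega> \<le> ennreal t} \<in> sets (F (ennreal t))"
  by (rule hitting_time_meas) (auto intro: exit_dist_cont)

lemma lower_time_F: "0 \<le> t \<Longrightarrow> {\<omega> \<in> space M. lower_time a \<omega> \<le> ennreal t} \<in> sets (F (ennreal t))"
  unfolding lower_time_def by (rule hitting_time_meas) (auto intro!: X_cont continuous_intros)

lemma exit_time_meas [measurable]: "exit_time a b \<in> borel_measurable M"
  by (rule stopping_time_borel) (rule exit_time_F)

lemma lower_time_meas: "lower_time a \<in> borel_measurable M"
  by (rule stopping_time_borel) (rule lower_time_F)

text \<open>The normal density of variance t is at most 1 / sqrt t, so a bounded interval holds the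
  path with vanishing probability at late times.\<close>

lemma prob_X_interval:
  assumes "t > 0" "a \<le> b"
  shows "prob {\<omega> \<in> space M. X t \<omega> \<in> {a..b}} \<le> (b - a) / (\<sigma> * sqrt t)"
proof -
  let ?A = "{(a - x - \<mu> * t) / \<sigma> .. (b - x - \<mu> * t) / \<sigma>}"
  let ?D = "\<lambda>\<omega>. W t \<omega> - W 0 \<omega>"
  have d: "distributed M lborel ?D (normal_density 0 (sqrt t))"
    using distr_increment[of 0 t] assms by simp
  have "{\<omega> \<in> space M. X t \<omega> \<in> {a..b}} = ?D -` ?A \<inter> space M"
    using \<sigma> by (auto simp: drifted_path_def W_0 field_simps)
  then have "emeasure M {\<omega> \<in> space M. X t \<omega> \<in> {a..b}} = (\<integral>\<^sup>+w. ennreal (normal_density 0 (sqrt t) w) * indicator ?A w \<partial>lborel)"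
    using distributed_emeasure[OF d, of ?A] by simp
  also have "\<dots> \<le> (\<integral>\<^sup>+w. ennreal (1 / sqrt t) * indicator ?A w \<partial>lborel)"
  proof (intro nn_integral_mono mult_right_mono ennreal_leI)
    fix w
    have "1 / sqrt (2 * pi * (sqrt t)\<^sup>2) \<le> 1 / sqrt t"
    proof (rule divide_left_mono)
      have "t * 1 \<le> t * (2 * pi)" using assms pi_gt3 by (intro mult_left_mono) auto
      then show "sqrt t \<le> sqrt (2 * pi * (sqrt t)\<^sup>2)" using assms by (simp add: mult_ac)
    qed (use assms in auto)
    moreover have "exp (- (w - 0)\<^sup>2 / (2 * (sqrt t)\<^sup>2)) \<le> 1" using assms by simp
    ultimately have "1 / sqrt (2 * pi * (sqrt t)\<^sup>2) * exp (- (w - 0)\<^sup>2 / (2 * (sqrt t)\<^sup>2)) \<le> 1 / sqrt t * 1"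
      using assms by (intro mult_mono) auto
    then show "normal_density 0 (sqrt t) w \<le> 1 / sqrt t" by (simp add: normal_density_def)
  qed auto
  also have "\<dots> = ennreal (1 / sqrt t) * emeasure lborel ?A"
    by (simp add: nn_integral_cmult)
  also have "emeasure lborel ?A = ennreal ((b - a) / \<sigma>)"
    using assms \<sigma> by (simp add: divide_right_mono diff_divide_distrib[symmetric])
  also have "ennreal (1 / sqrt t) * ennreal ((b - a) / \<sigma>) = ennreal ((b - a) / (\<sigma> * sqrt t))"
    using assms \<sigma> by (subst ennreal_mult[symmetric]) (auto simp: mult_ac)
  finally show ?thesis using assms \<sigma> by (simp add: emeasure_eq_measure)
qed

text \<open>A path that never leaves the interval lies in it at every integer time, and the
  probability of that tends to 0; drifts of either sign are covered at once.\<close>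

lemma exit_time_finite:
  assumes "a \<le> x" "x \<le> b"
  shows "AE \<omega> in M. exit_time a b \<omega> < \<infinity>"
proof -
  let ?E = "{\<omega> \<in> space M. exit_time a b \<omega> = \<infinity>}"
  have E[measurable]: "?E \<in> sets M" by measurable
  have "prob ?E \<le> (b - a) / \<sigma> * (1 / sqrt (real (Suc n)))" for n
  proof -
    have "?E \<subseteq> {\<omega> \<in> space M. X (real (Suc n)) \<omega> \<in> {a..b}}"
    proof
      fix \<omega> assume "\<omega> \<in> ?E"
      then have \<omega>: "\<omega> \<in> space M" "exit_time a b \<omega> = \<infinity>" by auto
      have "0 < exit_dist a b (real (Suc n)) \<omega>"
        by (rule hitting_time_before[where Z="exit_dist a b" and z=\<omega>, OF exit_dist_cont[OF \<omega>(1)]]) (simp_all add: \<omega>)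
      then show "\<omega> \<in> {\<omega> \<in> space M. X (real (Suc n)) \<omega> \<in> {a..b}}" using \<omega> by auto
    qed
    then have "prob ?E \<le> prob {\<omega> \<in> space M. X (real (Suc n)) \<omega> \<in> {a..b}}"
      by (intro finite_measure_mono) measurable
    also have "\<dots> \<le> (b - a) / (\<sigma> * sqrt (real (Suc n)))"
      using assms by (intro prob_X_interval) auto
    finally show ?thesis by simp
  qed
  moreover have "(\<lambda>n. (b - a) / \<sigma> * (1 / sqrt (real (Suc n)))) \<longlonglongrightarrow> (b - a) / \<sigma> * 0"
  proof (rule tendsto_mult_left)
    have "(\<lambda>n. sqrt (inverse (real (Suc n)))) \<longlonglongrightarrow> sqrt 0"
      by (intro tendsto_real_sqrt LIMSEQ_inverse_real_of_nat)
    then show "(\<lambda>n. 1 / sqrt (real (Suc n))) \<longlonglongrightarrow> 0"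
      by (simp only: real_sqrt_inverse real_sqrt_zero) (simp only: inverse_eq_divide)
  qed
  ultimately have "prob ?E \<le> 0"
    by (intro LIMSEQ_le_const) auto
  then have "prob ?E = 0" by (simp add: measure_le_0_iff)
  then have "AE \<omega> in M. \<omega> \<notin> ?E" using prob_eq_0[OF E] by simp
  then show ?thesis by (rule AE_mp) (auto intro!: AE_I2 simp: less_top)
qed

lemma absorbed_before_ruin:
  assumes "\<omega> \<in> space M" "0 \<le> s" "\<And>r. 0 \<le> r \<Longrightarrow> r < s \<Longrightarrow> 0 < X r \<omega>"
  shows "absorbed s \<omega> = X s \<omega>"
proof (cases "\<exists>r\<in>{0..s}. X r \<omega> = 0")
  case True
  then obtain r where r: "0 \<le> r" "r \<le> s" "X r \<omega> = 0" by auto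
  then have "r = s" using assms(3)[of r] by (cases "r = s") auto
  then show ?thesis using r by (auto simp: absorbed_path_def)
qed (simp add: absorbed_path_def)

lemma exit_value:
  assumes \<omega>: "\<omega> \<in> space M" and ab: "0 \<le> a" "a \<le> x" "x \<le> b" and fin: "exit_time a b \<omega> < \<infinity>"
  obtains s where "0 \<le> s" "exit_time a b \<omega> = ennreal s" "absorbed s \<omega> = X s \<omega>" "X s \<omega> = a \<or> X s \<omega> = b"
proof -
  have "0 \<le> exit_dist a b 0 \<omega>" using ab X_0[OF \<omega>] by simp
  then obtain s where s: "0 \<le> s" "exit_time a b \<omega> = ennreal s" "exit_dist a b s \<omega> = 0" "\<And>r. 0 \<le> r \<Longrightarrow> r < s \<Longrightarrow> 0 < exit_dist a b r \<omega>"
    using hitting_time_zero[where Z="exit_dist a b" and z=\<omega>, OF exit_dist_cont[OF \<omega>] _ fin] by blast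
  have "absorbed s \<omega> = X s \<omega>"
    using s(4) ab by (intro absorbed_before_ruin \<omega> s(1)) fastforce
  moreover have "X s \<omega> = a \<or> X s \<omega> = b" using s(3) by (auto simp: min_def split: if_splits)
  ultimately show ?thesis using that s by blast
qed

lemma absorbed_exit_meas [measurable]:
  "(\<lambda>\<omega>. absorbed (enn2real (exit_time a b \<omega>)) \<omega>) \<in> borel_measurable M"
  by (rule absorbed_joint_meas) measurable

text \<open>At exit the path is at a or at b, so the mean of the scale, preserved because the
  stopped path stays below \<open>b\<close>, is one linear equation for the single unknown
  probability.\<close>

lemma exit_law:
  assumes ab: "0 \<le> a" "a \<le> x" "x \<le> b" and [measurable]: "\<phi> \<in> borel_measurable borel"
  defines "w \<equiv> (natural_scale \<theta> b - natural_scale \<theta> x) / (natural_scale \<theta> b - natural_scale \<theta> a)"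
  shows "(\<integral>\<^sup>+\<omega>. \<phi> (absorbed (enn2real (exit_time a b \<omega>)) \<omega>) \<partial>M) = ennreal w * \<phi> a + ennreal (1 - w) * \<phi> b"
proof -
  let ?V = "\<lambda>\<omega>. absorbed (enn2real (exit_time a b \<omega>)) \<omega>"
  have fin: "AE \<omega> in M. exit_time a b \<omega> < \<infinity>" using ab by (intro exit_time_finite)
  then have V: "AE \<omega> in M. ?V \<omega> = a \<or> ?V \<omega> = b"
  proof (rule AE_mp, intro AE_I2 impI)
    fix \<omega> assume "\<omega> \<in> space M" "exit_time a b \<omega> < \<infinity>"
    then show "?V \<omega> = a \<or> ?V \<omega> = b" by (rule exit_value[OF _ ab]) auto
  qed
  show ?thesis
  \<comment> \<open>If a = b then x = a as well and \<open>w\<close> is 0 / 0 = 0; the formula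
    remains true and describes stopping at once.\<close>
  proof (cases "a = b")
    case True
    then have "(\<integral>\<^sup>+\<omega>. \<phi> (?V \<omega>) \<partial>M) = (\<integral>\<^sup>+\<omega>. \<phi> b \<partial>M)"
      using V by (intro nn_integral_cong_AE) auto
    then show ?thesis using True by (simp add: w_def emeasure_space_1)
  next
    case False
    let ?A = "{\<omega> \<in> space M. ?V \<omega> = a}"
    have A[measurable]: "?A \<in> sets M" by measurable
    have split: "(\<integral>\<^sup>+\<omega>. \<psi> (?V \<omega>) \<partial>M) = ennreal (prob ?A) * \<psi> a + ennreal (1 - prob ?A) * \<psi> b" for \<psi> :: "real \<Rightarrow> ennreal"
    proof -
      have "(\<integral>\<^sup>+\<omega>. \<psi> (?V \<omega>) \<partial>M) = (\<integral>\<^sup>+\<omega>. \<psi> a * indicator ?A \<omega> + \<psi> b * indicator (space M - ?A) \<omega> \<partial>M)"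
      proof (rule nn_integral_cong_AE)
        show "AE \<omega> in M. \<psi> (?V \<omega>) = \<psi> a * indicator ?A \<omega> + \<psi> b * indicator (space M - ?A) \<omega>"
          using V by (rule AE_mp) (intro AE_I2, auto simp: indicator_def)
      qed
      also have "\<dots> = \<psi> a * emeasure M ?A + \<psi> b * emeasure M (space M - ?A)"
        by (subst nn_integral_add) (auto simp: nn_integral_cmult)
      finally show ?thesis by (simp add: emeasure_eq_measure prob_compl mult.commute)
    qed
    let ?s = "natural_scale \<theta>"
    have "(\<integral>\<^sup>+\<omega>. ennreal (?s (?V \<omega>)) \<partial>M) = ennreal (?s x)"
    proof (rule stopped_scale_eq[where K="?s b", OF _ exit_time_F fin])
      fix \<omega> n assume \<omega>: "\<omega> \<in> space M"
      let ?t = "enn2real (min (exit_time a b \<omega>) (of_nat n))"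
      have "min (exit_time a b \<omega>) (of_nat n) < top" by (simp add: min_less_iff_disj of_nat_less_top)
      then have "ennreal ?t \<le> exit_time a b \<omega>" by (simp add: ennreal_enn2real)
      moreover have "0 \<le> exit_dist a b 0 \<omega>" using ab X_0[OF \<omega>] by simp
      ultimately have "0 \<le> exit_dist a b ?t \<omega>"
        by (rule hitting_time_upto[where Z="exit_dist a b" and z=\<omega>, OF exit_dist_cont[OF \<omega>] _ enn2real_nonneg, rotated])
      then have "absorbed ?t \<omega> \<le> b" using ab by (simp add: absorbed_path_def)
      then show "?s (absorbed ?t \<omega>) \<le> ?s b" by simp
    qed (use ab in auto)
    then have "ennreal (prob ?A) * ennreal (?s a) + ennreal (1 - prob ?A) * ennreal (?s b) = ennreal (?s x)"
      using split[of "\<lambda>y. ennreal (?s y)"] by simp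
    moreover have "0 \<le> ?s a" "0 \<le> ?s b" "0 \<le> ?s x" using ab by (auto intro!: natural_scale_nonneg)
    ultimately have "prob ?A * ?s a + (1 - prob ?A) * ?s b = ?s x"
      by (simp add: ennreal_mult[symmetric] flip: ennreal_plus)
    moreover have "?s a < ?s b" using False ab by simp
    ultimately have "prob ?A = w" by (simp add: w_def field_simps)
    then show ?thesis using split[of \<phi>] by simp
  qed
qed

text \<open>A path that never falls to \<open>a\<close> leaves every interval (a, b) at b. The
  probability of that is of order 1 over the scale of b, which is at least b when \<theta> <=
  0.\<close>

lemma lower_time_finite:
  assumes a: "0 \<le> a" "a \<le> x" and "\<theta> \<le> 0"
  shows "AE \<omega> in M. lower_time a \<omega> < \<infinity>"
proof -
  let ?E = "{\<omega> \<in> space M. lower_time a \<omega> = \<infinity>}"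
  let ?s = "natural_scale \<theta>"
  have "?E = lower_time a -` {\<infinity>} \<inter> space M" by blast
  then have E: "?E \<in> sets M" using measurable_sets[OF lower_time_meas, of "{\<infinity>}" a] by simp
  have sb: "b \<le> ?s b" if "0 \<le> b" for b
  proof (cases "\<theta> = 0")
    case False
    then have "\<theta> < 0" using \<open>\<theta> \<le> 0\<close> by simp
    have "1 + - \<theta> * b \<le> exp (- \<theta> * b)" by (rule exp_ge_add_one_self)
    then show ?thesis using \<open>\<theta> < 0\<close> False by (simp add: natural_scale_def neg_le_divide_eq mult.commute)
  qed (simp add: natural_scale_def)
  have le: "prob ?E \<le> (?s x - ?s a) / (b - ?s a)" if b: "b > x" "b > ?s a" for b
  proof -
    let ?V = "\<lambda>\<omega>. absorbed (enn2real (exit_time a b \<omega>)) \<omega>"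
    let ?w = "(?s b - ?s x) / (?s b - ?s a)"
    have fin: "AE \<omega> in M. exit_time a b \<omega> < \<infinity>" using a b by (intro exit_time_finite) auto
    have "AE \<omega> in M. \<omega> \<in> ?E \<longrightarrow> \<omega> \<in> {\<omega> \<in> space M. ?V \<omega> = b}"
    proof (rule AE_mp[OF fin], intro AE_I2 impI)
      fix \<omega> assume \<omega>: "\<omega> \<in> space M" "exit_time a b \<omega> < \<infinity>" "\<omega> \<in> ?E"
      obtain s where s: "0 \<le> s" "exit_time a b \<omega> = ennreal s" "absorbed s \<omega> = X s \<omega>" "X s \<omega> = a \<or> X s \<omega> = b"
        using exit_value[OF \<omega>(1) a _ \<omega>(2)] b by auto
      have "0 < X s \<omega> - a"
        by (rule hitting_time_before[where Z="\<lambda>s \<omega>. X s \<omega> - a" and z=\<omega>, OF _ s(1)])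
          (use \<omega> in \<open>auto simp: lower_time_def intro!: continuous_intros X_cont\<close>)
      then show "\<omega> \<in> {\<omega> \<in> space M. ?V \<omega> = b}" using s \<omega> by auto
    qed
    then have "emeasure M ?E \<le> emeasure M {\<omega> \<in> space M. ?V \<omega> = b}"
      by (rule emeasure_mono_AE) measurable
    moreover have "emeasure M {\<omega> \<in> space M. ?V \<omega> = b} = ennreal (1 - ?w)"
    proof -
      have "emeasure M {\<omega> \<in> space M. ?V \<omega> = b} = (\<integral>\<^sup>+\<omega>. indicator {\<omega> \<in> space M. ?V \<omega> = b} \<omega> \<partial>M)"
        by (rule nn_integral_indicator[symmetric]) measurable
      also have "\<dots> = (\<integral>\<^sup>+\<omega>. indicator {b} (?V \<omega>) \<partial>M)"
        by (rule nn_integral_cong) (simp add: indicator_def)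
      also have "\<dots> = ennreal ?w * indicator {b} a + ennreal (1 - ?w) * indicator {b} b"
        using a b by (intro exit_law) auto
      finally show ?thesis using a b by (simp add: indicator_def)
    qed
    moreover have ab: "?s a < ?s b" "?s a \<le> ?s x" using a b by auto
    have "1 - ?w = (?s x - ?s a) / (?s b - ?s a)"
      using ab(1) by (simp add: field_simps)
    moreover have "(?s x - ?s a) / (?s b - ?s a) \<le> (?s x - ?s a) / (b - ?s a)"
      using a b ab sb[of b] by (intro divide_left_mono mult_pos_pos) auto
    moreover have "0 \<le> (?s x - ?s a) / (?s b - ?s a)" using ab by simp
    ultimately show ?thesis by (simp add: emeasure_eq_measure)
  qed
  have "((\<lambda>b. (?s x - ?s a) / (b - ?s a)) \<longlongrightarrow> 0) at_top"
    by (intro tendsto_divide_0[OF tendsto_const] filterlim_at_top_imp_at_infinity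
        filterlim_tendsto_add_at_top[of "\<lambda>_. - natural_scale \<theta> a", OF tendsto_const filterlim_ident, simplified])
  moreover have "\<forall>\<^sub>F b in at_top. prob ?E \<le> (?s x - ?s a) / (b - ?s a)"
    using eventually_gt_at_top[of x] eventually_gt_at_top[of "?s a"] by eventually_elim (rule le)
  ultimately have "prob ?E \<le> 0" by (intro tendsto_lowerbound) auto
  then have "prob ?E = 0" by (simp add: measure_le_0_iff)
  then have "AE \<omega> in M. \<omega> \<notin> ?E" using prob_eq_0[OF E] by simp
  then show ?thesis by (rule AE_mp) (auto intro!: AE_I2 simp: less_top)
qed

lemma lower_value:
  assumes \<omega>: "\<omega> \<in> space M" and a: "0 \<le> a" "a \<le> x" and fin: "lower_time a \<omega> < \<infinity>"
  shows "absorbed (enn2real (lower_time a \<omega>)) \<omega> = a"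
proof -
  have c: "continuous_on {0..} (\<lambda>s. X s \<omega> - a)" by (intro continuous_intros X_cont \<omega>)
  have "0 \<le> X 0 \<omega> - a" using a X_0[OF \<omega>] by simp
  then obtain s where s: "0 \<le> s" "lower_time a \<omega> = ennreal s" "X s \<omega> - a = 0" "\<And>r. 0 \<le> r \<Longrightarrow> r < s \<Longrightarrow> 0 < X r \<omega> - a"
    using hitting_time_zero[where Z="\<lambda>s \<omega>. X s \<omega> - a" and z=\<omega>, OF c _ fin[unfolded lower_time_def]]
    unfolding lower_time_def by blast
  have "absorbed s \<omega> = X s \<omega>"
    using s(4) a by (intro absorbed_before_ruin \<omega> s(1)) fastforce
  then show ?thesis using s by simp
qed

section \<open>Laws of randomly stopped paths\<close>

abbreviation law :: "('a \<times> real \<Rightarrow> ennreal) \<Rightarrow> real measure" where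
  "law \<tau> \<equiv> distr (randomized_space M) borel (\<lambda>(\<omega>, v). absorbed (enn2real (\<tau> (\<omega>, v))) \<omega>)"

lemma sets_randomized_space [measurable_cong]: "sets (randomized_space M) = sets (M \<Otimes>\<^sub>M (borel :: real measure))"
  unfolding randomized_space_def by (intro sets_pair_measure_cong) auto

text \<open>With the randomization frozen, the stopping time is an ordinary one. Together with
  Fubini this carries the results for ordinary stopping times over to randomized ones.\<close>

lemma stopping_time_section:
  assumes "stopping_time (\<lambda>t. F t \<Otimes>\<^sub>M (borel :: real measure)) \<tau>"
  shows "{\<omega> \<in> space M. \<tau> (\<omega>, v) \<le> t} \<in> sets (F t)"
proof -
  have "(\<lambda>\<omega>. (\<omega>, v)) \<in> measurable (F t) (F t \<Otimes>\<^sub>M (borel :: real measure))" by measurable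
  from measurable_compose[OF this stopping_timeD[OF assms]]
  have "Measurable.pred (F t) (\<lambda>\<omega>. \<tau> (\<omega>, v) \<le> t)" .
  then show ?thesis by (simp add: pred_def)
qed

lemma stopping_time_randomized_borel:
  assumes st: "stopping_time (\<lambda>t. F t \<Otimes>\<^sub>M (borel :: real measure)) \<tau>"
  shows "\<tau> \<in> borel_measurable (randomized_space M)"
proof (rule borel_measurableI_le)
  fix t
  have fst: "fst \<in> measurable (randomized_space M) M" by (simp add: randomized_space_def)
  have [measurable]: "fst \<in> measurable (randomized_space M) (F t)"
  proof (rule measurableI)
    fix A assume "A \<in> sets (F t)"
    then have "A \<in> sets M" using sets_F_subset by blast
    then show "fst -` A \<inter> space (randomized_space M) \<in> sets (randomized_space M)"
      by (rule measurable_sets[OF fst])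
  qed (use measurable_space[OF fst] in simp)
  have [measurable]: "snd \<in> measurable (randomized_space M) (borel :: real measure)"
    unfolding randomized_space_def by measurable
  have "(\<lambda>z. (fst z, snd z)) \<in> measurable (randomized_space M) (F t \<Otimes>\<^sub>M (borel :: real measure))"
    by measurable
  from measurable_compose[OF this stopping_timeD[OF st, of t]]
  show "{z \<in> space (randomized_space M). \<tau> z \<le> t} \<in> sets (randomized_space M)" by (simp add: pred_def)
qed

lemma law_meas:
  assumes "stopping_time (\<lambda>t. F t \<Otimes>\<^sub>M (borel :: real measure)) \<tau>"
  shows "(\<lambda>(\<omega>, v). absorbed (enn2real (\<tau> (\<omega>, v))) \<omega>) \<in> borel_measurable (randomized_space M)"
proof -
  have "(\<lambda>z. absorbed (enn2real (\<tau> z)) (fst z)) \<in> borel_measurable (randomized_space M)"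
    by (intro absorbed_joint_meas stopping_time_randomized_borel assms) (simp add: randomized_space_def)
  then show ?thesis by (simp add: case_prod_beta')
qed

lemma nn_integral_law:
  assumes st: "stopping_time (\<lambda>t. F t \<Otimes>\<^sub>M (borel :: real measure)) \<tau>" and [measurable]: "\<phi> \<in> borel_measurable borel"
  shows "(\<integral>\<^sup>+y. \<phi> y \<partial>law \<tau>) = (\<integral>\<^sup>+v. (\<integral>\<^sup>+\<omega>. \<phi> (absorbed (enn2real (\<tau> (\<omega>, v))) \<omega>) \<partial>M) \<partial>uniform01)"
proof -
  interpret U: prob_space uniform01 by (rule prob_space_uniform01)
  interpret P: pair_sigma_finite M uniform01 ..
  note [measurable] = law_meas[OF st]
  have "(\<lambda>z. \<phi> (case z of (\<omega>, v) \<Rightarrow> absorbed (enn2real (\<tau> (\<omega>, v))) \<omega>)) \<in> borel_measurable (M \<Otimes>\<^sub>M uniform01)"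
    using law_meas[OF st] unfolding randomized_space_def by measurable
  from P.nn_integral_snd[OF this] show ?thesis
    by (subst nn_integral_distr) (auto simp: randomized_space_def)
qed

lemma finite_section:
  assumes "finite_randomized_stopping_time M W \<tau>"
  shows "AE v in uniform01. AE \<omega> in M. \<tau> (\<omega>, v) < \<infinity>"
proof -
  interpret U: prob_space uniform01 by (rule prob_space_uniform01)
  interpret P: pair_sigma_finite M uniform01 ..
  have st: "stopping_time (\<lambda>t. F t \<Otimes>\<^sub>M (borel :: real measure)) \<tau>" and ae: "AE z in M \<Otimes>\<^sub>M uniform01. \<tau> z < \<infinity>"
    using assms unfolding finite_randomized_stopping_time_def randomized_space_def by blast+
  have [measurable]: "\<tau> \<in> borel_measurable (M \<Otimes>\<^sub>M uniform01)"
    using stopping_time_randomized_borel[OF st] by (simp add: randomized_space_def)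
  have "AE \<omega> in M. AE v in uniform01. \<tau> (\<omega>, v) < \<infinity>" by (rule P.AE_pair[OF ae])
  then show ?thesis by (subst (asm) P.AE_commute) measurable
qed

lemma finite_randomizedI:
  assumes st: "stopping_time (\<lambda>t. F t \<Otimes>\<^sub>M (borel :: real measure)) \<tau>"
    and fin: "\<And>v. AE \<omega> in M. \<tau> (\<omega>, v) < \<infinity>"
  shows "finite_randomized_stopping_time M W \<tau>"
proof -
  interpret U: prob_space uniform01 by (rule prob_space_uniform01)
  interpret P: pair_sigma_finite M uniform01 ..
  have [measurable]: "\<tau> \<in> borel_measurable (M \<Otimes>\<^sub>M uniform01)"
    using stopping_time_randomized_borel[OF st] by (simp add: randomized_space_def)
  have "AE v in uniform01. AE \<omega> in M. \<tau> (\<omega>, v) < \<infinity>" using fin by simp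
  then have "AE \<omega> in M. AE v in uniform01. \<tau> (\<omega>, v) < \<infinity>" by (subst P.AE_commute) measurable
  moreover have "{z \<in> space (M \<Otimes>\<^sub>M uniform01). \<tau> z < \<infinity>} \<in> sets (M \<Otimes>\<^sub>M uniform01)" by measurable
  ultimately have "AE z in M \<Otimes>\<^sub>M uniform01. \<tau> z < \<infinity>"
    by (intro P.AE_pair_measure)
  then show ?thesis using st unfolding finite_randomized_stopping_time_def randomized_space_def by blast
qed

lemma attainable_cases:
  assumes "G \<in> attainable_laws M W \<mu> \<sigma> x"
  obtains \<tau> where "G = law \<tau>" "finite_randomized_stopping_time M W \<tau>" "stopping_time (\<lambda>t. F t \<Otimes>\<^sub>M (borel :: real measure)) \<tau>"
proof -
  obtain \<tau> where \<tau>: "G = law \<tau>" "finite_randomized_stopping_time M W \<tau>"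
    using assms unfolding attainable_laws_def by blast
  then show ?thesis using that unfolding finite_randomized_stopping_time_def by blast
qed

lemma attainable_distribution:
  assumes x: "0 \<le> x" and "G \<in> attainable_laws M W \<mu> \<sigma> x"
  shows "real_distribution G" and "AE y in G. 0 \<le> y"
proof -
  obtain \<tau> where G: "G = law \<tau>" and fin: "finite_randomized_stopping_time M W \<tau>"
    and st: "stopping_time (\<lambda>t. F t \<Otimes>\<^sub>M (borel :: real measure)) \<tau>"
    by (rule attainable_cases[OF assms(2)])
  interpret U: prob_space uniform01 by (rule prob_space_uniform01)
  interpret P: pair_prob_space M uniform01 ..
  have "prob_space (randomized_space M)" unfolding randomized_space_def by (rule P.prob_space_axioms)
  then have "prob_space G" unfolding G using law_meas[OF st] by (rule prob_space.prob_space_distr)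
  then show "real_distribution G"
    by (simp add: real_distribution_def real_distribution_axioms_def G)
  have "AE z in randomized_space M. 0 \<le> (case z of (\<omega>, v) \<Rightarrow> absorbed (enn2real (\<tau> (\<omega>, v))) \<omega>)"
    using absorbed_nonneg[OF _ x] by (intro AE_I2) (auto simp: randomized_space_def space_pair_measure)
  then show "AE y in G. 0 \<le> y" unfolding G using law_meas[OF st] by (subst AE_distr_iff) auto
qed

lemma attainable_scale_le:
  assumes x: "0 \<le> x" and "G \<in> attainable_laws M W \<mu> \<sigma> x"
  shows "(\<integral>\<^sup>+y. ennreal (natural_scale \<theta> y) \<partial>G) \<le> ennreal (natural_scale \<theta> x)"
proof -
  obtain \<tau> where G: "G = law \<tau>" and fin: "finite_randomized_stopping_time M W \<tau>"
    and st: "stopping_time (\<lambda>t. F t \<Otimes>\<^sub>M (borel :: real measure)) \<tau>"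
    by (rule attainable_cases[OF assms(2)])
  interpret U: prob_space uniform01 by (rule prob_space_uniform01)
  have "(\<integral>\<^sup>+y. ennreal (natural_scale \<theta> y) \<partial>G)
      = (\<integral>\<^sup>+v. (\<integral>\<^sup>+\<omega>. ennreal (natural_scale \<theta> (absorbed (enn2real (\<tau> (\<omega>, v))) \<omega>)) \<partial>M) \<partial>uniform01)"
    unfolding G by (rule nn_integral_law[OF st]) measurable
  also have "\<dots> \<le> (\<integral>\<^sup>+v. ennreal (natural_scale \<theta> x) \<partial>uniform01)"
  proof (rule nn_integral_mono_AE, rule AE_mp[OF finite_section[OF fin]], intro AE_I2 impI)
    fix v assume "AE \<omega> in M. \<tau> (\<omega>, v) < \<infinity>"
    then show "(\<integral>\<^sup>+\<omega>. ennreal (natural_scale \<theta> (absorbed (enn2real (\<tau> (\<omega>, v))) \<omega>)) \<partial>M) \<le> ennreal (natural_scale \<theta> x)"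
      by (rule stopped_scale_le[where \<tau>="\<lambda>\<omega>. \<tau> (\<omega>, v)", OF x stopping_time_section[OF st]])
  qed
  also have "\<dots> = ennreal (natural_scale \<theta> x)" by (simp add: U.emeasure_space_1)
  finally show ?thesis .
qed

lemma attainable_scale_eq:
  assumes x: "0 \<le> x" and "G \<in> attainable_laws M W \<mu> \<sigma> x" and "\<theta> > 0"
  shows "(\<integral>\<^sup>+y. ennreal (natural_scale \<theta> y) \<partial>G) = ennreal (natural_scale \<theta> x)"
proof -
  obtain \<tau> where G: "G = law \<tau>" and fin: "finite_randomized_stopping_time M W \<tau>"
    and st: "stopping_time (\<lambda>t. F t \<Otimes>\<^sub>M (borel :: real measure)) \<tau>"
    by (rule attainable_cases[OF assms(2)])
  interpret U: prob_space uniform01 by (rule prob_space_uniform01)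
  \<comment> \<open>For positive \<theta> the scale is bounded above, so no mean is lost in the
    limit.\<close>
  have le: "natural_scale \<theta> y \<le> 1 / \<theta>" for y
    using \<open>\<theta> > 0\<close> by (simp add: natural_scale_def divide_right_mono)
  have "(\<integral>\<^sup>+y. ennreal (natural_scale \<theta> y) \<partial>G)
      = (\<integral>\<^sup>+v. (\<integral>\<^sup>+\<omega>. ennreal (natural_scale \<theta> (absorbed (enn2real (\<tau> (\<omega>, v))) \<omega>)) \<partial>M) \<partial>uniform01)"
    unfolding G by (rule nn_integral_law[OF st]) measurable
  also have "\<dots> = (\<integral>\<^sup>+v. ennreal (natural_scale \<theta> x) \<partial>uniform01)"
  proof (rule nn_integral_cong_AE, rule AE_mp[OF finite_section[OF fin]], intro AE_I2 impI)
    fix v assume "AE \<omega> in M. \<tau> (\<omega>, v) < \<infinity>"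
    then show "(\<integral>\<^sup>+\<omega>. ennreal (natural_scale \<theta> (absorbed (enn2real (\<tau> (\<omega>, v))) \<omega>)) \<partial>M) = ennreal (natural_scale \<theta> x)"
      by (rule stopped_scale_eq[where \<tau>="\<lambda>\<omega>. \<tau> (\<omega>, v)", OF x stopping_time_section[OF st] _ le])
  qed
  also have "\<dots> = ennreal (natural_scale \<theta> x)" by (simp add: U.emeasure_space_1)
  finally show ?thesis .
qed

text \<open>The variable known at time 0 selects the interval to be left, which makes mixtures of
  exit laws over measurable families of intervals attainable.\<close>

lemma attainable_exit:
  fixes a b :: "real \<Rightarrow> real"
  assumes ab: "\<And>v. 0 \<le> a v" "\<And>v. a v \<le> x" "\<And>v. x \<le> b v"
    and [measurable]: "a \<in> borel_measurable borel" "b \<in> borel_measurable borel"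
  obtains G where "G \<in> attainable_laws M W \<mu> \<sigma> x"
    "\<And>\<phi>. \<phi> \<in> borel_measurable borel \<Longrightarrow> (\<integral>\<^sup>+y. \<phi> y \<partial>G) = (\<integral>\<^sup>+v.
      ennreal ((natural_scale \<theta> (b v) - natural_scale \<theta> x) / (natural_scale \<theta> (b v) - natural_scale \<theta> (a v))) * \<phi> (a v) +
      ennreal (1 - (natural_scale \<theta> (b v) - natural_scale \<theta> x) / (natural_scale \<theta> (b v) - natural_scale \<theta> (a v))) * \<phi> (b v) \<partial>uniform01)"
proof -
  let ?Z = "\<lambda>s (\<omega>, v). exit_dist (a v) (b v) s \<omega>"
  let ?\<tau> = "hitting_time ?Z"
  have st: "stopping_time (\<lambda>t. F t \<Otimes>\<^sub>M (borel :: real measure)) ?\<tau>"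
    by (rule hitting_time_randomized) (auto simp: case_prod_beta' intro!: continuous_intros X_cont)
  have sec: "?\<tau> (\<omega>, v) = exit_time (a v) (b v) \<omega>" for \<omega> v by (simp add: hitting_time_def)
  have "finite_randomized_stopping_time M W ?\<tau>"
    by (rule finite_randomizedI[OF st]) (use ab exit_time_finite in \<open>auto simp: sec\<close>)
  then have "law ?\<tau> \<in> attainable_laws M W \<mu> \<sigma> x" unfolding attainable_laws_def by blast
  moreover have "(\<integral>\<^sup>+y. \<phi> y \<partial>law ?\<tau>) = (\<integral>\<^sup>+v.
      ennreal ((natural_scale \<theta> (b v) - natural_scale \<theta> x) / (natural_scale \<theta> (b v) - natural_scale \<theta> (a v))) * \<phi> (a v) +
      ennreal (1 - (natural_scale \<theta> (b v) - natural_scale \<theta> x) / (natural_scale \<theta> (b v) - natural_scale \<theta> (a v))) * \<phi> (b v) \<partial>uniform01)"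
    if "\<phi> \<in> borel_measurable borel" for \<phi>
    unfolding nn_integral_law[OF st that] unfolding sec exit_law[OF ab(1) ab(2) ab(3) that] ..
  ultimately show ?thesis by (rule that)
qed

text \<open>For \<theta> <= 0 every lower level is reached almost surely. These point masses are the
  deviations that permit a nonnegative slope in \<open>supporting_line\<close>.\<close>

lemma attainable_lower:
  assumes a: "0 \<le> a" "a \<le> x" and "\<theta> \<le> 0"
  shows "return borel a \<in> attainable_laws M W \<mu> \<sigma> x"
proof -
  let ?Z = "\<lambda>s (\<omega>, v :: real). X s \<omega> - a"
  let ?\<tau> = "hitting_time ?Z"
  have st: "stopping_time (\<lambda>t. F t \<Otimes>\<^sub>M (borel :: real measure)) ?\<tau>"
    by (rule hitting_time_randomized) (auto simp: case_prod_beta' intro!: continuous_intros X_cont)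
  have sec: "?\<tau> (\<omega>, v) = lower_time a \<omega>" for \<omega> v by (simp add: hitting_time_def lower_time_def)
  have "finite_randomized_stopping_time M W ?\<tau>"
    by (rule finite_randomizedI[OF st]) (use lower_time_finite[OF assms] in \<open>auto simp: sec\<close>)
  then have "law ?\<tau> \<in> attainable_laws M W \<mu> \<sigma> x" unfolding attainable_laws_def by blast
  moreover have "law ?\<tau> = return borel a"
  proof (rule measure_eqI)
    interpret U: prob_space uniform01 by (rule prob_space_uniform01)
    fix A assume "A \<in> sets (law ?\<tau>)"
    then have A[measurable]: "A \<in> sets borel" by simp
    have "emeasure (law ?\<tau>) A = (\<integral>\<^sup>+y. indicator A y \<partial>law ?\<tau>)" by simp
    also have "\<dots> = (\<integral>\<^sup>+v. (\<integral>\<^sup>+\<omega>. indicator A (absorbed (enn2real (lower_time a \<omega>)) \<omega>) \<partial>M) \<partial>uniform01)"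
      by (subst nn_integral_law[OF st]) (auto simp: sec)
    also have "(\<integral>\<^sup>+\<omega>. indicator A (absorbed (enn2real (lower_time a \<omega>)) \<omega>) \<partial>M) = (\<integral>\<^sup>+\<omega>. indicator A a \<partial>M)"
      using lower_time_finite[OF assms]
      by (intro nn_integral_cong_AE, elim AE_mp) (auto intro!: AE_I2 simp: lower_value[OF _ a])
    finally show "emeasure (law ?\<tau>) A = emeasure (return borel a) A"
      by (simp add: emeasure_space_1 U.emeasure_space_1)
  qed simp
  ultimately show ?thesis by simp
qed

end

section \<open>Matching of lower and upper parts of a monotone profile\<close>

lemma nn_integral_uniform01:
  "f \<in> borel_measurable borel \<Longrightarrow> (\<integral>\<^sup>+v. f v \<partial>uniform01) = (\<integral>\<^sup>+v. indicator {0..1} v * f v \<partial>lborel)"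
  by (subst nn_integral_uniform_measure) (auto simp: mult.commute divide_ennreal_def)

lemma uniform01_density: "uniform01 = density lborel (\<lambda>v. ennreal (indicator {0..1} v))"
  by (simp add: uniform_measure_def ennreal_indicator divide_ennreal_def)

lemma integral_uniform01:
  fixes f :: "real \<Rightarrow> real"
  shows "f \<in> borel_measurable borel \<Longrightarrow> (\<integral>v. f v \<partial>uniform01) = (\<integral>v. indicator {0..1} v * f v \<partial>lborel)"
  unfolding uniform01_density by (subst integral_density) auto

text \<open>
  Let \<open>V\<close> be uniform on \<open>[0,1]\<close>. The law of \<open>\<psi> V\<close>, of mean 1, is realized by leaving the interval
  \<open>(low v, high v)\<close> from the starting point 1. An argument \<open>v\<close> with \<open>\<psi> v < 1\<close> is matched with the one
  with \<open>\<psi> > 1\<close> at which \<open>level\<close>, the integral of \<open>\<psi> - 1\<close> over \<open>[v,1]\<close>, takes the same value; the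
  measures \<open>(1 - \<psi>)\<^sup>+ dv\<close> and \<open>(\<psi> - 1)\<^sup>+ dv\<close> have the same image under \<open>level\<close>, which is what makes the exit probabilities fit.
\<close>

locale mono_profile =
  fixes \<psi> :: "real \<Rightarrow> real" and K :: real
  assumes mono: "mono \<psi>" and nonneg: "\<And>v. 0 \<le> \<psi> v" and bound: "\<And>v. \<psi> v \<le> K"
    and mean: "(\<integral>v. \<psi> v \<partial>uniform01) = 1"
begin

lemma \<psi>_meas [measurable]: "\<psi> \<in> borel_measurable borel"
  using mono by (rule borel_measurable_mono)

lemma K1: "1 \<le> K"
proof -
  interpret U: prob_space uniform01 by (rule prob_space_uniform01)
  have "integrable uniform01 \<psi>"
    using nonneg bound by (intro U.integrable_const_bound[where B=K]) auto
  then have "(\<integral>v. \<psi> v \<partial>uniform01) \<le> (\<integral>v. K \<partial>uniform01)"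
    using bound by (intro integral_mono) auto
  then show ?thesis by (simp add: mean U.prob_space)
qed

section \<open>Superlevel sets of the integrated profile\<close>

definition D :: "real \<Rightarrow> real \<Rightarrow> real" where
  "D v w = (\<integral>t. indicator {v<..w} t * (\<psi> t - 1) \<partial>lborel)"

lemma integrable_Ioc: "integrable lborel (indicator {v<..w::real} :: real \<Rightarrow> real)"
  by (cases "v \<le> w") (auto intro!: integrable_real_indicator)

lemma integrable_D: "integrable lborel (\<lambda>t. indicator {v<..w} t * (\<psi> t - 1))"
proof (rule Bochner_Integration.integrable_bound)
  show "integrable lborel (\<lambda>t. indicator {v<..w} t * (K + 1))" using integrable_Ioc by simp
  show "AE t in lborel. norm (indicator {v<..w} t * (\<psi> t - 1)) \<le> norm (indicator {v<..w} t * (K + 1))"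
  proof (intro AE_I2)
    fix t show "norm (indicator {v<..w} t * (\<psi> t - 1)) \<le> norm (indicator {v<..w} t * (K + 1))"
      using nonneg[of t] bound[of t] by (auto simp: indicator_def)
  qed
qed measurable

lemma D_add: "v \<le> w \<Longrightarrow> w \<le> z \<Longrightarrow> D v z = D v w + D w z"
  unfolding D_def
  by (subst Bochner_Integration.integral_add[OF integrable_D integrable_D, symmetric])
     (auto intro!: Bochner_Integration.integral_cong simp: indicator_def)

lemma D_ge:
  assumes "v \<le> w" "\<And>t. v < t \<Longrightarrow> t \<le> w \<Longrightarrow> c \<le> \<psi> t - 1"
  shows "(w - v) * c \<le> D v w"
proof -
  have "(\<integral>t. indicator {v<..w} t * c \<partial>lborel) \<le> D v w"
    unfolding D_def using assms integrable_D integrable_Ioc by (intro integral_mono) (simp_all split: split_indicator)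
  then show ?thesis using assms(1) by simp
qed

lemma D_le:
  assumes "v \<le> w" "\<And>t. v < t \<Longrightarrow> t \<le> w \<Longrightarrow> \<psi> t - 1 \<le> c"
  shows "D v w \<le> (w - v) * c"
proof -
  have "D v w \<le> (\<integral>t. indicator {v<..w} t * c \<partial>lborel)"
    unfolding D_def using assms integrable_D integrable_Ioc by (intro integral_mono) (simp_all split: split_indicator)
  then show ?thesis using assms(1) by simp
qed

text \<open>With \<open>D_neg\<close>: the sign of an integral yields one point where \<psi> lies on
  that side of 1, and monotonicity spreads it to the right, respectively to the left.\<close>

lemma D_pos: assumes "v \<le> w" "D v w > 0" obtains t where "v < t" "t \<le> w" "1 < \<psi> t"
proof (cases "\<exists>t. v < t \<and> t \<le> w \<and> 1 < \<psi> t")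
  case False
  then have "D v w \<le> (w - v) * 0" using assms(1) by (intro D_le) (auto simp: not_less)
  then show ?thesis using assms(2) by simp
qed (use that in blast)

lemma D_neg: assumes "v \<le> w" "D v w < 0" obtains t where "v < t" "t \<le> w" "\<psi> t < 1"
proof (cases "\<exists>t. v < t \<and> t \<le> w \<and> \<psi> t < 1")
  case False
  then have "(w - v) * 0 \<le> D v w" using assms(1) by (intro D_ge) (auto simp: not_less)
  then show ?thesis using assms(2) by simp
qed (use that in blast)

definition level :: "real \<Rightarrow> real" where "level v = D v 1"

lemma level_diff: "v \<le> w \<Longrightarrow> w \<le> 1 \<Longrightarrow> level v - level w = D v w"
  unfolding level_def by (simp add: D_add[of v w 1])

lemma level_1: "level 1 = 0"
  by (simp add: level_def D_def)

lemma level_0: "level 0 = 0"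
proof -
  have i: "integrable lborel (\<lambda>v. indicator {0<..1} v * \<psi> v)"
    using Bochner_Integration.integrable_add[OF integrable_D[of 0 1], of "\<lambda>v. indicator {0<..1} v * 1"]
    by (simp add: algebra_simps)
  have "1 = (\<integral>v. indicator {0..1} v * \<psi> v \<partial>lborel)" by (rule trans[OF mean[symmetric] integral_uniform01[OF \<psi>_meas]])
  also have "\<dots> = (\<integral>v. indicator {0<..1} v * \<psi> v \<partial>lborel)"
    by (rule integral_cong_AE, measurable) (rule AE_mp[OF AE_lborel_singleton[of "0::real"]], auto intro!: AE_I2 simp: indicator_def)
  finally have "(\<integral>v. indicator {0<..1} v * \<psi> v \<partial>lborel) = 1" by simp
  then show ?thesis using i by (simp add: level_def D_def right_diff_distrib)
qed

lemma level_lipschitz: "v \<le> w \<Longrightarrow> w \<le> 1 \<Longrightarrow> \<bar>level v - level w\<bar> \<le> (w - v) * (K + 1)"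
proof -
  assume vw: "v \<le> w" "w \<le> 1"
  have "(w - v) * (- (K + 1)) \<le> D v w" using nonneg K1 vw by (intro D_ge) (auto simp: algebra_simps intro: order_trans[OF _ nonneg])
  moreover have "D v w \<le> (w - v) * (K + 1)" using bound vw by (intro D_le) (auto intro: order_trans[OF bound])
  ultimately show ?thesis using level_diff[OF vw] by (simp add: abs_le_iff algebra_simps)
qed

lemma level_cont: "continuous_on {0..1} level"
proof (rule lipschitz_on_continuous_on)
  show "(K + 1)-lipschitz_on {0..1} level"
  proof (rule lipschitz_onI)
    fix v w :: real assume "v \<in> {0..1}" "w \<in> {0..1}"
    then show "dist (level v) (level w) \<le> (K + 1) * dist v w"
      using level_lipschitz[of v w] level_lipschitz[of w v]
      by (cases "v \<le> w") (auto simp: dist_real_def mult.commute abs_minus_commute)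
  qed (use K1 in simp)
qed

text \<open>As \<psi> - 1 changes sign at most once, from below to above, \<open>level\<close> first
  rises and then falls, with value 0 at both ends.\<close>

lemma level_nonneg: assumes "0 \<le> v" "v \<le> 1" shows "0 \<le> level v"
proof (rule ccontr)
  assume "\<not> 0 \<le> level v"
  then have "D v 1 < 0" by (simp add: level_def)
  then obtain t where t: "v < t" "t \<le> 1" "\<psi> t < 1" by (rule D_neg[OF assms(2)])
  have "D 0 v \<le> (v - 0) * 0"
  proof (rule D_le)
    fix s assume "s \<le> v"
    then show "\<psi> s - 1 \<le> 0" using monoD[OF mono, of s t] t by simp
  qed (use assms in simp)
  then show False using level_diff[of 0 v] assms level_0 \<open>\<not> 0 \<le> level v\<close> by simp
qed

text \<open>By unimodality a superlevel set is an interval at whose two ends \<open>level\<close>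
  agrees, and the integral is the difference of these two values. It says that deficits and excesses
  balance above every height.\<close>

lemma superlevel_balance:
  "(\<integral>t. indicator {v \<in> {0<..1}. c < level v} t * (\<psi> t - 1) \<partial>lborel) = 0"
proof (cases "\<exists>u\<in>{0..1}. c < level u")
  case False
  then have "{v \<in> {0<..1}. c < level v} = {}" by auto
  then show ?thesis by simp
next
  case True
  then obtain u where u: "0 \<le> u" "u \<le> 1" "c < level u" by auto
  show ?thesis
  proof (cases "c < 0")
    case True
    then have "{v \<in> {0<..1}. c < level v} = {0<..1}"
      using level_nonneg by (auto intro: less_le_trans)
    then show ?thesis using level_0 by (simp add: level_def D_def)
  next
    case False
    let ?L = "{v \<in> {0..u}. level v \<in> {..c}}" and ?R = "{v \<in> {u..1}. level v \<in> {..c}}"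
    have "closed ({0..u} \<inter> level -` {..c})" "closed ({u..1} \<inter> level -` {..c})"
      using u by (auto intro!: continuous_closed_preimage continuous_on_subset[OF level_cont])
    moreover have "{0..u} \<inter> level -` {..c} = ?L" "{u..1} \<inter> level -` {..c} = ?R" by auto
    ultimately have cl: "closed ?L" "closed ?R" by simp_all
    \<comment> \<open>The last point before \<open>u\<close> and the first one after
      \<open>u\<close> at which \<open>level\<close> is at most \<open>c\<close>; by continuity the
      value there is exactly \<open>c\<close>.\<close>
    define \<alpha> where "\<alpha> = Sup ?L"
    define \<beta> where "\<beta> = Inf ?R"
    have L: "?L \<noteq> {}" "bdd_above ?L" and R: "?R \<noteq> {}" "bdd_below ?R"
    proof -
      have "0 \<in> ?L" "1 \<in> ?R" using u False level_0 level_1 by auto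
      then show "?L \<noteq> {}" "?R \<noteq> {}" by blast+
    qed (auto intro: bdd_aboveI[of _ u] bdd_belowI[of _ u])
    have aL: "\<alpha> \<in> ?L" unfolding \<alpha>_def using L cl by (intro closed_contains_Sup)
    have bR: "\<beta> \<in> ?R" unfolding \<beta>_def using R cl by (intro closed_contains_Inf)
    have above: "c < level v" if "\<alpha> < v" "v \<le> u" for v
      using cSup_upper[OF _ L(2), of v] that aL unfolding \<alpha>_def[symmetric] by force
    have below: "c < level v" if "u \<le> v" "v < \<beta>" for v
      using cInf_lower[OF _ R(2), of v] that bR unfolding \<beta>_def[symmetric] by force
    have au: "0 \<le> \<alpha>" "\<alpha> < u" "level \<alpha> \<le> c" using aL u by (auto simp: order_le_less)
    have bu: "\<beta> \<le> 1" "u < \<beta>" "level \<beta> \<le> c" using bR u by (auto simp: order_le_less)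
    have la: "level \<alpha> = c"
    proof (rule ccontr)
      assume "level \<alpha> \<noteq> c"
      then have "level \<alpha> < c" using au by simp
      moreover have "continuous_on {\<alpha>..u} level" using au u by (intro continuous_on_subset[OF level_cont]) auto
      ultimately obtain z where "\<alpha> \<le> z" "z \<le> u" "level z = c" using IVT'[of level \<alpha> c u] u au by auto
      then show False using above[of z] \<open>level \<alpha> < c\<close> by (cases "z = \<alpha>") auto
    qed
    have lb: "level \<beta> = c"
    proof (rule ccontr)
      assume "level \<beta> \<noteq> c"
      then have "level \<beta> < c" using bu by simp
      moreover have "continuous_on {u..\<beta>} level" using bu u by (intro continuous_on_subset[OF level_cont]) auto
      ultimately obtain z where "u \<le> z" "z \<le> \<beta>" "level z = c" using IVT2'[of level \<beta> c u] u bu by auto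
      then show False using below[of z] \<open>level \<beta> < c\<close> by (cases "z = \<beta>") auto
    qed
    \<comment> \<open>A second excursion above \<open>c\<close>, before \<alpha>, would force \<psi>
      > 1 somewhere up to \<alpha>, hence everywhere after it, and \<open>level\<close> could not
      rise from \<alpha> to \<open>u\<close>.\<close>
    have left: "level v \<le> c" if v: "0 \<le> v" "v \<le> \<alpha>" for v
    proof (rule ccontr)
      assume "\<not> level v \<le> c"
      then have "D v \<alpha> > 0" using level_diff[of v \<alpha>] that au u la by simp
      then obtain t where t: "v < t" "t \<le> \<alpha>" "1 < \<psi> t" by (rule D_pos[OF v(2)])
      have "(u - \<alpha>) * 0 \<le> D \<alpha> u"
      proof (rule D_ge)
        fix s assume "\<alpha> < s"
        then show "0 \<le> \<psi> s - 1" using monoD[OF mono, of t s] t by simp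
      qed (use au in simp)
      then show False using level_diff[of \<alpha> u] au u la by simp
    qed
    have right: "level v \<le> c" if v: "\<beta> \<le> v" "v \<le> 1" for v
    proof (rule ccontr)
      assume "\<not> level v \<le> c"
      then have "D \<beta> v < 0" using level_diff[of \<beta> v] that bu u lb by simp
      then obtain t where t: "\<beta> < t" "t \<le> v" "\<psi> t < 1" by (rule D_neg[OF v(1)])
      have "D u \<beta> \<le> (\<beta> - u) * 0"
      proof (rule D_le)
        fix s assume "s \<le> \<beta>"
        then show "\<psi> s - 1 \<le> 0" using monoD[OF mono, of s t] t by simp
      qed (use bu in simp)
      then show False using level_diff[of u \<beta>] bu u lb by simp
    qed
    have T: "{v \<in> {0<..1}. c < level v} = {\<alpha><..<\<beta>}"
    proof (intro set_eqI iffI)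
      fix v assume v: "v \<in> {v \<in> {0<..1}. c < level v}"
      then show "v \<in> {\<alpha><..<\<beta>}" using left[of v] right[of v] by (auto simp: not_le[symmetric])
    next
      fix v assume "v \<in> {\<alpha><..<\<beta>}"
      then show "v \<in> {v \<in> {0<..1}. c < level v}" using above[of v] below[of v] au bu by (cases "v \<le> u") auto
    qed
    have "(\<integral>t. indicator {v \<in> {0<..1}. c < level v} t * (\<psi> t - 1) \<partial>lborel) = D \<alpha> \<beta>"
      unfolding D_def T
    proof (rule integral_cong_AE)
      show "AE t in lborel. indicator {\<alpha><..<\<beta>} t * (\<psi> t - 1) = indicator {\<alpha><..\<beta>} t * (\<psi> t - 1)"
        by (rule AE_mp[OF AE_lborel_singleton[of \<beta>]]) (auto intro!: AE_I2 split: split_indicator)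
    qed measurable
    also have "\<dots> = 0" using level_diff[of \<alpha> \<beta>] la lb au bu by simp
    finally show ?thesis .
  qed
qed

lemma level_meas [measurable]: "level \<in> borel_measurable borel"
proof -
  have "level = (\<lambda>v. \<integral>t. (if v < t \<and> t \<le> 1 then \<psi> t - 1 else 0) \<partial>lborel)"
    unfolding level_def D_def by (intro ext Bochner_Integration.integral_cong) (auto simp: indicator_def)
  also have "\<dots> \<in> borel_measurable borel" by measurable
  finally show ?thesis .
qed

section \<open>Transport between the two sides of the mean\<close>

definition gain :: "real \<Rightarrow> real" where "gain v = indicator {0<..1} v * max (\<psi> v - 1) 0"
definition loss :: "real \<Rightarrow> real" where "loss v = indicator {0<..1} v * max (1 - \<psi> v) 0"

lemma gain_meas [measurable]: "gain \<in> borel_measurable borel"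
  and loss_meas [measurable]: "loss \<in> borel_measurable borel"
  unfolding gain_def loss_def by measurable

lemma gain_nonneg: "0 \<le> gain v" and loss_nonneg: "0 \<le> loss v"
  by (auto simp: gain_def loss_def)

lemma integrable_gain: "integrable lborel gain" and integrable_loss: "integrable lborel loss"
proof -
  have "integrable lborel (\<lambda>t. indicator {0<..1::real} t * (K + 1))" using integrable_Ioc by simp
  moreover have "norm (gain t) \<le> norm (indicator {0<..1::real} t * (K + 1))"
    "norm (loss t) \<le> norm (indicator {0<..1::real} t * (K + 1))" for t
    using nonneg[of t] bound[of t] K1 by (auto simp: indicator_def gain_def loss_def)
  ultimately show "integrable lborel gain" "integrable lborel loss"
    by (auto intro: Bochner_Integration.integrable_bound[where f="\<lambda>t. indicator {0<..1::real} t * (K + 1)"])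
qed

text \<open>Finite measures on the line agree once they agree on open upper rays, and there the
  claim is \<open>superlevel_balance\<close>.\<close>

lemma level_law_eq:
  "distr (density lborel (\<lambda>v. ennreal (loss v))) borel level = distr (density lborel (\<lambda>v. ennreal (gain v))) borel level"
proof (rule measure_eqI_lessThan)
  have em: "emeasure (distr (density lborel (\<lambda>v. ennreal (f v))) borel level) {c<..} = ennreal (\<integral>v. indicator {v. c < level v} v * f v \<partial>lborel)"
    if f[measurable]: "f \<in> borel_measurable borel" "integrable lborel f" "\<And>v. 0 \<le> f v" for f c
  proof -
    have "level -` {c<..} = {v. c < level v}" by auto
    then have "emeasure (distr (density lborel (\<lambda>v. ennreal (f v))) borel level) {c<..}
        = (\<integral>\<^sup>+v. ennreal (f v) * indicator {v. c < level v} v \<partial>lborel)"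
      by (simp add: emeasure_distr emeasure_density)
    also have "\<dots> = (\<integral>\<^sup>+v. ennreal (indicator {v. c < level v} v * f v) \<partial>lborel)"
      by (intro nn_integral_cong) (auto simp: indicator_def)
    also have "\<dots> = ennreal (\<integral>v. indicator {v. c < level v} v * f v \<partial>lborel)"
      using f integrable_mult_indicator[OF _ f(2), of "{v. c < level v}"] by (intro nn_integral_eq_integral) auto
    finally show ?thesis .
  qed
  fix c
  show "emeasure (distr (density lborel (\<lambda>v. ennreal (loss v))) borel level) {c<..} < \<infinity>"
    by (simp add: em integrable_loss loss_nonneg)
  have i: "integrable lborel (\<lambda>v. indicator {v. c < level v} v * gain v)" "integrable lborel (\<lambda>v. indicator {v. c < level v} v * loss v)"
    using integrable_mult_indicator[OF _ integrable_gain, of "{v. c < level v}"]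
      integrable_mult_indicator[OF _ integrable_loss, of "{v. c < level v}"] by auto
  have "(\<integral>v. indicator {v. c < level v} v * gain v \<partial>lborel) - (\<integral>v. indicator {v. c < level v} v * loss v \<partial>lborel)
    = (\<integral>v. indicator {v \<in> {0<..1}. c < level v} v * (\<psi> v - 1) \<partial>lborel)"
    by (subst Bochner_Integration.integral_diff[OF i, symmetric], intro Bochner_Integration.integral_cong)
       (auto simp: gain_def loss_def indicator_def max_def)
  then show "emeasure (distr (density lborel (\<lambda>v. ennreal (loss v))) borel level) {c<..}
      = emeasure (distr (density lborel (\<lambda>v. ennreal (gain v))) borel level) {c<..}"
    by (simp only: em[OF loss_meas integrable_loss loss_nonneg] em[OF gain_meas integrable_gain gain_nonneg] superlevel_balance) simp
qed auto

lemma level_push: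
  assumes [measurable]: "k \<in> borel_measurable borel"
  shows "(\<integral>\<^sup>+v. ennreal (loss v) * k (level v) \<partial>lborel) = (\<integral>\<^sup>+v. ennreal (gain v) * k (level v) \<partial>lborel)"
proof -
  have "(\<integral>\<^sup>+v. ennreal (f v) * k (level v) \<partial>lborel) = (\<integral>\<^sup>+\<sigma>. k \<sigma> \<partial>distr (density lborel (\<lambda>v. ennreal (f v))) borel level)"
    if [measurable]: "f \<in> borel_measurable borel" for f
    by (simp add: nn_integral_distr nn_integral_density)
  then show ?thesis by (simp add: level_law_eq)
qed

text \<open>Generalized inverse of \<open>level\<close> on its rising branch, composed with \<psi>;
  \<open>upper\<close> does the same on the falling branch. The added points 1 and 0 keep the sets
  nonempty, and clamping puts both values on the right side of the mean for every argument.\<close>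

definition lower :: "real \<Rightarrow> real" where
  "lower \<sigma> = min 1 (\<psi> (Inf ({w \<in> {0..1}. \<sigma> \<le> level w} \<union> {1})))"
definition upper :: "real \<Rightarrow> real" where
  "upper \<sigma> = max 1 (\<psi> (Sup ({w \<in> {0..1}. \<sigma> \<le> level w} \<union> {0})))"

lemma lower_meas [measurable]: "lower \<in> borel_measurable borel"
proof (rule borel_measurable_mono)
  show "mono lower"
    unfolding lower_def
    by (intro monoI min.mono order_refl monoD[OF mono] cInf_superset_mono) (auto intro: bdd_belowI[of _ 0])
qed

lemma upper_meas [measurable]: "upper \<in> borel_measurable borel"
proof -
  have "mono (\<lambda>\<sigma>. - upper \<sigma>)"
    unfolding upper_def
    by (intro monoI le_imp_neg_le max.mono order_refl monoD[OF mono] cSup_subset_mono) (auto intro: bdd_aboveI[of _ 1])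
  then have "(\<lambda>\<sigma>. - (- upper \<sigma>)) \<in> borel_measurable borel"
    by (intro borel_measurable_uminus borel_measurable_mono)
  then show ?thesis by simp
qed

lemma lower_bounds: "0 \<le> lower \<sigma>" "lower \<sigma> \<le> 1" and upper_bounds: "1 \<le> upper \<sigma>" "upper \<sigma> \<le> K"
  using nonneg bound K1 by (auto simp: lower_def upper_def)

text \<open>If \<psi> v < 1, then \<open>level\<close> rises strictly up to \<open>v\<close>, so
  \<open>v\<close> is the first point to reach its own level.\<close>

lemma lower_level:
  assumes v: "0 \<le> v" "v \<le> 1" and less: "\<psi> v < 1"
  shows "lower (level v) = \<psi> v"
proof -
  have "Inf ({w \<in> {0..1}. level v \<le> level w} \<union> {1}) = v"
  proof (rule cInf_eq_minimum)
    fix w assume w: "w \<in> {w \<in> {0..1}. level v \<le> level w} \<union> {1}"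
    show "v \<le> w"
    proof (rule ccontr)
      assume "\<not> v \<le> w"
      then have wv: "w < v" "level v \<le> level w" using w v by auto
      have "D w v \<le> (v - w) * (\<psi> v - 1)" using wv monoD[OF mono] by (intro D_le) auto
      also have "\<dots> < 0" using wv less by (simp add: mult_pos_neg)
      finally show False using level_diff[of w v] wv v by simp
    qed
  qed (use v in auto)
  then show ?thesis using less by (simp add: lower_def)
qed

lemma upper_level:
  assumes v: "0 \<le> v" "v \<le> 1" and less: "1 < \<psi> v"
  shows "upper (level v) = \<psi> v"
proof -
  have "Sup ({w \<in> {0..1}. level v \<le> level w} \<union> {0}) = v"
  proof (rule cSup_eq_maximum)
    fix w assume w: "w \<in> {w \<in> {0..1}. level v \<le> level w} \<union> {0}"
    show "w \<le> v"
    proof (rule ccontr)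
      assume "\<not> w \<le> v"
      then have wv: "v < w" "w \<le> 1" "level v \<le> level w" using w v by auto
      have "0 < (w - v) * (\<psi> v - 1)" using wv less by simp
      also have "\<dots> \<le> D v w" using wv monoD[OF mono] by (intro D_ge) auto
      finally show False using level_diff[of v w] wv v by simp
    qed
  qed (use v in auto)
  then show ?thesis using less by (simp add: upper_def)
qed

text \<open>Where \<psi> v = 1 the interval degenerates to the starting point. The case is set apart
  because \<open>level\<close> is constant on such a piece and does not identify
  \<open>v\<close>.\<close>

definition low :: "real \<Rightarrow> real" where "low v = (if \<psi> v = 1 then 1 else lower (level v))"
definition high :: "real \<Rightarrow> real" where "high v = (if \<psi> v = 1 then 1 else upper (level v))"

lemma low_meas [measurable]: "low \<in> borel_measurable borel"
  and high_meas [measurable]: "high \<in> borel_measurable borel"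
  unfolding low_def high_def by measurable

lemma low_bounds: "0 \<le> low v" "low v \<le> 1" and high_bounds: "1 \<le> high v" "high v \<le> K"
  using lower_bounds upper_bounds K1 by (auto simp: low_def high_def)

text \<open>An argument with \<psi> v = a < 1 and partner value b moves the fraction (1 - a) / (b -
  a) of its mass to b, that is \<open>loss\<close> divided by the gap; arguments above the mean
  likewise move \<open>gain\<close> divided by the gap to their lower partners. By
  \<open>level_push\<close>, what leaves either side equals what arrives there.\<close>

lemma matching:
  assumes S: "S \<in> sets borel"
  shows "(\<integral>\<^sup>+v. ennreal ((high v - 1) / (high v - low v)) * indicator S (low v)
      + ennreal (1 - (high v - 1) / (high v - low v)) * indicator S (high v) \<partial>uniform01)
    = (\<integral>\<^sup>+v. indicator S (\<psi> v) \<partial>uniform01)"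
proof -
  note [measurable] = S
  let ?w = "\<lambda>v. (high v - 1) / (high v - low v)"
  let ?G = "\<lambda>v. ennreal (?w v) * indicator S (low v) + ennreal (1 - ?w v) * indicator S (high v) :: ennreal"
  let ?d = "\<lambda>\<sigma>. ennreal (1 / (upper \<sigma> - lower \<sigma>))"
  let ?kl = "\<lambda>\<sigma>. ?d \<sigma> * indicator S (lower \<sigma>)" and ?ku = "\<lambda>\<sigma>. ?d \<sigma> * indicator S (upper \<sigma>)"
  let ?L = "\<lambda>k. \<integral>\<^sup>+v. ennreal (loss v) * k (level v) \<partial>lborel"
  let ?P = "\<lambda>k. \<integral>\<^sup>+v. ennreal (gain v) * k (level v) \<partial>lborel"
  let ?I = "indicator {0<..1} :: real \<Rightarrow> ennreal"
  \<comment> \<open>The mass that moves is added on both sides, at its old place on the left and at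
    its new place on the right, so that nothing has to be subtracted in
    \<open>ennreal\<close>.\<close>
  have pt: "?I v * ?G v + (ennreal (loss v) * ?kl (level v) + ennreal (gain v) * ?ku (level v))
      = ?I v * indicator S (\<psi> v) + (ennreal (loss v) * ?ku (level v) + ennreal (gain v) * ?kl (level v))" for v
  proof (cases "v \<in> {0<..1}")
    case True
    then have v: "0 \<le> v" "v \<le> 1" by auto
    let ?a = "lower (level v)" and ?b = "upper (level v)"
    consider "\<psi> v < 1" | "\<psi> v = 1" | "1 < \<psi> v" by linarith
    then show ?thesis
    proof cases
      case 1
      have a: "?a = \<psi> v" by (rule lower_level[OF v 1])
      have ab: "?a < ?b" using upper_bounds(1)[of "level v"] a 1 by linarith
      have lh: "low v = \<psi> v" "high v = ?b" using 1 a by (auto simp: low_def high_def)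
      have g: "gain v = 0" and l: "loss v = 1 - ?a" using True 1 a by (auto simp: gain_def loss_def)
      have w: "?w v = (?b - 1) / (?b - ?a)" and w1: "1 - ?w v = (1 - ?a) * (1 / (?b - ?a))"
        using ab by (auto simp: lh a[symmetric] field_simps)
      have w0: "0 \<le> ?w v" "0 \<le> 1 - ?w v" using ab upper_bounds(1)[of "level v"] lower_bounds(2)[of "level v"] unfolding w1 by (auto simp: w)
      have ld: "ennreal (loss v) * ?d (level v) = ennreal (1 - ?w v)"
        unfolding l w1 using ab 1 a by (subst ennreal_mult[symmetric]) auto
      have "ennreal (?w v) + ennreal (1 - ?w v) = 1" using w0 by (simp flip: ennreal_plus)
      then have "ennreal (?w v) * indicator S (\<psi> v) + ennreal (1 - ?w v) * indicator S (\<psi> v) = (indicator S (\<psi> v) :: ennreal)"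
        by (simp flip: distrib_right)
      then show ?thesis using True
        by (simp add: g mult.assoc[symmetric] ld) (simp add: lh a ac_simps)
    next
      case 2
      then show ?thesis by (simp add: gain_def loss_def low_def high_def)
    next
      case 3
      have b: "?b = \<psi> v" by (rule upper_level[OF v 3])
      have ab: "?a < ?b" using lower_bounds(2)[of "level v"] b 3 by linarith
      have lh: "low v = ?a" "high v = \<psi> v" using 3 b by (auto simp: low_def high_def)
      have g: "gain v = ?b - 1" and l: "loss v = 0" using True 3 b by (auto simp: gain_def loss_def)
      have w: "?w v = (?b - 1) * (1 / (?b - ?a))" and w1: "1 - ?w v = (1 - ?a) / (?b - ?a)"
        using ab by (auto simp: lh b[symmetric] field_simps)
      have w0: "0 \<le> ?w v" "0 \<le> 1 - ?w v" using ab upper_bounds(1)[of "level v"] lower_bounds(2)[of "level v"] unfolding w1 by (auto simp: w)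
      have ld: "ennreal (gain v) * ?d (level v) = ennreal (?w v)"
        unfolding g w using ab 3 b by (subst ennreal_mult[symmetric]) auto
      have "ennreal (?w v) + ennreal (1 - ?w v) = 1" using w0 by (simp flip: ennreal_plus)
      then have "ennreal (?w v) * indicator S (\<psi> v) + ennreal (1 - ?w v) * indicator S (\<psi> v) = (indicator S (\<psi> v) :: ennreal)"
        by (simp flip: distrib_right)
      then show ?thesis using True
        by (simp add: l mult.assoc[symmetric] ld) (simp add: lh b ac_simps)
    qed
  qed (simp add: gain_def loss_def)
  \<comment> \<open>The integrand is at most (1 - a) / (b - a) on the part below the mean, which b
    >= 1 keeps below the generous constant 2. Finiteness is what allows cancellation.\<close>
  have fin: "?L k \<le> ennreal (\<integral>v. 2 * indicator {0<..1::real} v \<partial>lborel)"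
    if k: "\<And>\<sigma>. k \<sigma> \<le> ?d \<sigma>" for k
  proof -
    have le: "ennreal (loss v) * k (level v) \<le> ennreal (2 * indicator {0<..1} v)" for v
    proof (cases "v \<in> {0<..1} \<and> \<psi> v < 1")
      case True
      let ?a = "lower (level v)" and ?b = "upper (level v)"
      have a: "?a = \<psi> v" using True by (intro lower_level) auto
      have ab: "?a < ?b" "1 \<le> ?b" using upper_bounds(1)[of "level v"] a True by linarith+
      have "ennreal (loss v) * k (level v) \<le> ennreal (loss v) * ?d (level v)" by (intro mult_left_mono k) auto
      also have "\<dots> = ennreal ((1 - ?a) / (?b - ?a))"
        using ab True a by (subst ennreal_mult[symmetric]) (auto simp: loss_def)
      also have "\<dots> \<le> ennreal (2 * indicator {0<..1} v)"
        using ab True by (intro ennreal_leI) (simp add: divide_le_eq)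
      finally show ?thesis .
    qed (auto simp: loss_def)
    have "?L k \<le> (\<integral>\<^sup>+v. ennreal (2 * indicator {0<..1::real} v) \<partial>lborel)" by (intro nn_integral_mono le)
    also have "\<dots> = ennreal (\<integral>v. 2 * indicator {0<..1::real} v \<partial>lborel)"
      using integrable_Ioc by (intro nn_integral_eq_integral) auto
    finally show ?thesis .
  qed
  have "?kl \<sigma> \<le> ?d \<sigma>" "?ku \<sigma> \<le> ?d \<sigma>" for \<sigma>
    by (auto split: split_indicator)
  from fin[of ?kl, OF this(1)] fin[of ?ku, OF this(2)]
  have "?L ?kl < \<infinity>" "?L ?ku < \<infinity>" by (auto elim!: le_less_trans)
  then have fin2: "?L ?kl + ?L ?ku \<noteq> \<infinity>" by (simp add: less_top)
  \<comment> \<open>Two finite terms that agree by \<open>level_push\<close> are added on both sides, so that \<open>pt\<close> holds pointwise.\<close>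
  have add3: "(\<integral>\<^sup>+v. f v \<partial>lborel) + ((\<integral>\<^sup>+v. g v \<partial>lborel) + (\<integral>\<^sup>+v. h v \<partial>lborel)) = (\<integral>\<^sup>+v. f v + (g v + h v) \<partial>lborel)"
    if "f \<in> borel_measurable borel" "g \<in> borel_measurable borel" "h \<in> borel_measurable borel" for f g h :: "real \<Rightarrow> ennreal"
    using that by (simp add: nn_integral_add)
  have cancel: "p = q" if "p + (s + t) = q + (t + s)" "s + t \<noteq> \<infinity>" for p q s t :: ennreal
    using that by (metis add.commute ennreal_add_left_cancel)
  have "(\<integral>\<^sup>+v. ?I v * ?G v \<partial>lborel) + (?L ?kl + ?P ?ku) = (\<integral>\<^sup>+v. ?I v * ?G v + (ennreal (loss v) * ?kl (level v) + ennreal (gain v) * ?ku (level v)) \<partial>lborel)"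
    by (rule add3) measurable
  also have "\<dots> = (\<integral>\<^sup>+v. ?I v * indicator S (\<psi> v) + (ennreal (loss v) * ?ku (level v) + ennreal (gain v) * ?kl (level v)) \<partial>lborel)"
    by (simp only: pt)
  also have "\<dots> = (\<integral>\<^sup>+v. ?I v * indicator S (\<psi> v) \<partial>lborel) + (?L ?ku + ?P ?kl)"
    by (rule add3[symmetric]) measurable
  finally have "(\<integral>\<^sup>+v. ?I v * ?G v \<partial>lborel) + (?L ?kl + ?P ?ku) = (\<integral>\<^sup>+v. ?I v * indicator S (\<psi> v) \<partial>lborel) + (?L ?ku + ?P ?kl)" .
  moreover have "?P ?ku = ?L ?ku" by (rule level_push[symmetric]) measurable
  moreover have "?P ?kl = ?L ?kl" by (rule level_push[symmetric]) measurable
  ultimately have "(\<integral>\<^sup>+v. ?I v * ?G v \<partial>lborel) + (?L ?kl + ?L ?ku) = (\<integral>\<^sup>+v. ?I v * indicator S (\<psi> v) \<partial>lborel) + (?L ?ku + ?L ?kl)"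
    by (simp only:)
  then have "(\<integral>\<^sup>+v. ?I v * ?G v \<partial>lborel) = (\<integral>\<^sup>+v. ?I v * indicator S (\<psi> v) \<partial>lborel)"
    using fin2 by (rule cancel)
  moreover have "(\<integral>\<^sup>+v. f v \<partial>uniform01) = (\<integral>\<^sup>+v. ?I v * f v \<partial>lborel)" if "f \<in> borel_measurable borel" for f
    unfolding nn_integral_uniform01[OF that]
    by (rule nn_integral_cong_AE, rule AE_mp[OF AE_lborel_singleton[of "0::real"]]) (auto intro!: AE_I2 simp: indicator_def)
  ultimately show ?thesis by simp
qed

end

section \<open>Quantile functions and rewards\<close>

lemma measure_uniform01_Iic: "0 \<le> y \<Longrightarrow> y \<le> 1 \<Longrightarrow> measure uniform01 {..y} = y"
proof -
  assume y: "0 \<le> y" "y \<le> 1"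
  then have "{0..1} \<inter> {..y} = {0..y}" by auto
  then show ?thesis using y by (subst measure_uniform_measure) auto
qed

lemma measure_uniform01_Iio: "0 \<le> y \<Longrightarrow> y \<le> 1 \<Longrightarrow> measure uniform01 {..<y} = y"
proof -
  assume y: "0 \<le> y" "y \<le> 1"
  then have "{0..1} \<inter> {..<y} = {0..<y}" by auto
  then show ?thesis using y by (subst measure_uniform_measure) auto
qed

lemma AE_interior_uniform01: "AE u in uniform01. 0 < u \<and> u < 1"
proof -
  have "AE u in lborel. u \<noteq> (0::real)" "AE u in lborel. u \<noteq> (1::real)" by (rule AE_lborel_singleton)+
  then have "AE u in lborel. u \<in> {0..1::real} \<longrightarrow> 0 < u \<and> u < 1" by eventually_elim auto
  then show ?thesis by (subst AE_uniform_measure) auto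
qed

text \<open>A null set contains no interval. In \<open>equilibrium_unique\<close> this supplies good
  points arbitrarily near 0 and near 1.\<close>

lemma AE_uniform01_dense:
  assumes "AE u in uniform01. P u" "0 \<le> a" "a < b" "b \<le> 1"
  obtains u where "a < u" "u < b" "P u"
proof -
  have "AE u in lborel. u \<in> {0..1} \<longrightarrow> P u"
    using assms(1) by (subst (asm) AE_uniform_measure) auto
  then obtain N where N: "N \<in> null_sets lborel" "{u. \<not> (u \<in> {0..1} \<longrightarrow> P u)} \<subseteq> N"
    by (auto simp: eventually_ae_filter)
  have "\<not> {a<..<b} \<subseteq> N"
  proof
    assume "{a<..<b} \<subseteq> N"
    then have "emeasure lborel {a<..<b} \<le> emeasure lborel N" using N(1) by (intro emeasure_mono) auto
    then show False using N(1) assms(3) by (simp add: null_sets_def)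
  qed
  then obtain u where "u \<in> {a<..<b}" "u \<notin> N" by blast
  then have "u \<in> {0..1} \<longrightarrow> P u" using N(2) by blast
  then show ?thesis using \<open>u \<in> {a<..<b}\<close> assms(2,4) that[of u] by simp
qed

text \<open>The infimum formula represents \<open>F\<close> over Lebesgue measure on the open unit
  interval; setting \<open>J\<close> to 0 elsewhere changes a null set only.\<close>

lemma quantile_representation:
  assumes "real_distribution F"
  obtains J where "J \<in> borel_measurable borel" "distr uniform01 borel J = F" "mono_on {0<..<1} J"
    "\<And>u x. 0 < u \<Longrightarrow> u < 1 \<Longrightarrow> u \<le> cdf F x \<longleftrightarrow> J u \<le> x"
proof -
  interpret F: real_distribution F by fact
  interpret C: cdf_distribution F by unfold_locales
  let ?I = "\<lambda>u. Inf {x. u \<le> cdf F x}"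
  define J where "J u = (if u \<in> {0<..<1} then ?I u else 0)" for u
  have J[measurable]: "J \<in> borel_measurable borel"
  proof -
    have "(\<lambda>u. indicator {0<..<1} u *\<^sub>R ?I u) \<in> borel_measurable borel"
      using C.measurable_CI by (subst (asm) borel_measurable_restrict_space_iff) auto
    moreover have "(\<lambda>u. indicator {0<..<1} u *\<^sub>R ?I u) = J" by (auto simp: J_def indicator_def)
    ultimately show ?thesis by simp
  qed
  have "distr uniform01 borel J = F"
  proof (rule measure_eqI)
    fix A assume "A \<in> sets (distr uniform01 borel J)"
    then have A[measurable]: "A \<in> sets borel" by simp
    have "emeasure F A = emeasure (distr (restrict_space lborel {0<..<1}) borel ?I) A"
      by (simp only: C.distr_I_eq_M)
    also have "\<dots> = (\<integral>\<^sup>+u. indicator A (?I u) \<partial>restrict_space lborel {0<..<1})"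
      by (subst nn_integral_indicator[symmetric], simp, subst nn_integral_distr) auto
    also have "\<dots> = (\<integral>\<^sup>+u. indicator A (?I u) * indicator {0<..<1} u \<partial>lborel)"
      by (subst nn_integral_restrict_space) auto
    also have "\<dots> = (\<integral>\<^sup>+u. indicator {0<..<1} u * indicator A (J u) \<partial>lborel)"
      by (intro nn_integral_cong) (auto simp: J_def indicator_def)
    also have "\<dots> = (\<integral>\<^sup>+u. indicator {0..1} u * indicator A (J u) \<partial>lborel)"
    proof (rule nn_integral_cong_AE)
      have "AE u in lborel. u \<noteq> (0::real)" "AE u in lborel. u \<noteq> (1::real)" by (rule AE_lborel_singleton)+
      then show "AE u in lborel. indicator {0<..<1} u * indicator A (J u) = (indicator {0..1} u * indicator A (J u) :: ennreal)"
        by eventually_elim (auto simp: indicator_def)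
    qed
    also have "\<dots> = (\<integral>\<^sup>+u. indicator A (J u) \<partial>uniform01)" by (subst nn_integral_uniform01) auto
    also have "\<dots> = emeasure (distr uniform01 borel J) A"
      by (subst nn_integral_indicator[symmetric, of A], simp, subst nn_integral_distr) auto
    finally show "emeasure (distr uniform01 borel J) A = emeasure F A" by simp
  qed simp
  moreover have "mono_on {0<..<1} J"
    using C.mono_I by (auto simp: J_def mono_on_def)
  moreover have "u \<le> cdf F x \<longleftrightarrow> J u \<le> x" if "0 < u" "u < 1" for u x
    using C.pseudoinverse[OF that, of x] that by (simp add: J_def)
  ultimately show ?thesis using that J by blast
qed

lemma (in real_distribution) cdf_left_bounds:
  "0 \<le> cdf_left M x" "cdf_left M x \<le> cdf M x" "cdf M x \<le> 1" "x < y \<Longrightarrow> cdf M x \<le> cdf_left M y"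
  "cdf M x - cdf_left M x = measure M {x}"
proof -
  show "0 \<le> cdf_left M x" "cdf_left M x \<le> cdf M x" "cdf M x \<le> 1"
    by (auto simp: cdf_left_def cdf_def intro!: finite_measure_mono)
  show "x < y \<Longrightarrow> cdf M x \<le> cdf_left M y"
    by (auto simp: cdf_left_def cdf_def intro!: finite_measure_mono)
  have "measure M {..x} = measure M ({..<x} \<union> {x})" by (rule arg_cong[where f="measure M"]) auto
  also have "\<dots> = measure M {..<x} + measure M {x}" by (rule finite_measure_Union) auto
  finally show "cdf M x - cdf_left M x = measure M {x}" by (simp add: cdf_left_def cdf_def)
qed

lemma (in real_distribution) cdf_left_le:
  assumes "\<And>y. y < x \<Longrightarrow> cdf M y \<le> u"
  shows "cdf_left M x \<le> u"
  unfolding cdf_left_def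
proof (rule tendsto_upperbound[OF cdf_at_left])
  show "\<forall>\<^sub>F y in at_left x. cdf M y \<le> u"
    unfolding eventually_at_left_field by (intro exI[of _ "x - 1"]) (auto intro: assms)
qed simp

section \<open>Reward functions and their averages over jumps\<close>

locale reward =
  fixes R :: "real \<Rightarrow> real"
  assumes R: "reward_function R"
begin

text \<open>Reflected reward, constant outside [0,1]: monotone on all reals, which gives Borel
  measurability directly.\<close>

definition g :: "real \<Rightarrow> real" where "g y = R (1 - max 0 (min 1 y))"

abbreviation "R0 \<equiv> R 0"
abbreviation "R1 \<equiv> R 1"
definition "Rbar = integral {0..1} R"

lemma g_eq: "0 \<le> y \<Longrightarrow> y \<le> 1 \<Longrightarrow> g y = R (1 - y)"
  by (simp add: g_def)

lemma g_0 [simp]: "g 0 = R1" and g_1 [simp]: "g 1 = R0"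
  by (simp_all add: g_def)

lemma R_decreasing: "0 \<le> a \<Longrightarrow> a \<le> b \<Longrightarrow> b \<le> 1 \<Longrightarrow> R b \<le> R a"
  using R unfolding reward_function_def monotone_on_def by auto

lemma g_mono: "mono g"
  unfolding g_def by (intro monoI R_decreasing) auto

lemma g_bounds: "R1 \<le> g y" "g y \<le> R0"
  using monoD[OF g_mono, of 0 "max 0 (min 1 y)"] monoD[OF g_mono, of "max 0 (min 1 y)" 1] by (auto simp: g_def)

lemma R1_nonneg: "0 \<le> R1" and R1_less_R0: "R1 < R0"
  using R by (auto simp: reward_function_def)

lemma g_nonneg: "0 \<le> g y"
  using g_bounds(1)[of y] R1_nonneg by simp

lemma g_meas [measurable]: "g \<in> borel_measurable borel"
  using g_mono by (rule borel_measurable_mono)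

text \<open>Right continuity of R is left continuity of g. The form with an upper bound fits its
  use, where bounds are known strictly below a cdf value.\<close>

lemma g_left_continuous:
  assumes "0 < q" "q \<le> 1" "\<And>y. 0 < y \<Longrightarrow> y < q \<Longrightarrow> g y \<le> c"
  shows "g q \<le> c"
proof -
  let ?r = "1 - q"
  have lim: "(R \<longlongrightarrow> R ?r) (at_right ?r)"
    using R assms by (auto simp: reward_function_def continuous_within)
  have "\<forall>\<^sub>F r in at_right ?r. R r \<le> c"
    unfolding eventually_at_right_field
  proof (intro exI[of _ 1] conjI allI impI)
    fix r assume "?r < r" "r < 1"
    then show "R r \<le> c" using assms(3)[of "1 - r"] assms by (simp add: g_eq)
  qed (use assms in simp)
  then have "R ?r \<le> c" using lim by (intro tendsto_upperbound) auto
  then show ?thesis using assms by (simp add: g_eq)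
qed

lemma g_near_0:
  assumes "R1 < c"
  obtains d where "0 < d" "d < 1" "\<And>u. u < d \<Longrightarrow> g u < c"
proof -
  have "(R \<longlongrightarrow> R 1) (at_left 1)" using R by (auto simp: reward_function_def)
  then have "\<forall>\<^sub>F r in at_left 1. R r < c" using assms by (rule order_tendstoD)
  then obtain b where b: "b < 1" "\<And>r. b < r \<Longrightarrow> r < 1 \<Longrightarrow> R r < c" by (auto simp: eventually_at_left_field)
  define r where "r = (max b 0 + 1) / 2"
  have r: "b < r" "0 < r" "r < 1" using b(1) by (auto simp: r_def max_def field_simps)
  have "g u < c" if "u < 1 - r" for u
  proof -
    have "g u \<le> g (1 - r)" using that by (intro monoD[OF g_mono]) auto
    also have "\<dots> < c" using r b(2)[of r] by (simp add: g_eq)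
    finally show ?thesis .
  qed
  then show ?thesis using that[of "1 - r"] r by auto
qed

lemma g_near_1:
  assumes "c < R0"
  obtains d where "0 < d" "d < 1" "\<And>u. d < u \<Longrightarrow> c < g u"
proof -
  have "\<not> (\<forall>y. 0 < y \<longrightarrow> y < 1 \<longrightarrow> g y \<le> c)" using g_left_continuous[of 1 c] assms by auto
  then obtain d where d: "0 < d" "d < 1" "c < g d" by (auto simp: not_le)
  then show ?thesis using that[of d] monoD[OF g_mono, of d] by (metis less_eq_real_def less_le_trans)
qed

lemma g_integrable: "g integrable_on {a..b}"
  using g_mono by (intro integrable_on_mono_on) (auto simp: mono_on_def mono_def)

lemma integral_g_eq: "0 \<le> p \<Longrightarrow> q \<le> 1 \<Longrightarrow> integral {p..q} (\<lambda>y. R (1 - y)) = integral {p..q} g"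
  by (intro Henstock_Kurzweil_Integration.integral_cong) (simp add: g_eq)

lemma g_integrable_uniform01: "integrable uniform01 g"
proof -
  interpret U: prob_space uniform01 by (rule prob_space_uniform01)
  show ?thesis using g_nonneg g_bounds(2) by (intro U.integrable_const_bound[where B=R0]) auto
qed

lemma Rbar_eq: "(\<integral>u. g u \<partial>uniform01) = Rbar"
proof -
  have "integrable lborel (\<lambda>u. indicator {0..1} u *\<^sub>R g u)"
  proof (rule Bochner_Integration.integrable_bound)
    show "integrable lborel (\<lambda>u. indicator {0..1::real} u * R0)" by simp
    show "AE u in lborel. norm (indicator {0..1} u *\<^sub>R g u) \<le> norm (indicator {0..1} u * R0)"
      using g_nonneg g_bounds(2) by (intro AE_I2) (auto split: split_indicator simp: abs_of_nonneg intro: order_trans[OF _ abs_ge_self])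
  qed measurable
  then have "(LINT u:{0..1}|lborel. g u) = integral {0..1} g"
    by (intro set_borel_integral_eq_integral) (simp add: set_integrable_def)
  also have "\<dots> = Rbar"
  proof -
    have "(\<lambda>x::real. 1 - x) ` {0..1} = {0..1}"
      by (auto intro!: image_eqI[of x "\<lambda>x. 1 - x" "1 - x" for x])
    then have "((\<lambda>x. g (1 - x)) has_integral integral {0..1} g) {0..1}"
      using has_integral_affinity[of g "integral {0..1} g" 0 1 "-1" 1] g_integrable[of 0 1]
      by (simp add: has_integral_integral[symmetric] add.commute)
    then have "integral {0..1} (\<lambda>x. g (1 - x)) = integral {0..1} g" by (rule integral_unique)
    then show ?thesis unfolding Rbar_def
      by (subst (asm) Henstock_Kurzweil_Integration.integral_cong[where g=R]) (auto simp: g_eq)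
  qed
  finally show ?thesis by (simp add: integral_uniform01 set_lebesgue_integral_def)
qed

text \<open>g lies below the midpoint of R1 and R0 on an initial piece of length d and above it on a
  final piece of length 1 - e, which makes both inequalities strict.\<close>

lemma R1_less_Rbar: "R1 < Rbar" and Rbar_less_R0: "Rbar < R0"
proof -
  interpret U: prob_space uniform01 by (rule prob_space_uniform01)
  let ?m = "(R1 + R0) / 2"
  have m: "R1 < ?m" "?m < R0" using R1_less_R0 by auto
  obtain d where d: "0 < d" "d < 1" "\<And>u. u < d \<Longrightarrow> g u < ?m" using g_near_0[OF m(1)] by blast
  obtain e where e: "0 < e" "e < 1" "\<And>u. e < u \<Longrightarrow> ?m < g u" using g_near_1[OF m(2)] by blast
  have i: "integrable uniform01 (\<lambda>u. indicator A u :: real)" if "A \<in> sets borel" for A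
    using that by (intro U.integrable_const_bound[where B=1]) (auto simp: indicator_def)
  have pu: "measure uniform01 UNIV = 1" using U.prob_space by (simp del: measure_uniform_measure)
  have "Rbar \<le> (\<integral>u. R0 - (R0 - ?m) * indicator {..<d} u \<partial>uniform01)"
    unfolding Rbar_eq[symmetric]
  proof (rule integral_mono)
    fix u show "g u \<le> R0 - (R0 - ?m) * indicator {..<d} u"
      using d(3)[of u] g_bounds(2)[of u] by (auto split: split_indicator simp: less_imp_le)
  qed (use i g_integrable_uniform01 in auto)
  also have "\<dots> = R0 - (R0 - ?m) * d" using i d by (simp add: pu measure_uniform01_Iio del: measure_uniform_measure)
  also have "\<dots> < R0" using d m by simp
  finally show "Rbar < R0" .
  have "R1 < R1 + (?m - R1) * (1 - e)" using e m by simp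
  also have "\<dots> = (\<integral>u. R1 + (?m - R1) * (1 - indicator {..e} u) \<partial>uniform01)"
    using i e by (simp add: pu measure_uniform01_Iic del: measure_uniform_measure)
  also have "\<dots> \<le> Rbar"
    unfolding Rbar_eq[symmetric]
  proof (rule integral_mono)
    fix u show "R1 + (?m - R1) * (1 - indicator {..e} u) \<le> g u"
      using e(3)[of u] g_bounds(1)[of u] by (auto split: split_indicator simp: field_simps)
  qed (use i g_integrable_uniform01 in auto)
  finally show "R1 < Rbar" .
qed

definition avg :: "real \<Rightarrow> real \<Rightarrow> real" where
  "avg p q = (if q = p then g q else integral {p..q} g / (q - p))"

lemma payoff_eq:
  assumes "real_distribution F"
  shows "mean_field_payoff R F x = avg (cdf_left F x) (cdf F x)"
proof -
  interpret real_distribution F by fact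
  show ?thesis using cdf_left_bounds[of x] cdf_nonneg[of x]
    by (simp add: mean_field_payoff_def avg_def g_eq integral_g_eq)
qed

text \<open>Endpoints do not affect a mean, so bounds on the open interval suffice; an endpoint
  value matters just for p = q.\<close>

lemma avg_le:
  assumes "p \<le> q" "\<And>y. p < y \<Longrightarrow> y < q \<Longrightarrow> g y \<le> c" "p = q \<Longrightarrow> g q \<le> c"
  shows "avg p q \<le> c"
proof (cases "p = q")
  case False
  then have "p < q" using assms by simp
  have "integral {p..q} g = integral {p<..<q} g" by (simp add: integral_open_interval_real)
  also have "\<dots> \<le> integral {p<..<q} (\<lambda>_. c)"
    using assms g_integrable[of p q] by (intro integral_le) (auto simp: integrable_on_open_interval_real)
  also have "\<dots> = c * (q - p)" using \<open>p < q\<close> by (simp add: integral_open_interval_real[symmetric])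
  finally show ?thesis using \<open>p < q\<close> by (simp add: avg_def divide_le_eq)
qed (use assms in \<open>simp add: avg_def\<close>)

lemma avg_ge:
  assumes "p \<le> q" "\<And>y. p < y \<Longrightarrow> y < q \<Longrightarrow> c \<le> g y" "p = q \<Longrightarrow> c \<le> g q"
  shows "c \<le> avg p q"
proof (cases "p = q")
  case False
  then have "p < q" using assms by simp
  have "c * (q - p) = integral {p<..<q} (\<lambda>_. c)" using \<open>p < q\<close> by (simp add: integral_open_interval_real[symmetric])
  also have "\<dots> \<le> integral {p<..<q} g"
    using assms g_integrable[of p q] by (intro integral_le) (auto simp: integrable_on_open_interval_real)
  also have "\<dots> = integral {p..q} g" by (simp add: integral_open_interval_real)
  finally show ?thesis using \<open>p < q\<close> by (simp add: avg_def le_divide_eq)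
qed (use assms in \<open>simp add: avg_def\<close>)

lemma avg_bounds: assumes "p \<le> q" shows "g p \<le> avg p q" "avg p q \<le> g q"
  using assms monoD[OF g_mono] by (auto intro!: avg_le avg_ge simp: less_imp_le)

text \<open>Splitting at \<open>y\<close> bounds the mean over the left part by g y, so a value
  below g q would pull the whole mean down. The left end is excluded since g may jump immediately
  after it.\<close>

lemma avg_eq_right:
  assumes "p < q" "avg p q = g q" "p < y" "y \<le> q"
  shows "g y = g q"
proof (rule antisym)
  show "g y \<le> g q" using assms by (intro monoD[OF g_mono])
  show "g q \<le> g y"
  proof (cases "y = q")
    case False
    then have y: "y < q" using assms by simp
    have "integral {p..q} g = integral {p..y} g + integral {y..q} g"
      using assms g_integrable by (intro Henstock_Kurzweil_Integration.integral_combine[symmetric]) auto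
    moreover have "avg p y \<le> g y" "avg y q \<le> g q" using avg_bounds assms y by auto
    then have "integral {p..y} g \<le> g y * (y - p)" "integral {y..q} g \<le> g q * (q - y)"
      using assms y by (auto simp: avg_def divide_le_eq)
    moreover have "integral {p..q} g = g q * (q - p)" using assms by (auto simp: avg_def field_simps)
    ultimately have "g q * (q - p) \<le> g y * (y - p) + g q * (q - y)" by linarith
    then have "g q * (y - p) \<le> g y * (y - p)" by (simp add: algebra_simps)
    then show ?thesis using assms by simp
  qed simp
qed

lemma payoff_mono:
  assumes F: "real_distribution F"
  shows "mono (mean_field_payoff R F)"
proof (rule monoI)
  interpret real_distribution F by fact
  fix x y :: real assume "x \<le> y"
  show "mean_field_payoff R F x \<le> mean_field_payoff R F y"
  proof (cases "x = y")
    case False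
    then have "x < y" using \<open>x \<le> y\<close> by simp
    have "avg (cdf_left F x) (cdf F x) \<le> g (cdf F x)" using cdf_left_bounds by (intro avg_bounds)
    also have "\<dots> \<le> g (cdf_left F y)" using cdf_left_bounds \<open>x < y\<close> by (intro monoD[OF g_mono])
    also have "\<dots> \<le> avg (cdf_left F y) (cdf F y)" using cdf_left_bounds by (intro avg_bounds)
    finally show ?thesis by (simp add: payoff_eq[OF F])
  qed simp
qed

lemma payoff_bounds:
  assumes F: "real_distribution F"
  shows "R1 \<le> mean_field_payoff R F x" "mean_field_payoff R F x \<le> R0" "0 \<le> mean_field_payoff R F x"
proof -
  interpret real_distribution F by fact
  show "R1 \<le> mean_field_payoff R F x" "mean_field_payoff R F x \<le> R0"
    using avg_bounds[OF cdf_left_bounds(2)[of x]] g_bounds by (auto simp: payoff_eq[OF F] intro: order_trans)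
  then show "0 \<le> mean_field_payoff R F x" using R1_nonneg by simp
qed

lemma payoff_meas: "real_distribution F \<Longrightarrow> mean_field_payoff R F \<in> borel_measurable borel"
  by (rule borel_measurable_mono[OF payoff_mono])

lemma payoff_integrable:
  assumes "real_distribution F" "real_distribution G"
  shows "integrable G (mean_field_payoff R F)"
proof -
  interpret G: real_distribution G by fact
  show ?thesis
    using payoff_bounds[OF assms(1)] payoff_meas[OF assms(1)] by (intro G.integrable_const_bound[where B=R0]) auto
qed

end

section \<open>Equilibria of games with a reward function\<close>

text \<open>What the games need to know about attainable laws. The same \<open>L\<close> serves the
  limit game and all finite games; only the reward function changes. In \<open>L_embed\<close> the
  bound by \<open>h B\<close> keeps \<psi> inside the range of \<open>h\<close>, where its inverse
  is meaningful.\<close>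

locale stopping_problem =
  fixes h :: "real \<Rightarrow> real" and L :: "real \<Rightarrow> real measure set" and x0 :: real
  assumes x0: "0 < x0" and h_strict_mono: "strict_mono h" and h_cont: "continuous_on UNIV h"
    and h_0: "h 0 = 0" and h_x0: "h x0 = 1"
    and L_distribution: "\<And>x G. 0 \<le> x \<Longrightarrow> G \<in> L x \<Longrightarrow> real_distribution G"
    and L_nonneg: "\<And>x G. 0 \<le> x \<Longrightarrow> G \<in> L x \<Longrightarrow> AE y in G. 0 \<le> y"
    and L_le: "\<And>x G. 0 \<le> x \<Longrightarrow> G \<in> L x \<Longrightarrow> (\<integral>\<^sup>+y. ennreal (h y) \<partial>G) \<le> ennreal (h x)"
    \<comment> \<open>the cases \<open>\<mu> > 0\<close> and \<open>\<mu> \<le> 0\<close>\<close>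
    and L_alt: "(\<forall>G\<in>L x0. (\<integral>\<^sup>+y. ennreal (h y) \<partial>G) = 1) \<or> (\<forall>a. 0 \<le> a \<longrightarrow> a \<le> x0 \<longrightarrow> return borel a \<in> L x0)"
    and L_two_point: "\<And>x a b. 0 \<le> a \<Longrightarrow> a \<le> x \<Longrightarrow> x \<le> b \<Longrightarrow> \<exists>G\<in>L x. \<forall>f\<in>borel_measurable borel. (\<forall>y. 0 \<le> f y) \<longrightarrow>
      (\<integral>y. f y \<partial>G) = (h b - h x) / (h b - h a) * f a + (1 - (h b - h x) / (h b - h a)) * (f b :: real)"
    and L_embed: "\<And>\<psi> B. mono \<psi> \<Longrightarrow> (\<And>v. 0 \<le> \<psi> v) \<Longrightarrow> (\<And>v. \<psi> v \<le> h B) \<Longrightarrow> (\<integral>v. \<psi> v \<partial>uniform01) = 1 \<Longrightarrow>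
      distr uniform01 borel (\<lambda>v. inv h (\<psi> v)) \<in> L x0"
begin

lemma h_le_iff [simp]: "h x \<le> h y \<longleftrightarrow> x \<le> y" and h_less_iff [simp]: "h x < h y \<longleftrightarrow> x < y"
  using h_strict_mono by (auto simp: strict_mono_less_eq strict_mono_less)

lemma h_inj: "inj h" using h_strict_mono by (rule strict_mono_imp_inj_on)

lemma inv_h [simp]: "inv h (h x) = x" using h_inj by (rule inv_f_f)

lemma h_inv: "0 \<le> y \<Longrightarrow> y \<le> h B \<Longrightarrow> h (inv h y) = y"
proof -
  assume y: "0 \<le> y" "y \<le> h B"
  then have "h 0 \<le> h B" using h_0 by linarith
  then have "0 \<le> B" by simp
  moreover have "continuous_on {0..B} h" using h_cont by (rule continuous_on_subset) simp
  ultimately obtain z where "h z = y" using IVT'[of h 0 y B] y h_0 by auto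
  then show ?thesis by auto
qed

lemma h_meas [measurable]: "h \<in> borel_measurable borel"
  using h_strict_mono by (intro borel_measurable_mono strict_mono_mono)

lemma h_nonneg: "0 \<le> x \<Longrightarrow> 0 \<le> h x"
  using h_le_iff[of 0 x] h_0 by (simp del: h_le_iff)

lemma L_integrable:
  assumes "0 \<le> x" "G \<in> L x"
  shows "integrable G h" "(\<integral>y. h y \<partial>G) \<le> h x"
    "(\<integral>\<^sup>+y. ennreal (h y) \<partial>G) = 1 \<Longrightarrow> (\<integral>y. h y \<partial>G) = 1"
proof -
  interpret G: real_distribution G using L_distribution[OF assms] .
  have ae: "AE y in G. 0 \<le> h y" using L_nonneg[OF assms] by eventually_elim (rule h_nonneg)
  show i: "integrable G h"
    using ae order.strict_trans1[OF L_le[OF assms], of "\<infinity>"]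
    by (intro integrableI_nonneg) auto
  note eq = nn_integral_eq_integral[OF i ae]
  show "(\<integral>y. h y \<partial>G) \<le> h x" using L_le[OF assms] h_nonneg[OF assms(1)] by (simp add: eq)
  show "(\<integral>\<^sup>+y. ennreal (h y) \<partial>G) = 1 \<Longrightarrow> (\<integral>y. h y \<partial>G) = 1" by (simp add: eq ennreal_eq_1)
qed

end

text \<open>\<open>cap\<close> says that the line R1 + (Rbar - R1) h reaches the best reward R0 at a
  finite level, so that the candidate law fits into the range of \<open>h\<close>.\<close>

locale stopping_game = stopping_problem + reward +
  assumes cap: "\<exists>B. h B = (R0 - R1) / (Rbar - R1)"
begin

text \<open>The solution for h of g u = R1 + (Rbar - R1) h: the level at quantile u is where the
  value line equals the reward for u.\<close>

definition \<psi> :: "real \<Rightarrow> real" where "\<psi> u = (g u - R1) / (Rbar - R1)"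

definition eq_law :: "real measure" where "eq_law = distr uniform01 borel (\<lambda>u. inv h (\<psi> u))"

definition line :: "real \<Rightarrow> real" where "line x = R1 + (Rbar - R1) * h x"

abbreviation quant :: "real \<Rightarrow> real" where "quant u \<equiv> inv h (\<psi> u)"

section \<open>Verification of the candidate law\<close>

lemma \<psi>_mono: "mono \<psi>"
  using monoD[OF g_mono] R1_less_Rbar by (intro monoI) (auto simp: \<psi>_def divide_right_mono)

lemma \<psi>_nonneg: "0 \<le> \<psi> u"
  using g_bounds(1)[of u] R1_less_Rbar by (simp add: \<psi>_def)

lemma \<psi>_le_cap: "h B = (R0 - R1) / (Rbar - R1) \<Longrightarrow> \<psi> u \<le> h B"
  using g_bounds(2)[of u] R1_less_Rbar by (simp add: \<psi>_def divide_right_mono)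

lemma h_quant: "h (quant u) = \<psi> u"
  using cap \<psi>_le_cap \<psi>_nonneg h_inv by metis

lemma quant_mono: "mono quant"
proof (rule monoI)
  fix u v :: real assume "u \<le> v"
  then have "h (quant u) \<le> h (quant v)" using monoD[OF \<psi>_mono] by (simp only: h_quant)
  then show "quant u \<le> quant v" by simp
qed

lemma quant_meas [measurable]: "quant \<in> borel_measurable borel"
  using quant_mono by (rule borel_measurable_mono)

text \<open>A Galois connection: questions about the cdf become comparisons of rewards with the
  line, without a generalized inverse of g.\<close>

lemma quant_le_iff: "quant u \<le> x \<longleftrightarrow> g u \<le> line x"
proof -
  have "quant u \<le> x \<longleftrightarrow> \<psi> u \<le> h x" using h_le_iff[of "quant u" x] unfolding h_quant by (rule sym)
  then show ?thesis using R1_less_Rbar by (simp add: \<psi>_def line_def divide_le_eq algebra_simps)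
qed

lemma quant_less_iff: "quant u < x \<longleftrightarrow> g u < line x"
proof -
  have "quant u < x \<longleftrightarrow> \<psi> u < h x" using h_less_iff[of "quant u" x] unfolding h_quant by (rule sym)
  then show ?thesis using R1_less_Rbar by (simp add: \<psi>_def line_def divide_less_eq algebra_simps)
qed

lemma line_quant: "line (quant u) = g u"
  using R1_less_Rbar unfolding line_def h_quant by (simp add: \<psi>_def)

lemma \<psi>_mean: "(\<integral>u. \<psi> u \<partial>uniform01) = 1"
proof -
  interpret U: prob_space uniform01 by (rule prob_space_uniform01)
  have "(\<integral>u. \<psi> u \<partial>uniform01) = ((\<integral>u. g u \<partial>uniform01) - (\<integral>u. R1 \<partial>uniform01)) / (Rbar - R1)"
    unfolding \<psi>_def using g_integrable_uniform01 by simp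
  also have "\<dots> = (Rbar - R1) / (Rbar - R1)"
    using U.prob_space by (simp add: Rbar_eq del: measure_uniform_measure)
  finally show ?thesis using R1_less_Rbar by simp
qed

lemma eq_law_attainable: "eq_law \<in> L x0"
proof -
  obtain B where "h B = (R0 - R1) / (Rbar - R1)" using cap by blast
  then show ?thesis unfolding eq_law_def
    by (intro L_embed[of \<psi> B] \<psi>_mono \<psi>_nonneg \<psi>_le_cap \<psi>_mean)
qed

lemma eq_law_distribution: "real_distribution eq_law"
  using L_distribution[OF _ eq_law_attainable] x0 by simp

lemma cdf_eq_law: "cdf eq_law x = measure uniform01 {u. quant u \<le> x}"
  and cdf_left_eq_law: "cdf_left eq_law x = measure uniform01 {u. quant u < x}"
  unfolding cdf_def cdf_left_def eq_law_def
  by (subst measure_distr; auto intro!: arg_cong[where f="measure uniform01"] simp del: measure_uniform_measure)+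

text \<open>If g y exceeded the line at x, every u >= y would have its quantile above x, and the cdf
  at x would be at most y.\<close>

lemma below_cdf: assumes "0 \<le> y" "y < cdf eq_law x" shows "g y \<le> line x"
proof (rule ccontr)
  assume "\<not> g y \<le> line x"
  interpret U: prob_space uniform01 by (rule prob_space_uniform01)
  interpret real_distribution eq_law by (rule eq_law_distribution)
  have y1: "y < 1" using assms cdf_bounded_prob[of x] by simp
  have "{u. quant u \<le> x} \<subseteq> {..<y}"
  proof
    fix u assume "u \<in> {u. quant u \<le> x}"
    then have "g u < g y" using \<open>\<not> g y \<le> line x\<close> by (simp add: quant_le_iff)
    then have "\<not> y \<le> u" using monoD[OF g_mono, of y u] by (meson leD)
    then show "u \<in> {..<y}" by simp
  qed
  then have "cdf eq_law x \<le> measure uniform01 {..<y}"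
    unfolding cdf_eq_law by (intro U.finite_measure_mono) auto
  then show False using assms y1 by (simp add: measure_uniform01_Iio del: measure_uniform_measure)
qed

lemma above_cdf_left: assumes "y \<le> 1" "cdf_left eq_law x < y" shows "line x \<le> g y"
proof (rule ccontr)
  assume "\<not> line x \<le> g y"
  interpret U: prob_space uniform01 by (rule prob_space_uniform01)
  interpret real_distribution eq_law by (rule eq_law_distribution)
  have y0: "0 \<le> y" using assms cdf_left_bounds(1)[of x] by simp
  have "{..y} \<subseteq> {u. quant u < x}"
  proof
    fix u assume "u \<in> {..y}"
    then have "g u \<le> g y" by (intro monoD[OF g_mono]) simp
    then show "u \<in> {u. quant u < x}" using \<open>\<not> line x \<le> g y\<close> by (simp add: quant_less_iff)
  qed
  then have "measure uniform01 {..y} \<le> cdf_left eq_law x"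
    unfolding cdf_left_eq_law by (intro U.finite_measure_mono) auto
  then show False using assms y0 by (simp add: measure_uniform01_Iic del: measure_uniform_measure)
qed

lemma cdf_quant: "0 \<le> u \<Longrightarrow> u \<le> 1 \<Longrightarrow> u \<le> cdf eq_law (quant u)"
proof -
  assume u: "0 \<le> u" "u \<le> 1"
  interpret U: prob_space uniform01 by (rule prob_space_uniform01)
  have "{..u} \<subseteq> {v. quant v \<le> quant u}" using monoD[OF quant_mono] by auto
  then have "measure uniform01 {..u} \<le> cdf eq_law (quant u)"
    unfolding cdf_eq_law by (intro U.finite_measure_mono) auto
  then show ?thesis using u by (simp add: measure_uniform01_Iic del: measure_uniform_measure)
qed

abbreviation payoff :: "real \<Rightarrow> real" where "payoff \<equiv> mean_field_payoff R eq_law"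

lemma line_0: "line 0 = R1" by (simp add: line_def h_0)

lemma line_mono: "x \<le> y \<Longrightarrow> line x \<le> line y"
  using R1_less_Rbar by (simp add: line_def mult_left_mono)

lemma payoff_le_line:
  assumes "0 \<le> x" shows "payoff x \<le> line x"
proof -
  interpret real_distribution eq_law by (rule eq_law_distribution)
  have "g (cdf eq_law x) \<le> line x"
  \<comment> \<open>Left continuity of g is available at positive arguments; at 0 the reward is R1,
    the value of the line at 0.\<close>
  proof (cases "cdf eq_law x = 0")
    case True
    then show ?thesis using line_mono[OF assms] line_0 by simp
  next
    case False
    show ?thesis
    proof (rule g_left_continuous)
      fix y assume "0 < y" "y < cdf eq_law x"
      then show "g y \<le> line x" by (intro below_cdf) auto
    qed (use False cdf_left_bounds(3)[of x] cdf_nonneg[of x] in auto)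
  qed
  moreover have "g y \<le> line x" if "cdf_left eq_law x < y" "y < cdf eq_law x" for y
    using that cdf_left_bounds(1)[of x] by (intro below_cdf) auto
  ultimately show ?thesis unfolding payoff_eq[OF eq_law_distribution]
    using cdf_left_bounds(2)[of x] by (intro avg_le)
qed

text \<open>At a jump the mean involves the open interval only, where \<open>above_cdf_left\<close>
  applies; at a continuity point the single value has to be supplied.\<close>

lemma payoff_ge:
  assumes "cdf eq_law x = cdf_left eq_law x \<Longrightarrow> line x \<le> g (cdf eq_law x)"
  shows "line x \<le> payoff x"
proof -
  interpret real_distribution eq_law by (rule eq_law_distribution)
  have "line x \<le> g y" if "cdf_left eq_law x < y" "y < cdf eq_law x" for y
    using that cdf_left_bounds(3)[of x] by (intro above_cdf_left) auto
  then show ?thesis unfolding payoff_eq[OF eq_law_distribution]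
    using cdf_left_bounds(2)[of x] assms by (intro avg_ge) auto
qed

lemma payoff_quant: "0 \<le> u \<Longrightarrow> u \<le> 1 \<Longrightarrow> g u \<le> payoff (quant u)"
  using payoff_ge[of "quant u", unfolded line_quant] monoD[OF g_mono cdf_quant[of u]] by blast

lemma payoff_top:
  assumes "R0 \<le> line x" shows "payoff x = R0"
proof (rule antisym)
  interpret U: prob_space uniform01 by (rule prob_space_uniform01)
  interpret real_distribution eq_law by (rule eq_law_distribution)
  show "payoff x \<le> R0" by (rule payoff_bounds(2)[OF eq_law_distribution])
  have "{u. quant u \<le> x} = UNIV" using assms g_bounds(2) by (auto simp: quant_le_iff intro: order_trans)
  then have "cdf eq_law x = 1" unfolding cdf_eq_law using U.prob_space by (simp del: measure_uniform_measure)
  then have "line x \<le> payoff x \<or> payoff x = R0"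
    using payoff_ge[of x] g_1 payoff_eq[OF eq_law_distribution, of x] by (cases "cdf_left eq_law x = 1") (auto simp: avg_def)
  then show "R0 \<le> payoff x" using assms by auto
qed

lemma integral_line:
  assumes "0 \<le> x" "G \<in> L x"
  shows "integrable G line" "(\<integral>y. line y \<partial>G) = R1 + (Rbar - R1) * (\<integral>y. h y \<partial>G)" "(\<integral>y. line y \<partial>G) \<le> line x"
proof -
  interpret real_distribution G by (rule L_distribution[OF assms])
  show "integrable G line" "(\<integral>y. line y \<partial>G) = R1 + (Rbar - R1) * (\<integral>y. h y \<partial>G)"
    unfolding line_def using L_integrable(1)[OF assms] prob_space by auto
  then show "(\<integral>y. line y \<partial>G) \<le> line x"
    using L_integrable(2)[OF assms] R1_less_Rbar by (simp add: line_def mult_left_mono)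
qed

lemma integral_payoff_le:
  assumes "0 \<le> x" "G \<in> L x"
  shows "(\<integral>y. payoff y \<partial>G) \<le> min (line x) R0"
proof -
  interpret real_distribution G by (rule L_distribution[OF assms])
  note i = payoff_integrable[OF eq_law_distribution L_distribution[OF assms]]
  have "AE y in G. payoff y \<le> line y" using L_nonneg[OF assms] by eventually_elim (rule payoff_le_line)
  then have "(\<integral>y. payoff y \<partial>G) \<le> (\<integral>y. line y \<partial>G)" using i integral_line(1)[OF assms] by (intro integral_mono_AE)
  moreover have "(\<integral>y. payoff y \<partial>G) \<le> (\<integral>y. R0 \<partial>G)"
    using i payoff_bounds(2)[OF eq_law_distribution] by (intro integral_mono) auto
  then have "(\<integral>y. payoff y \<partial>G) \<le> R0" using prob_space by simp
  ultimately show ?thesis using integral_line(3)[OF assms] by simp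
qed

lemma line_x0: "line x0 = Rbar"
  by (simp add: line_def h_x0)

text \<open>Every attainable law earns at most the integral of the line, hence at most line x0 =
  Rbar; \<open>eq_law\<close> earns at least g u at its quantile u, and these rewards average to
  Rbar.\<close>

theorem eq_law_equilibrium: "equilibrium (L x0) (mean_field_payoff R) eq_law"
proof -
  interpret U: prob_space uniform01 by (rule prob_space_uniform01)
  note pm[measurable] = payoff_meas[OF eq_law_distribution]
  have i: "integrable uniform01 (\<lambda>u. payoff (quant u))"
    using payoff_bounds[OF eq_law_distribution] by (intro U.integrable_const_bound[where B=R0]) auto
  have "Rbar \<le> (\<integral>u. payoff (quant u) \<partial>uniform01)"
    unfolding Rbar_eq[symmetric]
  proof (rule integral_mono_AE[OF g_integrable_uniform01 i])
    show "AE u in uniform01. g u \<le> payoff (quant u)"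
      using AE_interior_uniform01 by eventually_elim (simp add: payoff_quant)
  qed
  also have "\<dots> = (\<integral>y. payoff y \<partial>eq_law)"
  proof -
    have "(\<integral>y. f y \<partial>eq_law) = (\<integral>u. f (quant u) \<partial>uniform01)" if "f \<in> borel_measurable borel" for f :: "real \<Rightarrow> real"
      unfolding eq_law_def using that by (intro integral_distr) auto
    from this[OF pm] show ?thesis by (rule sym)
  qed
  finally have "Rbar \<le> (\<integral>y. payoff y \<partial>eq_law)" .
  then show ?thesis
    unfolding equilibrium_def using eq_law_attainable integral_payoff_le[of x0] x0 by (force simp: line_x0)
qed

text \<open>Where the line has reached R0, stopping at once is optimal. Below, leaving (0, B) with
  line B = R0 earns at least the line: the mean payoff of the exit law is affine in h x, and it
  dominates the line at both ends.\<close>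

theorem eq_law_value:
  assumes x: "0 \<le> x"
  shows "optimal_value (L x) (mean_field_payoff R eq_law) = min (line x) R0"
proof -
  let ?V = "\<lambda>G. \<integral>y. payoff y \<partial>G"
  note pm = payoff_meas[OF eq_law_distribution]
  note pb = payoff_bounds[OF eq_law_distribution]
  have "\<exists>G\<in>L x. min (line x) R0 \<le> ?V G"
  proof (cases "R0 \<le> line x")
    case True
    \<comment> \<open>Stopping at once is the two-point law with a = b = x, whose first weight 0 / 0
      is 0.\<close>
    obtain G where "G \<in> L x" "?V G = payoff x"
      using L_two_point[OF x order_refl order_refl] pm pb(3) by fastforce
    then show ?thesis using payoff_top[OF True] by (intro bexI[of _ G]) auto
  next
    case False
    obtain B where B: "h B = (R0 - R1) / (Rbar - R1)" using cap by blast
    have lB: "line B = R0" using R1_less_Rbar by (simp add: line_def B)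
    have xB: "x \<le> B" using line_mono[of B x] False lB by linarith
    define w where "w = (h B - h x) / (h B - h 0)"
    obtain G where G: "G \<in> L x" "?V G = w * payoff 0 + (1 - w) * payoff B"
      unfolding w_def using L_two_point[OF order_refl x xB] pm pb(3) by fast
    have hB: "0 < h B" using B R1_less_Rbar R1_less_R0 by simp
    have w: "0 \<le> w" "1 - w = h x / h B" using xB hB by (auto simp: w_def h_0 field_simps)
    have "line x = R1 + (R0 - R1) * (h x / h B)"
      using R1_less_Rbar R1_less_R0 by (simp add: line_def B)
    also have "\<dots> = w * R1 + (1 - w) * R0" unfolding w(2)[symmetric] by (simp add: algebra_simps)
    also have "\<dots> \<le> w * payoff 0 + (1 - w) * R0" using w(1) pb(1) by (intro add_right_mono mult_left_mono)
    also have "\<dots> = ?V G" using G(2) payoff_top[of B] lB by simp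
    finally show ?thesis using G(1) by (intro bexI[of _ G]) auto
  qed
  then obtain G where G: "G \<in> L x" "min (line x) R0 \<le> ?V G" by blast
  show ?thesis unfolding optimal_value_def
  proof (rule antisym)
    show "(SUP G\<in>L x. ?V G) \<le> min (line x) R0"
      using G(1) integral_payoff_le[OF x] by (intro cSUP_least) auto
    show "min (line x) R0 \<le> (SUP G\<in>L x. ?V G)"
      using G integral_payoff_le[OF x] by (intro cSUP_upper2[OF _ G(1)]) (auto intro!: bdd_aboveI2[where M="min (line x) R0"])
  qed
qed

section \<open>Uniqueness of the equilibrium\<close>

context
  fixes F :: "real measure"
  assumes F: "equilibrium (L x0) (mean_field_payoff R) F"
begin

lemma F_L: "F \<in> L x0" using F by (simp add: equilibrium_def)

lemma F_distribution: "real_distribution F"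
  using L_distribution[OF _ F_L] x0 by simp

abbreviation \<xi> :: "real \<Rightarrow> real" where "\<xi> \<equiv> mean_field_payoff R F"
definition val :: real where "val = (\<integral>y. \<xi> y \<partial>F)"

lemmas \<xi>_bounds = payoff_bounds[OF F_distribution]
lemmas \<xi>_meas = payoff_meas[OF F_distribution]
lemmas \<xi>_mono = monoD[OF payoff_mono[OF F_distribution]]

lemma deviation: "G \<in> L x0 \<Longrightarrow> (\<integral>y. \<xi> y \<partial>G) \<le> val"
  using F by (auto simp: equilibrium_def val_def)

text \<open>By two-point deviations around \<open>x0\<close>, each slope of the payoff to the right,
  measured in the scale \<open>h\<close> from height \<open>val\<close> at \<open>x0\<close>, is at
  most each such slope to the left, and any number in between supports. The second claim makes the
  line integrate to at most \<open>val\<close> against \<open>F\<close>.\<close>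

lemma supporting_line:
  "\<exists>c. (\<forall>x. 0 \<le> x \<longrightarrow> \<xi> x \<le> val + c * (h x - 1)) \<and> c * ((\<integral>y. h y \<partial>F) - 1) \<le> 0"
proof -
  have two: "(\<xi> b - val) * (1 - h a) \<le> (val - \<xi> a) * (h b - 1)" if ab: "0 \<le> a" "a < x0" "x0 < b" for a b
  proof -
    define w where "w = (h b - h x0) / (h b - h a)"
    obtain G where G: "G \<in> L x0" "(\<integral>y. \<xi> y \<partial>G) = w * \<xi> a + (1 - w) * \<xi> b"
      unfolding w_def using L_two_point[of a x0 b] \<xi>_meas \<xi>_bounds(3) ab by (metis less_imp_le)
    have "h a < h b" using ab by simp
    then have "w * (h b - h a) = h b - 1" using \<open>h a < h b\<close> by (simp add: w_def h_x0 del: h_less_iff)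
    moreover have "(w * \<xi> a + (1 - w) * \<xi> b) * (h b - h a) \<le> val * (h b - h a)"
      using deviation[OF G(1)] \<open>h a < h b\<close> unfolding G(2) by (intro mult_right_mono) auto
    moreover have "(w * \<xi> a + (1 - w) * \<xi> b) * (h b - h a) = (w * (h b - h a)) * \<xi> a + ((h b - h a) - w * (h b - h a)) * \<xi> b"
      by (simp add: algebra_simps)
    ultimately have "(h b - 1) * \<xi> a + ((h b - h a) - (h b - 1)) * \<xi> b \<le> val * (h b - h a)"
      by (simp only:)
    then show ?thesis by (simp add: algebra_simps)
  qed
  have mid: "\<xi> x0 \<le> val"
  proof -
    obtain G where "G \<in> L x0" "(\<integral>y. \<xi> y \<partial>G) = \<xi> x0"
      using L_two_point[of x0 x0 x0] \<xi>_meas \<xi>_bounds(3) x0 by fastforce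
    then show ?thesis using deviation by metis
  qed
  let ?A = "(\<lambda>b. (\<xi> b - val) / (h b - 1)) ` {x0<..}"
  have hb: "0 < h b - 1" if "x0 < b" for b using that h_less_iff[of x0 b] h_x0 by (simp del: h_less_iff)
  have ha: "0 < 1 - h a" if "a < x0" for a using that h_less_iff[of a x0] h_x0 by (simp del: h_less_iff)
  have le: "r \<le> (val - \<xi> a) / (1 - h a)" if a: "0 \<le> a" "a < x0" and r: "r \<in> ?A" for a r
  proof -
    obtain b where b: "x0 < b" "r = (\<xi> b - val) / (h b - 1)" using r by auto
    show ?thesis using two[OF a b(1)] hb[OF b(1)] ha[OF a(2)] unfolding b(2)
      by (simp add: divide_le_eq le_divide_eq)
  qed
  have bdd: "bdd_above ?A" using le[of 0] x0 by (intro bdd_aboveI) auto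
  have ne: "?A \<noteq> {}" by auto
  define c0 where "c0 = Sup ?A"
  have c0_upper: "\<xi> b \<le> val + c0 * (h b - 1)" if "x0 < b" for b
  proof -
    have "(\<xi> b - val) / (h b - 1) \<le> c0" unfolding c0_def using that bdd by (intro cSup_upper) auto
    then show ?thesis using hb[OF that] by (simp add: divide_le_eq)
  qed
  have c0_lower: "c0 \<le> (val - \<xi> a) / (1 - h a)" if "0 \<le> a" "a < x0" for a
    unfolding c0_def using ne le[OF that] by (intro cSup_least) auto
  \<comment> \<open>If means may drop below 1, the second claim requires a nonnegative slope.
    Raising it to 0 is harmless to the right of \<open>x0\<close>; to the left the point masses are
    attainable and keep the payoff below \<open>val\<close>.\<close>
  define c where "c = (if \<forall>G\<in>L x0. (\<integral>\<^sup>+y. ennreal (h y) \<partial>G) = 1 then c0 else max 0 c0)"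
  have "\<xi> x \<le> val + c * (h x - 1)" if "0 \<le> x" for x
  proof -
    consider "x < x0" | "x = x0" | "x0 < x" by linarith
    then show ?thesis
    proof cases
      case 1
      have "c \<le> (val - \<xi> x) / (1 - h x)"
      proof (cases "\<forall>G\<in>L x0. (\<integral>\<^sup>+y. ennreal (h y) \<partial>G) = 1")
        case False
        then have "return borel x \<in> L x0" using L_alt that 1 by auto
        then have "\<xi> x \<le> val" using deviation[of "return borel x"] \<xi>_meas by (simp add: integral_return)
        then have "0 \<le> (val - \<xi> x) / (1 - h x)" using ha[OF 1] by simp
        then show ?thesis using c0_lower[OF that 1] False by (simp add: c_def)
      qed (use c0_lower[OF that 1] in \<open>simp add: c_def\<close>)
      then show ?thesis using ha[OF 1] by (simp add: le_divide_eq algebra_simps)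
    next
      case 2
      then show ?thesis using mid by (simp add: h_x0)
    next
      case 3
      have "c0 \<le> c" by (simp add: c_def)
      then have "c0 * (h x - 1) \<le> c * (h x - 1)" using hb[OF 3] by (intro mult_right_mono) auto
      then show ?thesis using c0_upper[OF 3] by linarith
    qed
  qed
  moreover have "c * ((\<integral>y. h y \<partial>F) - 1) \<le> 0"
  proof (cases "\<forall>G\<in>L x0. (\<integral>\<^sup>+y. ennreal (h y) \<partial>G) = 1")
    case True
    then show ?thesis using L_integrable(3)[OF _ F_L] F_L x0 by simp
  next
    case False
    then have "c = max 0 c0" unfolding c_def by (rule if_not_P)
    then have "0 \<le> c" by simp
    then show ?thesis using L_integrable(2)[OF _ F_L] x0 by (simp add: h_x0 mult_nonneg_nonpos)
  qed
  ultimately show ?thesis by blast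
qed

lemma equilibrium_unique: "F = eq_law"
proof -
  interpret U: prob_space uniform01 by (rule prob_space_uniform01)
  interpret F: real_distribution F by (rule F_distribution)
  note [measurable] = \<xi>_meas
  obtain c where line: "\<And>x. 0 \<le> x \<Longrightarrow> \<xi> x \<le> val + c * (h x - 1)" and slope: "c * ((\<integral>y. h y \<partial>F) - 1) \<le> 0"
    using supporting_line by blast
  define l where "l x = val + c * (h x - 1)" for x
  have l_line: "\<xi> x \<le> l x" if "0 \<le> x" for x using line[OF that] by (simp add: l_def)
  have [measurable]: "l \<in> borel_measurable borel" unfolding l_def by measurable
  have hi: "integrable F h" using L_integrable(1)[OF _ F_L] x0 by simp
  have li: "integrable F l" and l_int: "(\<integral>y. l y \<partial>F) = val + c * ((\<integral>y. h y \<partial>F) - 1)"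
    unfolding l_def using hi F.prob_space by auto
  have \<xi>i: "integrable F \<xi>" by (rule payoff_integrable[OF F_distribution F_distribution])
  have nn: "AE y in F. 0 \<le> y" using L_nonneg[OF _ F_L] x0 by simp
  have pos: "AE y in F. 0 \<le> l y - \<xi> y" using nn by eventually_elim (use l_line in auto)
  \<comment> \<open>The gap between line and payoff is nonnegative, and by \<open>slope\<close> its
    integral is at most 0; so the gap vanishes almost everywhere and the slope term is 0.\<close>
  have "(\<integral>y. l y - \<xi> y \<partial>F) = c * ((\<integral>y. h y \<partial>F) - 1)"
    using li \<xi>i l_int by (simp add: val_def)
  then have zero: "(\<integral>y. l y - \<xi> y \<partial>F) = 0" and slope0: "c * ((\<integral>y. h y \<partial>F) - 1) = 0"
    using slope integral_nonneg_AE[OF pos] by linarith+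
  have "AE y in F. l y - \<xi> y = 0"
    using integral_nonneg_eq_0_iff_AE[OF _ pos] li \<xi>i zero by simp
  then have touch: "AE y in F. 0 \<le> y \<and> \<xi> y = l y" using nn by eventually_elim simp

  obtain J where J[measurable]: "J \<in> borel_measurable borel" and FJ: "distr uniform01 borel J = F"
    and Jm: "mono_on {0<..<1} J" and Jq: "\<And>u x. 0 < u \<Longrightarrow> u < 1 \<Longrightarrow> u \<le> cdf F x \<longleftrightarrow> J u \<le> x"
    using quantile_representation[OF F_distribution] by blast
  have touchJ: "AE u in uniform01. 0 \<le> J u \<and> \<xi> (J u) = l (J u)"
    using touch unfolding FJ[symmetric] by (subst (asm) AE_distr_iff) (auto simp: FJ)
  \<comment> \<open>The lower ends of the jumps of the cdf are the points that
    \<open>avg_eq_right\<close> leaves out; they are countably many.\<close>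
  have atoms: "countable (cdf_left F ` {x. measure F {x} \<noteq> 0})"
    using F.countable_support by (intro countable_image)
  have noatom: "AE u in uniform01. u \<notin> cdf_left F ` {x. measure F {x} \<noteq> 0}"
  proof (subst AE_uniform_measure)
    have "cdf_left F ` {x. measure F {x} \<noteq> 0} \<in> null_sets lborel"
      using atoms by (rule countable_imp_null_set_lborel)
    then show "AE u in lborel. u \<in> {0..1} \<longrightarrow> u \<notin> cdf_left F ` {x. measure F {x} \<noteq> 0}"
      by (rule AE_mp[OF AE_not_in]) (rule AE_I2, simp)
  qed auto
  have key: "AE u in uniform01. 0 < u \<and> u < 1 \<and> 0 \<le> J u \<and> g u = l (J u)"
    using touchJ noatom AE_interior_uniform01
  proof eventually_elim
    case (elim u)
    let ?x = "J u" and ?p = "cdf_left F (J u)" and ?q = "cdf F (J u)"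
    have uq: "u \<le> ?q" using Jq[of u "J u"] elim by simp
    have pu: "?p \<le> u"
    proof (rule F.cdf_left_le)
      fix y assume "y < J u"
      then show "cdf F y \<le> u" using Jq[of u y] elim by simp
    qed
    have "g u = l ?x"
    proof (cases "?p = ?q")
      case True
      then show ?thesis using uq pu elim by (simp add: payoff_eq[OF F_distribution] avg_def)
    next
      case False
      then have pq: "?p < ?q" using uq pu by simp
      \<comment> \<open>Immediately above an atom the payoff is already at least g ?q and lies below
        \<open>l\<close>; continuity of \<open>l\<close> carries this bound back to the
        atom.\<close>
      have gq: "g ?q \<le> l y" if "?x < y" for y
      proof -
        have "g ?q \<le> g (cdf_left F y)" using F.cdf_left_bounds(4)[OF that] by (intro monoD[OF g_mono])
        also have "\<dots> \<le> \<xi> y" unfolding payoff_eq[OF F_distribution] using F.cdf_left_bounds(2) by (intro avg_bounds)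
        also have "\<dots> \<le> l y" using that elim by (intro l_line) simp
        finally show ?thesis .
      qed
      have "isCont l ?x" unfolding l_def using h_cont by (intro continuous_intros) (simp add: continuous_on_eq_continuous_at)
      then have "(l \<longlongrightarrow> l ?x) (at_right ?x)" by (auto simp: isCont_def intro: filterlim_mono[OF _ order_refl at_le])
      moreover have "\<forall>\<^sub>F y in at_right ?x. g ?q \<le> l y"
        unfolding eventually_at_right_field by (intro exI[of _ "?x + 1"]) (auto intro: gq)
      ultimately have "g ?q \<le> l ?x" by (intro tendsto_lowerbound) auto
      also have "l ?x = avg ?p ?q" using elim by (simp add: payoff_eq[OF F_distribution])
      finally have eq: "avg ?p ?q = g ?q" using avg_bounds(2)[of ?p ?q] pq by simp
      have "measure F {?x} \<noteq> 0" using F.cdf_left_bounds(5)[of ?x] pq by simp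
      then have "u \<noteq> ?p" using elim by auto
      then have "g u = g ?q" using avg_eq_right[OF pq eq, of u] pu uq by simp
      then show ?thesis using eq elim by (simp add: payoff_eq[OF F_distribution])
    qed
    then show ?case using elim by simp
  qed
  have Jle: "h (J u) \<le> h (J v)" if "0 < u" "u \<le> v" "v < 1" for u v
    using mono_onD[OF Jm, of u v] that by simp
  \<comment> \<open>g lies below the midpoint near 0 and above it near 1. As g u = l (J u) for
    almost all u and \<open>J\<close> is monotone, \<open>l\<close> has to increase.\<close>
  have c: "0 < c"
  proof (rule ccontr)
    assume "\<not> 0 < c"
    let ?m = "(R1 + R0) / 2"
    have m: "R1 < ?m" "?m < R0" using R1_less_R0 by auto
    obtain d where d: "0 < d" "d < 1" "\<And>u. u < d \<Longrightarrow> g u < ?m" using g_near_0[OF m(1)] by blast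
    obtain e where e: "0 < e" "e < 1" "\<And>u. e < u \<Longrightarrow> ?m < g u" using g_near_1[OF m(2)] by blast
    obtain u where u: "0 < u" "u < d" "0 < u \<and> u < 1 \<and> 0 \<le> J u \<and> g u = l (J u)"
      using AE_uniform01_dense[OF key, of 0 d] d by auto
    obtain v where v: "e < v" "v < 1" "0 < v \<and> v < 1 \<and> 0 \<le> J v \<and> g v = l (J v)"
      using AE_uniform01_dense[OF key, of e 1] e by auto
    have uv: "g u < g v" using d(3)[OF u(2)] e(3)[OF v(1)] by simp
    then have "u \<le> v" using monoD[OF g_mono, of v u] by (meson leD linorder_le_cases)
    then have "h (J u) \<le> h (J v)" using Jle u v by simp
    then have "c * (h (J v) - 1) \<le> c * (h (J u) - 1)" using \<open>\<not> 0 < c\<close> by (intro mult_left_mono_neg) auto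
    then show False using uv u(3) v(3) by (simp add: l_def)
  qed
  \<comment> \<open>Near u = 0 the reward, which equals l (J u) >= l 0, comes arbitrarily close to
    R1; conversely the line dominates the payoff at 0.\<close>
  have l0: "l 0 = R1"
  proof (rule antisym)
    show "R1 \<le> l 0" using l_line[of 0] \<xi>_bounds(1)[of 0] by simp
    show "l 0 \<le> R1"
    proof (rule ccontr)
      assume "\<not> l 0 \<le> R1"
      then obtain d where d: "0 < d" "d < 1" "\<And>u. u < d \<Longrightarrow> g u < l 0" using g_near_0[of "l 0"] by (auto simp: not_le)
      obtain u where u: "0 < u" "u < d" "0 < u \<and> u < 1 \<and> 0 \<le> J u \<and> g u = l (J u)"
        using AE_uniform01_dense[OF key, of 0 d] d by auto
      have "l 0 \<le> l (J u)" using u c mult_nonneg_nonneg[of c "h (J u)"] h_nonneg[of "J u"] by (simp add: l_def h_0 algebra_simps)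
      then show False using d(3)[OF u(2)] u by simp
    qed
  qed
  \<comment> \<open>With c > 0 the slope term forces mean 1 for every sign of the drift.\<close>
  have h1: "(\<integral>y. h y \<partial>F) = 1" using slope0 c by simp
  have "Rbar = (\<integral>u. l (J u) \<partial>uniform01)"
    unfolding Rbar_eq[symmetric] using key by (intro integral_cong_AE) (auto elim: eventually_mono)
  also have "\<dots> = (\<integral>y. l y \<partial>F)" unfolding FJ[symmetric] by (subst integral_distr) auto
  also have "\<dots> = val" by (simp add: l_int h1)
  finally have v: "val = Rbar" by simp
  then have cR: "c = Rbar - R1" using l0 by (simp add: l_def h_0)
  have JQ: "AE u in uniform01. J u = quant u"
    using key
  proof eventually_elim
    case (elim u)
    then have "g u = line (J u)" by (simp add: l_def line_def v cR algebra_simps)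
    then have "line (J u) = line (quant u)" by (simp add: line_quant)
    then have "h (J u) = h (quant u)" using R1_less_Rbar by (simp add: line_def)
    then show ?case using h_inj by (simp add: inj_eq)
  qed
  have "distr uniform01 borel J = eq_law"
    unfolding eq_law_def by (rule distr_cong_AE[OF refl refl JQ]) auto
  then show ?thesis using FJ by simp
qed

end

theorem equilibrium_iff: "equilibrium (L x0) (mean_field_payoff R) F \<longleftrightarrow> F = eq_law"
  using equilibrium_unique eq_law_equilibrium by blast

end

section \<open>The n-player game as a game with a reward function\<close>

text \<open>Expected reward when each of m opponents ranks ahead independently with probability 1 -
  y; for m = n - 1 it is \<open>g\<^sub>n\<close>. In the variable 1 - y it is a Bernstein
  polynomial with coefficients r 1, ..., r (m + 1).\<close>

definition bernstein_sum :: "nat \<Rightarrow> (nat \<Rightarrow> real) \<Rightarrow> real \<Rightarrow> real" where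
  "bernstein_sum m r y = (\<Sum>i\<le>m. real (m choose i) * y ^ (m - i) * (1 - y) ^ i * r (Suc i))"

lemma bernstein_sum_0: "bernstein_sum 0 r y = r 1"
  by (simp add: bernstein_sum_def)

text \<open>Condition on one opponent: if behind, with probability y, the rewards are unchanged; if
  ahead, they shift by one rank.\<close>

lemma bernstein_sum_Suc:
  "bernstein_sum (Suc m) r y = y * bernstein_sum m r y + (1 - y) * bernstein_sum m (\<lambda>i. r (Suc i)) y"
proof -
  let ?t = "\<lambda>m i. y ^ (m - i) * (1 - y) ^ i * r (Suc i)"
  have "bernstein_sum (Suc m) r y = ?t (Suc m) 0 + (\<Sum>i\<le>m. real (Suc m choose Suc i) * ?t (Suc m) (Suc i))"
    by (simp add: bernstein_sum_def sum.atMost_Suc_shift mult.assoc del: sum.atMost_Suc binomial_Suc_Suc)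
  also have "\<dots> = (?t (Suc m) 0 + (\<Sum>i\<le>m. real (m choose Suc i) * ?t (Suc m) (Suc i))) + (\<Sum>i\<le>m. real (m choose i) * ?t (Suc m) (Suc i))"
    by (simp add: distrib_right sum.distrib)
  also have "?t (Suc m) 0 + (\<Sum>i\<le>m. real (m choose Suc i) * ?t (Suc m) (Suc i)) = (\<Sum>i\<le>Suc m. real (m choose i) * ?t (Suc m) i)"
    by (simp add: sum.atMost_Suc_shift del: sum.atMost_Suc)
  also have "\<dots> = y * bernstein_sum m r y"
    by (simp add: bernstein_sum_def sum_distrib_left Suc_diff_le mult_ac)
  also have "(\<Sum>i\<le>m. real (m choose i) * ?t (Suc m) (Suc i)) = (1 - y) * bernstein_sum m (\<lambda>i. r (Suc i)) y"
    by (simp add: bernstein_sum_def sum_distrib_left mult_ac)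
  finally show ?thesis .
qed

lemma bernstein_sum_antimono:
  assumes "0 \<le> y" "y \<le> 1" "\<And>i. 1 \<le> i \<Longrightarrow> i \<le> Suc m \<Longrightarrow> r i \<le> s i"
  shows "bernstein_sum m r y \<le> bernstein_sum m s y"
  unfolding bernstein_sum_def using assms by (intro sum_mono mult_left_mono) auto

text \<open>In the recursion the shifted rewards give the smaller sum, so more weight y on the
  unshifted one increases the mean.\<close>

lemma bernstein_sum_mono:
  assumes "\<And>i. 1 \<le> i \<Longrightarrow> i \<le> m \<Longrightarrow> r (Suc i) \<le> r i" "0 \<le> y" "y \<le> z" "z \<le> 1"
  shows "bernstein_sum m r y \<le> bernstein_sum m r z"
  using assms
proof (induction m arbitrary: r)
  case (Suc m)
  let ?B = "bernstein_sum m r" and ?C = "bernstein_sum m (\<lambda>i. r (Suc i))"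
  have 1: "?B y \<le> ?B z" "?C y \<le> ?C z" using Suc.prems by (auto intro!: Suc.IH)
  have 2: "?C z \<le> ?B z" using Suc.prems by (intro bernstein_sum_antimono) auto
  have "y * ?B y + (1 - y) * ?C y \<le> y * ?B z + (1 - y) * ?C z"
    using 1 Suc.prems by (intro add_mono mult_left_mono) auto
  also have "\<dots> = ?C z + y * (?B z - ?C z)" by (simp add: algebra_simps)
  also have "\<dots> \<le> ?C z + z * (?B z - ?C z)" using 2 Suc.prems by (intro add_left_mono mult_right_mono) auto
  also have "\<dots> = z * ?B z + (1 - z) * ?C z" by (simp add: algebra_simps)
  finally show ?case by (simp add: bernstein_sum_Suc)
qed (simp add: bernstein_sum_0)

lemma bernstein_sum_at_0: "bernstein_sum m r 0 = r (Suc m)"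
  by (induction m arbitrary: r) (simp_all add: bernstein_sum_0 bernstein_sum_Suc)

lemma bernstein_sum_at_1: "bernstein_sum m r 1 = r 1"
  by (induction m arbitrary: r) (simp_all add: bernstein_sum_0 bernstein_sum_Suc)

lemma continuous_on_bernstein_sum [continuous_intros]: "continuous_on A f \<Longrightarrow> continuous_on A (\<lambda>x. bernstein_sum m r (f x))"
  unfolding bernstein_sum_def by (intro continuous_intros)

lemma integral_Beta_nat: "((\<lambda>s::real. s ^ a * (1 - s) ^ b) has_integral fact a * fact b / fact (Suc (a + b))) {0..1}"
proof -
  have "((\<lambda>s. s powr (real (Suc a) - 1) * (1 - s) powr (real (Suc b) - 1)) has_integral Beta (real (Suc a)) (real (Suc b))) {0..1}"
    by (rule has_integral_Beta_real) auto
  moreover have "Beta (real (Suc a)) (real (Suc b)) = fact a * fact b / fact (Suc (a + b))"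
  proof -
    have "real (Suc a) + real (Suc b) = 1 + real (Suc (a + b))" by simp
    then show ?thesis
      unfolding Beta_def using Gamma_fact[of a, where 'a=real] Gamma_fact[of b, where 'a=real] Gamma_fact[of "Suc (a + b)", where 'a=real]
      by (simp add: add_ac)
  qed
  ultimately have "((\<lambda>s. s powr real a * (1 - s) powr real b) has_integral fact a * fact b / fact (Suc (a + b))) {0..1}"
    by simp
  then show ?thesis
  \<comment> \<open>The endpoints are excepted because 0 powr 0 is 0 while 0 ^ 0 is 1.\<close>
  proof (rule has_integral_spike_finite[of "{0, 1}", rotated 2])
    fix s :: real assume "s \<in> {0..1} - {0, 1}"
    then show "s ^ a * (1 - s) ^ b = s powr real a * (1 - s) powr real b" by (simp add: powr_realpow)
  qed simp
qed

text \<open>Expanding both powers in \<open>bernstein_sum\<close> binomially around \<open>p\<close> and \<open>e = 1 - p - d\<close> leaves Beta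
  integrals, whose values are the weights of the \<open>n\<close>-player payoff. For \<open>d = 0\<close> only \<open>k = 0\<close> contributes,
  by \<open>0\<^sup>0 = 1\<close>.\<close>

lemma integral_bernstein_sum:
  fixes p d e :: real
  assumes "p + d + e = 1"
  shows "((\<lambda>s. bernstein_sum m r (p + d * s)) has_integral
    (\<Sum>(i, j, k)\<in>{(i, j, k). i + j + k = m}. (\<Sum>l = i + 1..i + k + 1. r l) / real (k + 1)
      * (fact m / (fact i * fact j * fact k)) * e ^ i * p ^ j * d ^ k)) {0..1}"
proof -
  let ?A = "{(i, j, k). i + j + k = m}"
  let ?S = "SIGMA b:{..m}. {..m - b} \<times> {..b}"
  define c where "c i j k = fact m / (fact i * fact j * fact k) / real (k + 1) * e ^ i * p ^ j * d ^ k" for i j k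
  have "?A \<subseteq> {..m} \<times> {..m} \<times> {..m}" by auto
  then have finA: "finite ?A" by (rule finite_subset) auto
  have "(\<Sum>(i, j, k)\<in>?A. (\<Sum>l = i + 1..i + k + 1. r l) / real (k + 1)
      * (fact m / (fact i * fact j * fact k)) * e ^ i * p ^ j * d ^ k)
    = (\<Sum>t\<in>?A. \<Sum>l\<in>{fst t + 1..fst t + snd (snd t) + 1}. r l * c (fst t) (fst (snd t)) (snd (snd t)))"
  proof (intro sum.cong refl)
    have "a / real (k + 1) * (fact m / (fact i * fact j * fact k)) * e ^ i * p ^ j * d ^ k = a * c i j k" for a i j k
      by (simp add: c_def mult_ac)
    then show "(case t of (i, j, k) \<Rightarrow> (\<Sum>l = i + 1..i + k + 1. r l) / real (k + 1)
        * (fact m / (fact i * fact j * fact k)) * e ^ i * p ^ j * d ^ k)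
      = (\<Sum>l\<in>{fst t + 1..fst t + snd (snd t) + 1}. r l * c (fst t) (fst (snd t)) (snd (snd t)))" for t
      by (simp only: case_prod_beta' sum_distrib_right)
  qed
  also have "\<dots> = (\<Sum>(t, l)\<in>(SIGMA t:?A. {fst t + 1..fst t + snd (snd t) + 1}). r l * c (fst t) (fst (snd t)) (snd (snd t)))"
    by (rule sum.Sigma[OF finA]) auto
  \<comment> \<open>Reindexing by b = l - 1, the number of players ahead after ties are broken: i of
    them are strictly above and b - i are tied.\<close>
  also have "\<dots> = (\<Sum>(b, j, i)\<in>?S. r (Suc b) * c i j (m - i - j))"
    by (rule sum.reindex_bij_witness[where i="\<lambda>(b, j, i). ((i, j, m - i - j), Suc b)" and j="\<lambda>((i, j, k), l). (l - 1, j, i)"]) auto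
  finally have eq: "(\<Sum>(i, j, k)\<in>?A. (\<Sum>l = i + 1..i + k + 1. r l) / real (k + 1)
      * (fact m / (fact i * fact j * fact k)) * e ^ i * p ^ j * d ^ k) = (\<Sum>(b, j, i)\<in>?S. r (Suc b) * c i j (m - i - j))" .
  define f where "f b j i = real (m choose b) * real ((m - b) choose j) * real (b choose i) * p ^ j * e ^ i * d ^ (m - i - j) * r (Suc b)" for b j i
  \<comment> \<open>Here s is the position within the tie: m - b - j tied players fall behind it and
    b - i ahead. The Beta integral of these exponents cancels the factorials in the binomial
    coefficients.\<close>
  have "((\<lambda>s. f b j i * (s ^ (m - b - j) * (1 - s) ^ (b - i))) has_integral r (Suc b) * c i j (m - i - j)) {0..1}"
    if t: "b \<le> m" "j \<le> m - b" "i \<le> b" for b j i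
  proof -
    have ab: "m - b - j + (b - i) = m - i - j" using t by simp
    have "real (m choose b) = fact m / (fact b * fact (m - b))" "real ((m - b) choose j) = fact (m - b) / (fact j * fact (m - b - j))"
      "real (b choose i) = fact b / (fact i * fact (b - i))"
      using t by (simp_all add: binomial_fact)
    then have "f b j i * (fact (m - b - j) * fact (b - i) / fact (Suc (m - i - j))) = r (Suc b) * c i j (m - i - j)"
      by (simp add: f_def c_def mult_ac)
    then show ?thesis
      using has_integral_mult_right[OF integral_Beta_nat[of "m - b - j" "b - i"], of "f b j i"] by (simp only: ab)
  qed
  then have "((\<lambda>s. \<Sum>t\<in>?S. (case t of (b, j, i) \<Rightarrow> f b j i * (s ^ (m - b - j) * (1 - s) ^ (b - i)))) has_integral
     (\<Sum>t\<in>?S. (case t of (b, j, i) \<Rightarrow> r (Suc b) * c i j (m - i - j)))) {0..1}"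
    by (intro has_integral_sum) auto
  moreover have "(\<Sum>t\<in>?S. (case t of (b, j, i) \<Rightarrow> f b j i * (s ^ (m - b - j) * (1 - s) ^ (b - i)))) = bernstein_sum m r (p + d * s)" for s
  proof -
    have "1 - (p + d * s) = e + d * (1 - s)" using assms by (simp add: algebra_simps)
    then have "bernstein_sum m r (p + d * s) = (\<Sum>b\<le>m. real (m choose b) * (p + d * s) ^ (m - b) * (e + d * (1 - s)) ^ b * r (Suc b))"
      by (simp only: bernstein_sum_def)
    also have "\<dots> = (\<Sum>b\<le>m. \<Sum>j\<le>m - b. \<Sum>i\<le>b. f b j i * (s ^ (m - b - j) * (1 - s) ^ (b - i)))"
    proof (rule sum.cong[OF refl])
      fix b assume b: "b \<in> {..m}"
      have "real (m choose b) * (p + d * s) ^ (m - b) * (e + d * (1 - s)) ^ b * r (Suc b)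
        = (\<Sum>j\<le>m - b. \<Sum>i\<le>b. real (m choose b) * r (Suc b) * ((real ((m - b) choose j) * p ^ j * (d * s) ^ (m - b - j)) * (real (b choose i) * e ^ i * (d * (1 - s)) ^ (b - i))))"
        by (simp add: binomial_ring[of p] binomial_ring[of e] sum_product sum_distrib_left mult_ac)
      also have "\<dots> = (\<Sum>j\<le>m - b. \<Sum>i\<le>b. f b j i * (s ^ (m - b - j) * (1 - s) ^ (b - i)))"
      proof (intro sum.cong refl)
        fix j i assume "j \<in> {..m - b}" "i \<in> {..b}"
        then have "m - i - j = (m - b - j) + (b - i)" using b by auto
        then have "d ^ (m - i - j) = d ^ (m - b - j) * d ^ (b - i)" by (simp only: power_add)
        then show "real (m choose b) * r (Suc b) * ((real ((m - b) choose j) * p ^ j * (d * s) ^ (m - b - j)) * (real (b choose i) * e ^ i * (d * (1 - s)) ^ (b - i)))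
          = f b j i * (s ^ (m - b - j) * (1 - s) ^ (b - i))"
          by (simp add: f_def power_mult_distrib mult_ac)
      qed
      finally show "real (m choose b) * (p + d * s) ^ (m - b) * (e + d * (1 - s)) ^ b * r (Suc b)
        = (\<Sum>j\<le>m - b. \<Sum>i\<le>b. f b j i * (s ^ (m - b - j) * (1 - s) ^ (b - i)))" .
    qed
    also have "\<dots> = (\<Sum>b\<le>m. \<Sum>t\<in>{..m - b} \<times> {..b}. (case t of (j, i) \<Rightarrow> f b j i * (s ^ (m - b - j) * (1 - s) ^ (b - i))))"
      by (simp add: sum.cartesian_product)
    also have "\<dots> = (\<Sum>t\<in>?S. (case t of (b, j, i) \<Rightarrow> f b j i * (s ^ (m - b - j) * (1 - s) ^ (b - i))))"
      by (subst sum.Sigma) (auto simp: case_prod_beta')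
    finally show ?thesis by simp
  qed
  ultimately show ?thesis by (simp only: eq)
qed

definition n_reward :: "nat \<Rightarrow> (nat \<Rightarrow> real) \<Rightarrow> real \<Rightarrow> real" where
  "n_reward n r \<rho> = bernstein_sum (n - 1) r (1 - \<rho>)"

lemma n_player_payoff_eq:
  assumes "real_distribution F"
  shows "n_player_payoff n r F x = mean_field_payoff (n_reward n r) F x"
proof -
  interpret real_distribution F by fact
  let ?p = "cdf_left F x" and ?q = "cdf F x"
  let ?B = "bernstein_sum (n - 1) r"
  have eq: "((\<lambda>s. ?B (?p + (?q - ?p) * s)) has_integral n_player_payoff n r F x) {0..1}"
    unfolding n_player_payoff_def by (rule integral_bernstein_sum) simp
  show ?thesis
  proof (cases "?q = ?p")
    case True
    have "((\<lambda>s::real. ?B ?p) has_integral ?B ?p) {0..1}" using has_integral_const_real[of "?B ?p" 0 1] by simp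
    with eq True have "n_player_payoff n r F x = ?B ?p" by (simp add: has_integral_unique)
    then show ?thesis using True by (simp add: mean_field_payoff_def n_reward_def)
  next
    case False
    then have d: "0 < ?q - ?p" using cdf_left_bounds(2)[of x] by simp
    have "?B integrable_on {?p..?q}" by (intro integrable_continuous_real continuous_intros)
    then have "(?B has_integral integral {?p..?q} ?B) (cbox ?p ?q)" by (simp add: has_integral_integral)
    from has_integral_affinity'[OF this d, of ?p]
    have "((\<lambda>s. ?B (?p + (?q - ?p) * s)) has_integral integral {?p..?q} ?B / (?q - ?p)) {0..1}"
      using d by (simp add: add.commute divide_inverse mult.commute)
    with eq have "n_player_payoff n r F x = integral {?p..?q} ?B / (?q - ?p)" by (rule has_integral_unique)
    then show ?thesis using False by (simp add: mean_field_payoff_def n_reward_def)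
  qed
qed

lemma reward_function_n_reward:
  assumes n: "1 \<le> n" and nonneg: "\<And>i. 1 \<le> i \<Longrightarrow> i \<le> n \<Longrightarrow> 0 \<le> r i"
    and dec: "\<And>i. 1 \<le> i \<Longrightarrow> i < n \<Longrightarrow> r (Suc i) \<le> r i" and less: "r n < r 1"
  shows "reward_function (n_reward n r)"
  unfolding reward_function_def
proof (intro conjI ballI)
  have cont: "continuous_on UNIV (n_reward n r)" unfolding n_reward_def by (intro continuous_intros)
  then have isC: "isCont (n_reward n r) \<rho>" for \<rho> by (simp add: continuous_on_eq_continuous_at)
  show "continuous (at_right \<rho>) (n_reward n r)" for \<rho> using isC[of \<rho>] by (rule continuous_at_imp_continuous_at_within)
  show "(n_reward n r \<longlongrightarrow> n_reward n r 1) (at_left 1)"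
    using continuous_at_imp_continuous_at_within[OF isC[of 1], of "{..<1}"] by (simp add: continuous_within)
  show "n_reward n r 1 < n_reward n r 0"
    using less n by (simp add: n_reward_def bernstein_sum_at_0 bernstein_sum_at_1)
  show "antimono_on {0..1} (n_reward n r)"
    using dec n by (intro monotone_onI) (auto simp: n_reward_def intro!: bernstein_sum_mono)
  fix \<rho> :: real assume "\<rho> \<in> {0..1}"
  then have "bernstein_sum (n - 1) (\<lambda>_. 0) (1 - \<rho>) \<le> n_reward n r \<rho>"
    unfolding n_reward_def using nonneg n by (intro bernstein_sum_antimono) auto
  then show "0 \<le> n_reward n r \<rho>" by (simp add: bernstein_sum_def)
qed

section \<open>Drifted Brownian motion as an abstract stopping problem\<close>

lemma (in drifted_brownian) attainable_two_point:
  assumes "0 \<le> a" "a \<le> x" "x \<le> b"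
  shows "\<exists>G\<in>attainable_laws M W \<mu> \<sigma> x. \<forall>f\<in>borel_measurable borel. (\<forall>y. 0 \<le> f y) \<longrightarrow>
      (\<integral>y. f y \<partial>G) = (natural_scale \<theta> b - natural_scale \<theta> x) / (natural_scale \<theta> b - natural_scale \<theta> a) * f a
        + (1 - (natural_scale \<theta> b - natural_scale \<theta> x) / (natural_scale \<theta> b - natural_scale \<theta> a)) * (f b :: real)"
proof -
  interpret U: prob_space uniform01 by (rule prob_space_uniform01)
  define w where "w = (natural_scale \<theta> b - natural_scale \<theta> x) / (natural_scale \<theta> b - natural_scale \<theta> a)"
  have w: "0 \<le> w" "w \<le> 1"
    using assms by (auto simp: w_def divide_le_eq_1)
  obtain G where G: "G \<in> attainable_laws M W \<mu> \<sigma> x" "\<And>\<phi>. \<phi> \<in> borel_measurable borel \<Longrightarrow>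
      (\<integral>\<^sup>+y. \<phi> y \<partial>G) = (\<integral>\<^sup>+v. ennreal w * \<phi> a + ennreal (1 - w) * \<phi> b \<partial>uniform01)"
    using attainable_exit[of "\<lambda>_. a" "\<lambda>_. b"] assms unfolding w_def by auto
  interpret G: real_distribution G using assms by (intro attainable_distribution(1)[OF _ G(1)]) simp
  have "(\<integral>y. f y \<partial>G) = w * f a + (1 - w) * f b" if [measurable]: "f \<in> borel_measurable borel" and f: "\<And>y. 0 \<le> f y" for f :: "real \<Rightarrow> real"
  proof -
    have "(\<integral>\<^sup>+y. ennreal (f y) \<partial>G) = ennreal w * ennreal (f a) + ennreal (1 - w) * ennreal (f b)"
      using U.emeasure_space_1 by (subst G(2)) auto
    also have "\<dots> = ennreal (w * f a + (1 - w) * f b)"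
      using w f by (simp add: ennreal_mult[symmetric] flip: ennreal_plus)
    finally have "(\<integral>\<^sup>+y. ennreal (f y) \<partial>G) = ennreal (w * f a + (1 - w) * f b)" .
    moreover have "(\<integral>y. f y \<partial>G) = enn2real (\<integral>\<^sup>+y. ennreal (f y) \<partial>G)"
      using f by (intro integral_eq_nn_integral) auto
    moreover have "0 \<le> w * f a + (1 - w) * f b" using w f by simp
    ultimately show ?thesis by (simp only: enn2real_ennreal)
  qed
  then show ?thesis using G(1) unfolding w_def[symmetric] by blast
qed

definition normalized_scale :: "real \<Rightarrow> real \<Rightarrow> real \<Rightarrow> real" where
  "normalized_scale \<theta> x0 x = natural_scale \<theta> x / natural_scale \<theta> x0"

text \<open>Division by a positive constant changes no exit probability, so the properties of the
  scale pass to its normalization. For \<open>L_embed\<close> the matched intervals around 1 are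
  carried back by the inverse of the normalized scale.\<close>

lemma drifted_stopping_problem:
  assumes bm: "brownian_motion M W" and x0: "0 < x0" and \<sigma>: "0 < \<sigma>" and \<theta>: "\<theta> = 2 * \<mu> / \<sigma>\<^sup>2"
  shows "stopping_problem (normalized_scale \<theta> x0) (attainable_laws M W \<mu> \<sigma>) x0"
proof -
  let ?h = "normalized_scale \<theta> x0" and ?s = "natural_scale \<theta>"
  interpret prob_space M using bm by (simp add: brownian_motion_def)
  interpret B: drifted_brownian M W \<mu> \<sigma> x \<theta> for x
    using bm \<sigma> \<theta> by unfold_locales
  have s0: "0 < ?s x0" using natural_scale_less_iff[of \<theta> 0 x0] x0 by (simp del: natural_scale_less_iff)
  have h_less: "?h x < ?h y \<longleftrightarrow> x < y" and h_le: "?h x \<le> ?h y \<longleftrightarrow> x \<le> y" for x y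
    using s0 by (auto simp: normalized_scale_def divide_less_cancel divide_le_cancel)
  have h_0: "?h 0 = 0" and h_x0: "?h x0 = 1" using s0 by (auto simp: normalized_scale_def)
  have h_cont: "continuous_on A ?h" for A
    unfolding normalized_scale_def using s0 by (intro continuous_intros) auto
  have ratio: "(?h b - ?h x) / (?h b - ?h a) = (?s b - ?s x) / (?s b - ?s a)" for a b x
    using s0 by (simp add: normalized_scale_def diff_divide_distrib[symmetric])
  have nn_h: "(\<integral>\<^sup>+y. ennreal (?h y) \<partial>G) = ennreal (1 / ?s x0) * (\<integral>\<^sup>+y. ennreal (?s y) \<partial>G)"
    if "0 \<le> x" "G \<in> attainable_laws M W \<mu> \<sigma> x" for x G
  proof -
    interpret G: real_distribution G by (rule B.attainable_distribution(1)[OF that])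
    have "(\<integral>\<^sup>+y. ennreal (?h y) \<partial>G) = (\<integral>\<^sup>+y. ennreal (1 / ?s x0) * ennreal (?s y) \<partial>G)"
    proof (rule nn_integral_cong_AE)
      show "AE y in G. ennreal (?h y) = ennreal (1 / ?s x0) * ennreal (?s y)"
        using B.attainable_distribution(2)[OF that]
      proof eventually_elim
        case (elim y)
        then show ?case using s0 natural_scale_nonneg[of y \<theta>] by (simp add: normalized_scale_def ennreal_mult[symmetric])
      qed
    qed
    also have "\<dots> = ennreal (1 / ?s x0) * (\<integral>\<^sup>+y. ennreal (?s y) \<partial>G)" by (rule nn_integral_cmult) measurable
    finally show ?thesis .
  qed
  have mult_h: "ennreal (1 / ?s x0) * ennreal (?s x) = ennreal (?h x)" if "0 \<le> x" for x
    using s0 natural_scale_nonneg[OF that, of \<theta>] by (simp add: normalized_scale_def ennreal_mult[symmetric])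
  show ?thesis
  proof (rule stopping_problem.intro)
    show "0 < x0" by (rule x0)
    show "strict_mono ?h" by (rule strict_monoI) (simp add: h_less)
    show "continuous_on UNIV ?h" by (rule h_cont)
    show "?h 0 = 0" "?h x0 = 1" by (rule h_0 h_x0)+
    show "real_distribution G" if "0 \<le> x" "G \<in> attainable_laws M W \<mu> \<sigma> x" for x G
      by (rule B.attainable_distribution(1)[OF that])
    show "AE y in G. 0 \<le> y" if "0 \<le> x" "G \<in> attainable_laws M W \<mu> \<sigma> x" for x G
      by (rule B.attainable_distribution(2)[OF that])
    show "(\<integral>\<^sup>+y. ennreal (?h y) \<partial>G) \<le> ennreal (?h x)" if "0 \<le> x" "G \<in> attainable_laws M W \<mu> \<sigma> x" for x G
      unfolding nn_h[OF that] mult_h[OF that(1), symmetric]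
      by (intro mult_left_mono B.attainable_scale_le that) simp
    show "(\<forall>G\<in>attainable_laws M W \<mu> \<sigma> x0. (\<integral>\<^sup>+y. ennreal (?h y) \<partial>G) = 1) \<or>
      (\<forall>a. 0 \<le> a \<longrightarrow> a \<le> x0 \<longrightarrow> return borel a \<in> attainable_laws M W \<mu> \<sigma> x0)"
    proof (cases "\<theta> > 0")
      case True
      have "(\<integral>\<^sup>+y. ennreal (?h y) \<partial>G) = 1" if "G \<in> attainable_laws M W \<mu> \<sigma> x0" for G
        using nn_h[OF _ that] B.attainable_scale_eq[OF _ that True] mult_h[of x0] x0 h_x0 by simp
      then show ?thesis by blast
    next
      case False
      then have "return borel a \<in> attainable_laws M W \<mu> \<sigma> x0" if "0 \<le> a" "a \<le> x0" for a
        using that by (intro B.attainable_lower) auto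
      then show ?thesis by blast
    qed
    show "\<exists>G\<in>attainable_laws M W \<mu> \<sigma> x. \<forall>f\<in>borel_measurable borel. (\<forall>y. 0 \<le> f y) \<longrightarrow>
        (\<integral>y. f y \<partial>G) = (?h b - ?h x) / (?h b - ?h a) * f a + (1 - (?h b - ?h x) / (?h b - ?h a)) * (f b :: real)"
      if "0 \<le> a" "a \<le> x" "x \<le> b" for x a b
      unfolding ratio by (rule B.attainable_two_point[OF that])
    fix \<psi> :: "real \<Rightarrow> real" and K :: real
    assume \<psi>: "mono \<psi>" "\<And>v. 0 \<le> \<psi> v" "\<And>v. \<psi> v \<le> ?h K" "(\<integral>v. \<psi> v \<partial>uniform01) = 1"
    interpret P: mono_profile \<psi> "?h K" by unfold_locales (fact \<psi>)+
    have K0: "0 \<le> K" using order_trans[OF \<psi>(2) \<psi>(3)] h_le[of 0 K] by (simp add: h_0)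
    have inj: "inj ?h" by (rule strict_mono_imp_inj_on) (rule strict_monoI, simp add: h_less)
    \<comment> \<open>Outside the range the inverse is arbitrary; clamping its argument makes it
      monotone on the whole line, hence measurable.\<close>
    define H where "H y = inv ?h (max 0 (min (?h K) y))" for y
    have h_inv: "?h (inv ?h y) = y" if "0 \<le> y" "y \<le> ?h K" for y
    proof -
      have "\<exists>z\<ge>0. z \<le> K \<and> ?h z = y" using that K0 h_0 by (intro IVT' h_cont) auto
      then show ?thesis using inj by auto
    qed
    have h_H: "?h (H y) = max 0 (min (?h K) y)" for y
      unfolding H_def using K0 h_le[of 0 K] by (intro h_inv) (auto simp: h_0)
    have H_eq: "H y = inv ?h y" if "0 \<le> y" "y \<le> ?h K" for y using that by (simp add: H_def)
    have "mono H"
    proof (rule monoI)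
      fix y z :: real assume "y \<le> z"
      then have "?h (H y) \<le> ?h (H z)" unfolding h_H by auto
      then show "H y \<le> H z" by (simp only: h_le)
    qed
    then have H_meas[measurable]: "H \<in> borel_measurable borel" by (rule borel_measurable_mono)
    have hl: "?h (H (P.low v)) = P.low v" and hh: "?h (H (P.high v)) = P.high v" for v
      using P.low_bounds[of v] P.high_bounds[of v] by (auto simp: h_H)
    have bounds: "0 \<le> H (P.low v)" "H (P.low v) \<le> x0" "x0 \<le> H (P.high v)" for v
    proof -
      show "0 \<le> H (P.low v)" using P.low_bounds(1)[of v] by (subst h_le[symmetric]) (simp only: hl h_0)
      show "H (P.low v) \<le> x0" using P.low_bounds(2)[of v] by (subst h_le[symmetric]) (simp only: hl h_x0)
      show "x0 \<le> H (P.high v)" using P.high_bounds(1)[of v] by (subst h_le[symmetric]) (simp only: hh h_x0)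
    qed
    have m: "(\<lambda>v. H (P.low v)) \<in> borel_measurable borel" "(\<lambda>v. H (P.high v)) \<in> borel_measurable borel" by measurable
    obtain G where G: "G \<in> attainable_laws M W \<mu> \<sigma> x0" "\<And>\<phi>. \<phi> \<in> borel_measurable borel \<Longrightarrow> (\<integral>\<^sup>+y. \<phi> y \<partial>G) = (\<integral>\<^sup>+v.
      ennreal ((?s (H (P.high v)) - ?s x0) / (?s (H (P.high v)) - ?s (H (P.low v)))) * \<phi> (H (P.low v)) +
      ennreal (1 - (?s (H (P.high v)) - ?s x0) / (?s (H (P.high v)) - ?s (H (P.low v)))) * \<phi> (H (P.high v)) \<partial>uniform01)"
      using B.attainable_exit[OF bounds m] by blast
    interpret G: real_distribution G using x0 by (intro B.attainable_distribution(1)[OF _ G(1)]) simp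
    have "G = distr uniform01 borel (\<lambda>v. inv ?h (\<psi> v))"
    proof (rule measure_eqI)
      fix S assume "S \<in> sets G"
      then have S[measurable]: "S \<in> sets borel" by simp
      have T: "H -` S \<in> sets borel" using measurable_sets[OF H_meas S] by simp
      have "emeasure G S = (\<integral>\<^sup>+y. indicator S y \<partial>G)" by simp
      also have "\<dots> = (\<integral>\<^sup>+v. ennreal ((P.high v - 1) / (P.high v - P.low v)) * indicator (H -` S) (P.low v)
          + ennreal (1 - (P.high v - 1) / (P.high v - P.low v)) * indicator (H -` S) (P.high v) \<partial>uniform01)"
        by (subst G(2)) (simp_all add: ratio[symmetric] hl hh h_x0 indicator_def)
      also have "\<dots> = (\<integral>\<^sup>+v. indicator (H -` S) (\<psi> v) \<partial>uniform01)" by (rule P.matching[OF T])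
      also have "\<dots> = (\<integral>\<^sup>+v. indicator S (inv ?h (\<psi> v)) \<partial>uniform01)"
        using H_eq[OF \<psi>(2) \<psi>(3)] by (intro nn_integral_cong) (simp add: indicator_def)
      also have "\<dots> = emeasure (distr uniform01 borel (\<lambda>v. inv ?h (\<psi> v))) S"
      proof -
        have "(\<lambda>v. inv ?h (\<psi> v)) = (\<lambda>v. H (\<psi> v))" using H_eq[OF \<psi>(2) \<psi>(3)] by auto
        then have [measurable]: "(\<lambda>v. inv ?h (\<psi> v)) \<in> borel_measurable borel" by simp
        show ?thesis by (subst nn_integral_indicator[symmetric, of S], simp, subst nn_integral_distr) auto
      qed
      finally show "emeasure G S = emeasure (distr uniform01 borel (\<lambda>v. inv ?h (\<psi> v))) S" .
    qed simp
    then show "distr uniform01 borel (\<lambda>v. inv ?h (\<psi> v)) \<in> attainable_laws M W \<mu> \<sigma> x0" using G(1) by simp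
  qed
qed

text \<open>For \<theta> > 0 the supremum of the normalized scale is 1 / (1 - exp (- \<theta> x0)),
  and the drift condition puts the cap below it; for \<theta> <= 0 the scale is unbounded.\<close>

lemma (in reward) normalized_scale_exceeds:
  assumes x0: "0 < x0" and \<sigma>: "0 < \<sigma>" and \<theta>: "\<theta> = 2 * \<mu> / \<sigma>\<^sup>2" and \<mu>: "\<mu> < critical_drift R \<sigma> x0"
  obtains B where "(R0 - R1) / (Rbar - R1) < normalized_scale \<theta> x0 B"
proof -
  let ?c = "(R0 - R1) / (Rbar - R1)"
  have s0: "0 < natural_scale \<theta> x0" using natural_scale_less_iff[of \<theta> 0 x0] x0 by (simp del: natural_scale_less_iff)
  have c: "0 < ?c" using R1_less_Rbar R1_less_R0 by simp
  have "\<exists>B. ?c * natural_scale \<theta> x0 < natural_scale \<theta> B"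
  proof (cases "\<theta> > 0")
    case True
    have "\<theta> * x0 < ln ((R0 - R1) / (R0 - Rbar))"
    proof -
      have "\<mu> * (2 * x0 / \<sigma>\<^sup>2) < (\<sigma>\<^sup>2 / (2 * x0) * ln ((R0 - R1) / (R0 - Rbar))) * (2 * x0 / \<sigma>\<^sup>2)"
        using \<mu> x0 \<sigma> by (intro mult_strict_right_mono) (auto simp: critical_drift_def Rbar_def)
      then show ?thesis using x0 \<sigma> by (simp add: \<theta> mult_ac)
    qed
    moreover have q: "0 < (R0 - R1) / (R0 - Rbar)" using Rbar_less_R0 R1_less_R0 by simp
    ultimately have "exp (\<theta> * x0) < (R0 - R1) / (R0 - Rbar)" by (metis exp_less_cancel_iff exp_ln)
    then have "(R0 - Rbar) < (R0 - R1) * exp (- (\<theta> * x0))"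
      using Rbar_less_R0 by (simp add: exp_minus field_simps)
    then have "(R0 - R1) * (1 - exp (- (\<theta> * x0))) < Rbar - R1" by (simp add: algebra_simps)
    then have lt: "?c * (1 - exp (- (\<theta> * x0))) < 1" using R1_less_Rbar by (simp add: divide_less_eq)
    \<comment> \<open>Half of the gap that the drift condition leaves; the level - ln e / \<theta>
      is the one at which exp (- \<theta> B) equals e.\<close>
    define e where "e = (1 - ?c * (1 - exp (- (\<theta> * x0)))) / 2"
    have "0 < (1 - t) / 2 \<and> t < 1 - (1 - t) / 2" if "t < 1" for t :: real
      using that by (simp add: field_simps)
    from this[OF lt] have e: "0 < e" "?c * (1 - exp (- (\<theta> * x0))) < 1 - e" unfolding e_def by blast+
    have "exp (- \<theta> * (- ln e / \<theta>)) = e" using True e by simp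
    then have "natural_scale \<theta> (- ln e / \<theta>) = (1 - e) / \<theta>" using True unfolding natural_scale_def by simp
    moreover have "?c * natural_scale \<theta> x0 = (?c * (1 - exp (- (\<theta> * x0)))) / \<theta>" using True by (simp add: natural_scale_def)
    ultimately have "?c * natural_scale \<theta> x0 < natural_scale \<theta> (- ln e / \<theta>)"
      using e(2) True by (simp only: divide_strict_right_mono)
    then show ?thesis by blast
  next
    case False
    have ge: "b \<le> natural_scale \<theta> b" if "0 \<le> b" for b
    proof (cases "\<theta> = 0")
      case nz: False
      have "1 + - \<theta> * b \<le> exp (- \<theta> * b)" by (rule exp_ge_add_one_self)
      then show ?thesis using False nz by (simp add: natural_scale_def neg_le_divide_eq mult.commute)
    qed (simp add: natural_scale_def)
    have "0 \<le> ?c * natural_scale \<theta> x0 + 1" using c s0 by (intro add_nonneg_nonneg mult_nonneg_nonneg) auto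
    from ge[OF this] show ?thesis by (intro exI[of _ "?c * natural_scale \<theta> x0 + 1"]) linarith
  qed
  then obtain B where "?c * natural_scale \<theta> x0 < natural_scale \<theta> B" by blast
  then have "?c < normalized_scale \<theta> x0 B" using s0 by (simp add: normalized_scale_def less_divide_eq)
  then show ?thesis by (rule that)
qed

section \<open>Convergence of the sampled games\<close>

text \<open>Binomial variance plus a squared bias (1 - x)^2, both on the scale of m + 1. The bias
  comes from sampling at (i + 1) / (m + 1), the relative rank of a player with i opponents
  ahead.\<close>

lemma bernstein_sum_second_moment:
  assumes x: "0 \<le> x" "x \<le> 1"
  shows "(\<Sum>i\<le>m. Bernstein m i x * ((real i + 1) / (real m + 1) - x)\<^sup>2) \<le> 1 / (real m + 1)"
proof -
  have "(\<Sum>i\<le>m. Bernstein m i x * (real i + 1 - (real m + 1) * x)\<^sup>2)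
    = (\<Sum>i\<le>m. real i * (real i - 1) * Bernstein m i x) + (3 - 2 * (real m + 1) * x) * (\<Sum>i\<le>m. real i * Bernstein m i x)
      + (1 - (real m + 1) * x)\<^sup>2 * (\<Sum>i\<le>m. Bernstein m i x)"
    unfolding sum_distrib_left sum.distrib[symmetric]
    by (intro sum.cong refl) (simp add: power2_eq_square algebra_simps)
  also have "\<dots> = real m * (x * (1 - x)) + (1 - x)\<^sup>2"
    by (simp only: sum_k_Bernstein sum_kk_Bernstein sum_Bernstein) (simp add: power2_eq_square algebra_simps)
  also have "\<dots> \<le> real m * 1 + 1"
  proof (intro add_mono mult_left_mono)
    have "x * (1 - x) \<le> 1 * 1" using x by (intro mult_mono) auto
    then show "x * (1 - x) \<le> 1" by simp
    show "(1 - x)\<^sup>2 \<le> 1" using x by (simp add: power_le_one)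
  qed auto
  finally have le: "(\<Sum>i\<le>m. Bernstein m i x * (real i + 1 - (real m + 1) * x)\<^sup>2) \<le> real m + 1" by simp
  have "(\<Sum>i\<le>m. Bernstein m i x * ((real i + 1) / (real m + 1) - x)\<^sup>2)
    = (\<Sum>i\<le>m. Bernstein m i x * (real i + 1 - (real m + 1) * x)\<^sup>2) / (real m + 1)\<^sup>2"
    unfolding sum_divide_distrib
  proof (intro sum.cong refl)
    fix i
    have "(real i + 1) / (real m + 1) - x = (real i + 1 - (real m + 1) * x) / (real m + 1)" by (simp add: field_simps)
    then show "Bernstein m i x * ((real i + 1) / (real m + 1) - x)\<^sup>2 = Bernstein m i x * (real i + 1 - (real m + 1) * x)\<^sup>2 / (real m + 1)\<^sup>2"
      by (simp add: power_divide)
  qed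
  also have "\<dots> \<le> (real m + 1) / (real m + 1)\<^sup>2" using le by (intro divide_right_mono) auto
  also have "\<dots> = 1 / (real m + 1)" by (simp add: power2_eq_square)
  finally show ?thesis .
qed

lemma bernstein_sum_Bernstein:
  "bernstein_sum m r y = (\<Sum>i\<le>m. Bernstein m i (1 - y) * r (Suc i))"
  by (simp add: bernstein_sum_def Bernstein_def mult_ac)

section \<open>Convergence of the sampled rewards\<close>

context reward
begin

lemma sampled_bounds: "1 \<le> i \<Longrightarrow> i \<le> Suc (n - 1) \<Longrightarrow> R1 \<le> sampled_rewards R n i \<and> sampled_rewards R n i \<le> R0"
  unfolding sampled_rewards_def by (intro conjI R_decreasing) (cases n; auto simp: divide_le_eq_1)+

lemma n_reward_tendsto:
  assumes y: "0 < y" "y < 1" and cont: "isCont g y"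
  shows "(\<lambda>n. bernstein_sum (n - 1) (sampled_rewards R n) y) \<longlonglongrightarrow> g y"
proof (rule LIMSEQ_I)
  fix \<epsilon> :: real assume \<epsilon>: "0 < \<epsilon>"
  then have "0 < \<epsilon> / 2" by simp
  then obtain d where d: "0 < d" "\<And>z. dist z y < d \<Longrightarrow> dist (g z) (g y) < \<epsilon> / 2"
    using cont unfolding continuous_at_eps_delta dist_real_def by blast
  let ?x = "1 - y"
  have R0: "0 \<le> R0" using R1_nonneg R1_less_R0 by simp
  obtain N :: nat where N: "2 * R0 / (d\<^sup>2 * \<epsilon>) < real N" using reals_Archimedean2 by blast
  \<comment> \<open>Chebyshev in pointwise form: at distance d or more the trivial bound R0 is paid
    for by the squared distance over d^2.\<close>
  have pt: "\<bar>R r - g y\<bar> \<le> \<epsilon> / 2 + R0 / d\<^sup>2 * (r - ?x)\<^sup>2" if r: "0 \<le> r" "r \<le> 1" for r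
  proof (cases "\<bar>r - ?x\<bar> < d")
    case True
    then have "dist (1 - r) y < d" by (simp add: dist_real_def abs_minus_commute algebra_simps)
    then have "\<bar>R r - g y\<bar> < \<epsilon> / 2" using d(2)[of "1 - r"] r by (simp add: dist_real_def g_eq)
    then show ?thesis using R0 by (intro order_trans[OF less_imp_le add_increasing2[OF _ order_refl]]) auto
  next
    case False
    have "\<bar>R r - g y\<bar> \<le> R0" using g_bounds[of "1 - r"] g_bounds[of y] R1_nonneg r by (simp add: g_eq abs_le_iff)
    also have "\<dots> = R0 / d\<^sup>2 * d\<^sup>2" using d by simp
    also have "\<dots> \<le> R0 / d\<^sup>2 * (r - ?x)\<^sup>2"
    proof (rule mult_left_mono)
      have "d\<^sup>2 \<le> \<bar>r - ?x\<bar>\<^sup>2" using False d by (intro power_mono) auto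
      then show "d\<^sup>2 \<le> (r - ?x)\<^sup>2" by simp
    qed (use R0 in simp)
    finally show ?thesis using \<epsilon> by simp
  qed
  show "\<exists>no. \<forall>n\<ge>no. norm (bernstein_sum (n - 1) (sampled_rewards R n) y - g y) < \<epsilon>"
  proof (intro exI allI impI)
    fix n assume n: "Suc N \<le> n"
    obtain m where m: "n = Suc m" using n by (cases n) auto
    have nn: "0 \<le> Bernstein m i ?x" for i using y by (intro Bernstein_nonneg) auto
    have "bernstein_sum (n - 1) (sampled_rewards R n) y - g y
      = (\<Sum>i\<le>m. Bernstein m i ?x * R ((real i + 1) / (real m + 1))) - (\<Sum>i\<le>m. Bernstein m i ?x) * g y"
      by (simp add: bernstein_sum_Bernstein m sampled_rewards_def add.commute)
    also have "\<dots> = (\<Sum>i\<le>m. Bernstein m i ?x * (R ((real i + 1) / (real m + 1)) - g y))"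
      by (simp only: sum_distrib_right sum_subtractf[symmetric] right_diff_distrib)
    finally have "norm (bernstein_sum (n - 1) (sampled_rewards R n) y - g y)
      \<le> (\<Sum>i\<le>m. \<bar>Bernstein m i ?x * (R ((real i + 1) / (real m + 1)) - g y)\<bar>)"
      by (simp only: real_norm_def sum_abs)
    also have "\<dots> \<le> (\<Sum>i\<le>m. Bernstein m i ?x * (\<epsilon> / 2 + R0 / d\<^sup>2 * ((real i + 1) / (real m + 1) - ?x)\<^sup>2))"
    proof (rule sum_mono)
      fix i assume "i \<in> {..m}"
      then have "\<bar>R ((real i + 1) / (real m + 1)) - g y\<bar> \<le> \<epsilon> / 2 + R0 / d\<^sup>2 * ((real i + 1) / (real m + 1) - ?x)\<^sup>2"
        by (intro pt) auto
      then show "\<bar>Bernstein m i ?x * (R ((real i + 1) / (real m + 1)) - g y)\<bar>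
          \<le> Bernstein m i ?x * (\<epsilon> / 2 + R0 / d\<^sup>2 * ((real i + 1) / (real m + 1) - ?x)\<^sup>2)"
        using nn[of i] by (simp only: abs_mult abs_of_nonneg mult_left_mono)
    qed
    also have "\<dots> = \<epsilon> / 2 * (\<Sum>i\<le>m. Bernstein m i ?x) + R0 / d\<^sup>2 * (\<Sum>i\<le>m. Bernstein m i ?x * ((real i + 1) / (real m + 1) - ?x)\<^sup>2)"
      by (simp only: sum_distrib_left distrib_left sum.distrib mult_ac)
    also have "\<dots> \<le> \<epsilon> / 2 + R0 / d\<^sup>2 * (1 / (real m + 1))"
      using R0 y by (intro add_mono mult_left_mono bernstein_sum_second_moment) auto
    also have "\<dots> < \<epsilon> / 2 + \<epsilon> / 2"
    proof (rule add_strict_left_mono)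
      have "2 * R0 / (d\<^sup>2 * \<epsilon>) < real m + 1" using N n m by simp
      then have "2 * R0 < (real m + 1) * (d\<^sup>2 * \<epsilon>)" using d \<epsilon> by (simp add: divide_less_eq)
      moreover have "0 < d\<^sup>2 * (real m + 1)" using d by simp
      ultimately have "R0 / (d\<^sup>2 * (real m + 1)) < \<epsilon> / 2" by (simp add: divide_less_eq algebra_simps)
      then show "R0 / d\<^sup>2 * (1 / (real m + 1)) < \<epsilon> / 2" by simp
    qed
    finally show "norm (bernstein_sum (n - 1) (sampled_rewards R n) y - g y) < \<epsilon>" by simp
  qed
qed

lemma sampled_first_tendsto: "(\<lambda>n. sampled_rewards R n 1) \<longlonglongrightarrow> R0"
proof -
  have "(R \<longlongrightarrow> R 0) (at_right 0)" using R by (auto simp: reward_function_def continuous_within)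
  moreover have "filterlim (\<lambda>n. 1 / real n) (at_right 0) sequentially"
    unfolding filterlim_at using eventually_gt_at_top[of "0::nat"] lim_1_over_n
    by (auto elim!: eventually_mono)
  ultimately show ?thesis unfolding sampled_rewards_def by (auto dest: filterlim_compose)
qed

end

text \<open>Continuity of the cdf at \<open>x\<close> means that the limit variable avoids
  \<open>x\<close> almost surely, and away from \<open>x\<close> the indicators are eventually
  constant.\<close>

lemma cdf_tendsto_of_AE:
  fixes Q :: "nat \<Rightarrow> real \<Rightarrow> real" and Q' :: "real \<Rightarrow> real"
  assumes [measurable]: "\<And>n. Q n \<in> borel_measurable borel" "Q' \<in> borel_measurable borel"
    and lim: "AE u in uniform01. (\<lambda>n. Q n u) \<longlonglongrightarrow> Q' u"
    and cont: "isCont (cdf (distr uniform01 borel Q')) x"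
  shows "(\<lambda>n. cdf (distr uniform01 borel (Q n)) x) \<longlonglongrightarrow> cdf (distr uniform01 borel Q') x"
proof -
  interpret U: prob_space uniform01 by (rule prob_space_uniform01)
  have Q'm: "Q' \<in> measurable uniform01 borel" by measurable
  interpret D: real_distribution "distr uniform01 borel Q'"
    using U.prob_space_distr[OF Q'm] by (simp add: real_distribution_def real_distribution_axioms_def)
  have cdf_eq: "cdf (distr uniform01 borel f) x = (\<integral>u. indicator {..x} (f u) \<partial>uniform01)"
    if [measurable]: "f \<in> borel_measurable borel" for f
  proof -
    have fm: "f \<in> measurable uniform01 borel" by measurable
    have "cdf (distr uniform01 borel f) x = (\<integral>y. indicator {..x} y \<partial>distr uniform01 borel f)"
      unfolding cdf_def by simp
    also have "\<dots> = (\<integral>u. indicator {..x} (f u) \<partial>uniform01)" by (rule integral_distr[OF fm]) measurable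
    finally show ?thesis .
  qed
  have "measure (distr uniform01 borel Q') {x} = 0" using cont by (simp only: D.isCont_cdf)
  then have "AE y in distr uniform01 borel Q'. y \<notin> {x}" by (subst D.prob_eq_0[symmetric]) simp_all
  then have ne: "AE u in uniform01. Q' u \<noteq> x" using Q'm by (subst (asm) AE_distr_iff) auto
  have "(\<lambda>n. \<integral>u. indicator {..x} (Q n u) \<partial>uniform01) \<longlonglongrightarrow> (\<integral>u. (indicator {..x} (Q' u) :: real) \<partial>uniform01)"
  proof (rule integral_dominated_convergence[where w="\<lambda>_. 1"])
    show "AE u in uniform01. (\<lambda>n. indicator {..x} (Q n u)) \<longlonglongrightarrow> (indicator {..x} (Q' u) :: real)"
      using lim ne
    proof eventually_elim
      case (elim u)
      consider "Q' u < x" | "x < Q' u" using elim by linarith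
      then have "\<forall>\<^sub>F n in sequentially. indicator {..x} (Q n u) = (indicator {..x} (Q' u) :: real)"
      proof cases
        case 1
        from order_tendstoD(2)[OF elim(1) 1] show ?thesis by eventually_elim (use 1 in \<open>auto simp: indicator_def\<close>)
      next
        case 2
        from order_tendstoD(1)[OF elim(1) 2] show ?thesis by eventually_elim (use 2 in \<open>auto simp: indicator_def\<close>)
      qed
      then show ?case by (rule tendsto_eventually)
    qed
  qed (auto simp: indicator_def)
  then show ?thesis by (simp add: cdf_eq)
qed

lemma bernstein_sum_const: "bernstein_sum m (\<lambda>_. c) y = c"
  by (simp add: bernstein_sum_Bernstein flip: sum_distrib_right)

abbreviation sampled_game :: "(real \<Rightarrow> real) \<Rightarrow> nat \<Rightarrow> real \<Rightarrow> real" where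
  "sampled_game R n \<equiv> n_reward n (sampled_rewards R n)"

text \<open>Rewards matter on \<open>[0,1]\<close> only. Clamping makes the reflected reward function monotone on all reals.\<close>

definition clamped :: "(real \<Rightarrow> real) \<Rightarrow> real \<Rightarrow> real" where
  "clamped R u = R (1 - max 0 (min 1 u))"

text \<open>Stated for an arbitrary function rather than inside \<open>stopping_game\<close>, so
  that the sequence over n makes sense also for the n at which the sampled game is not a reward
  function.\<close>

definition game_quantile :: "(real \<Rightarrow> real) \<Rightarrow> (real \<Rightarrow> real) \<Rightarrow> real \<Rightarrow> real" where
  "game_quantile h R u = inv h ((clamped R u - R 1) / (integral {0..1} R - R 1))"

definition game_law :: "(real \<Rightarrow> real) \<Rightarrow> (real \<Rightarrow> real) \<Rightarrow> real measure" where
  "game_law h R = distr uniform01 borel (game_quantile h R)"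

definition game_value :: "(real \<Rightarrow> real) \<Rightarrow> (real \<Rightarrow> real) \<Rightarrow> real \<Rightarrow> real" where
  "game_value h R x = min (R 1 + (integral {0..1} R - R 1) * h x) (R 0)"

context stopping_game
begin

lemma game_quantile_eq: "game_quantile h R = (\<lambda>u. inv h (\<psi> u))"
  by (auto simp: game_quantile_def clamped_def \<psi>_def g_def Rbar_def)

lemma game_quantile_meas: "game_quantile h R \<in> borel_measurable borel"
  unfolding game_quantile_eq by (rule quant_meas)

lemma h_game_quantile: "h (game_quantile h R u) = (clamped R u - R 1) / (integral {0..1} R - R 1)"
  unfolding game_quantile_eq h_quant by (simp add: \<psi>_def g_def Rbar_def clamped_def)

lemma game_law_eq: "game_law h R = eq_law"
  by (simp add: game_law_def eq_law_def game_quantile_eq)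

lemma game_value_eq: "0 \<le> x \<Longrightarrow> optimal_value (L x) (mean_field_payoff R (game_law h R)) = game_value h R x"
  by (simp add: game_law_eq eq_law_value game_value_def line_def Rbar_def)

lemma game_equilibrium_iff: "equilibrium (L x0) (mean_field_payoff R) F \<longleftrightarrow> F = game_law h R"
  by (simp add: game_law_eq equilibrium_iff)

lemma game_law_distribution: "real_distribution (game_law h R)"
  unfolding game_law_eq by (rule eq_law_distribution)

end

context reward
begin

text \<open>Non-constancy is what can fail for small n; the best sampled reward R (1 / n) tends to R
  0 and eventually exceeds R 1.\<close>

lemma reward_function_sampled: "\<forall>\<^sub>F n in sequentially. reward_function (sampled_game R n)"
  using order_tendstoD(1)[OF sampled_first_tendsto R1_less_R0] eventually_ge_at_top[of 1]
proof eventually_elim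
  case (elim n)
  show ?case
  proof (rule reward_function_n_reward)
    show "0 \<le> sampled_rewards R n i" if "1 \<le> i" "i \<le> n" for i
      using sampled_bounds[of i n] R1_nonneg that by simp
    show "sampled_rewards R n (Suc i) \<le> sampled_rewards R n i" if "1 \<le> i" "i < n" for i
      unfolding sampled_rewards_def using that by (intro R_decreasing) (auto simp: divide_right_mono)
    show "sampled_rewards R n n < sampled_rewards R n 1" using elim by (simp add: sampled_rewards_def)
  qed (use elim in simp)
qed

lemma clamped_eq: "clamped R = g"
  by (auto simp: clamped_def g_def)

text \<open>The exceptional points are the discontinuities of the monotone g, which are countable,
  and the two endpoints.\<close>

lemma clamped_sampled_tendsto:
  "AE u in uniform01. (\<lambda>n. clamped (sampled_game R n) u) \<longlonglongrightarrow> clamped R u"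
proof -
  have "countable {u. \<not> isCont g u}" using g_mono by (rule mono_ctble_discont)
  then have null: "{u. \<not> isCont g u} \<in> null_sets lborel" by (rule countable_imp_null_set_lborel)
  have cont: "AE u in uniform01. isCont g u"
  proof (subst AE_uniform_measure)
    show "AE u in lborel. u \<in> {0..1} \<longrightarrow> isCont g u"
      by (rule AE_mp[OF AE_not_in[OF null]]) (rule AE_I2, simp)
  qed auto
  show ?thesis using cont AE_interior_uniform01
  proof eventually_elim
    case (elim u)
    have "clamped (sampled_game R n) u = bernstein_sum (n - 1) (sampled_rewards R n) u" for n
      using elim by (simp add: clamped_def n_reward_def)
    then show ?case using n_reward_tendsto[of u] elim by (simp add: clamped_eq)
  qed
qed

lemma clamped_sampled_bounds: "0 \<le> clamped (sampled_game R n) u" "clamped (sampled_game R n) u \<le> R0"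
proof -
  let ?y = "max 0 (min 1 u)"
  have "bernstein_sum (n - 1) (\<lambda>_. 0) ?y \<le> bernstein_sum (n - 1) (sampled_rewards R n) ?y"
    using sampled_bounds R1_nonneg by (intro bernstein_sum_antimono) (auto intro: order_trans)
  then show "0 \<le> clamped (sampled_game R n) u" by (simp add: clamped_def n_reward_def bernstein_sum_const)
  have "bernstein_sum (n - 1) (sampled_rewards R n) ?y \<le> bernstein_sum (n - 1) (\<lambda>_. R0) ?y"
    using sampled_bounds by (intro bernstein_sum_antimono) auto
  then show "clamped (sampled_game R n) u \<le> R0" by (simp add: clamped_def n_reward_def bernstein_sum_const)
qed

lemma mean_reward_tendsto: "(\<lambda>n. integral {0..1} (sampled_game R n)) \<longlonglongrightarrow> Rbar"
proof -
  interpret U: prob_space uniform01 by (rule prob_space_uniform01)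
  have [measurable]: "clamped (sampled_game R n) \<in> borel_measurable borel" for n
    unfolding clamped_def n_reward_def by (intro borel_measurable_continuous_onI continuous_intros)
  have "(\<lambda>n. \<integral>u. clamped (sampled_game R n) u \<partial>uniform01) \<longlonglongrightarrow> (\<integral>u. clamped R u \<partial>uniform01)"
  proof (rule integral_dominated_convergence[where w="\<lambda>_. R0"])
    show "AE u in uniform01. norm (clamped (sampled_game R n) u) \<le> R0" for n
      using clamped_sampled_bounds by (intro AE_I2) simp
    show "clamped R \<in> borel_measurable uniform01" unfolding clamped_eq by simp
  qed (auto intro: clamped_sampled_tendsto)
  then have lim: "(\<lambda>n. \<integral>u. clamped (sampled_game R n) u \<partial>uniform01) \<longlonglongrightarrow> Rbar"
    by (simp add: clamped_eq Rbar_eq)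
  have "\<forall>\<^sub>F n in sequentially. (\<integral>u. clamped (sampled_game R n) u \<partial>uniform01) = integral {0..1} (sampled_game R n)"
    using reward_function_sampled
  proof eventually_elim
    case (elim n)
    then interpret N: reward "sampled_game R n" by unfold_locales
    show ?case using N.Rbar_eq by (simp add: N.clamped_eq N.Rbar_def)
  qed
  with lim show ?thesis by (rule Lim_transform_eventually)
qed

lemma sampled_game_0: "sampled_game R n 0 = sampled_rewards R n 1"
  by (simp add: n_reward_def bernstein_sum_at_1)

lemma sampled_game_1: "1 \<le> n \<Longrightarrow> sampled_game R n 1 = R1"
  by (simp add: n_reward_def bernstein_sum_at_0 sampled_rewards_def)

lemma sampled_game_1_tendsto: "(\<lambda>n. sampled_game R n 1) \<longlonglongrightarrow> R1"
proof (rule tendsto_eventually)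
  show "\<forall>\<^sub>F n in sequentially. sampled_game R n 1 = R1"
    using eventually_ge_at_top[of 1] by eventually_elim (rule sampled_game_1)
qed

lemma sampled_game_0_tendsto: "(\<lambda>n. sampled_game R n 0) \<longlonglongrightarrow> R0"
  unfolding sampled_game_0 by (rule sampled_first_tendsto)

end

section \<open>Convergence of laws and values\<close>

lemma (in stopping_problem) stopping_gameI:
  assumes "reward_function R" "(R 0 - R 1) / (integral {0..1} R - R 1) < h B"
  shows "stopping_game h L x0 R"
proof -
  interpret reward R using assms(1) by unfold_locales
  have "0 \<le> (R 0 - R 1) / (integral {0..1} R - R 1)"
    using R1_less_Rbar R1_less_R0 by (simp add: Rbar_def)
  from h_inv[OF this less_imp_le[OF assms(2)]] show ?thesis
    by unfold_locales (auto simp: Rbar_def)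
qed

text \<open>The cap depends continuously on the best, the worst and the mean reward and lies
  strictly below \<open>h B\<close>, so the sampled games eventually obey the same bound. The value
  depends on the same three numbers; the quantiles depend on the worst and the mean reward and on
  the reflected reward at u.\<close>

lemma (in stopping_problem) limit_of_games:
  assumes R: "reward_function R" and B: "(R 0 - R 1) / (integral {0..1} R - R 1) < h B"
  shows "stopping_game h L x0 R"
    and "\<forall>\<^sub>F n in sequentially. stopping_game h L x0 (sampled_game R n)"
    and "weak_conv_m (\<lambda>n. game_law h (sampled_game R n)) (game_law h R)"
    and "compact K \<Longrightarrow> uniform_limit K (\<lambda>n. game_value h (sampled_game R n)) (game_value h R) sequentially"
proof -
  show G: "stopping_game h L x0 R" by (rule stopping_gameI[OF R B])
  then interpret G: stopping_game h L x0 R .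
  let ?Rn = "sampled_game R"
  have b: "(\<lambda>n. integral {0..1} (?Rn n)) \<longlonglongrightarrow> integral {0..1} R"
    using G.mean_reward_tendsto by (simp add: G.Rbar_def)
  have pos: "integral {0..1} R - R 1 \<noteq> 0" using G.R1_less_Rbar by (simp add: G.Rbar_def)
  have "(\<lambda>n. (?Rn n 0 - ?Rn n 1) / (integral {0..1} (?Rn n) - ?Rn n 1)) \<longlonglongrightarrow> (R 0 - R 1) / (integral {0..1} R - R 1)"
    using pos by (intro tendsto_intros G.sampled_game_0_tendsto G.sampled_game_1_tendsto b)
  from order_tendstoD(2)[OF this B] G.reward_function_sampled
  show ev: "\<forall>\<^sub>F n in sequentially. stopping_game h L x0 (?Rn n)"
    by eventually_elim (rule stopping_gameI)
  then obtain N where N: "\<And>n. N \<le> n \<Longrightarrow> stopping_game h L x0 (?Rn n)" by (auto simp: eventually_sequentially)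
  \<comment> \<open>Indices below \<open>N\<close> get the limit quantile, so that every member of
    the sequence is measurable.\<close>
  define Q where "Q n = (if N \<le> n then game_quantile h (?Rn n) else game_quantile h R)" for n
  have Qm: "Q n \<in> borel_measurable borel" for n
    using N stopping_game.game_quantile_meas G.game_quantile_meas by (auto simp: Q_def)
  have Ql: "AE u in uniform01. (\<lambda>n. Q n u) \<longlonglongrightarrow> game_quantile h R u"
    using G.clamped_sampled_tendsto
  proof eventually_elim
    case (elim u)
    have "(\<lambda>n. (clamped (?Rn n) u - ?Rn n 1) / (integral {0..1} (?Rn n) - ?Rn n 1)) \<longlonglongrightarrow> (clamped R u - R 1) / (integral {0..1} R - R 1)"
      using pos by (intro tendsto_intros elim G.sampled_game_1_tendsto b)
    moreover have "\<forall>\<^sub>F n in sequentially. (clamped (?Rn n) u - ?Rn n 1) / (integral {0..1} (?Rn n) - ?Rn n 1) = h (Q n u)"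
      using eventually_ge_at_top[of N]
    proof eventually_elim
      case (elim n)
      then show ?case using stopping_game.h_game_quantile[OF N[OF elim], of u] by (simp add: Q_def)
    qed
    ultimately have hl: "(\<lambda>n. h (Q n u)) \<longlonglongrightarrow> h (game_quantile h R u)"
      unfolding G.h_game_quantile by (rule Lim_transform_eventually)
    \<comment> \<open>Strict monotonicity of \<open>h\<close> turns convergence of the values of
      \<open>h\<close> into convergence of the arguments, by order comparison alone.\<close>
    show ?case
    proof (rule order_tendstoI)
      fix c assume "c < game_quantile h R u"
      then have "h c < h (game_quantile h R u)" by simp
      from order_tendstoD(1)[OF hl this] show "\<forall>\<^sub>F n in sequentially. c < Q n u" by simp
    next
      fix c assume "game_quantile h R u < c"
      then have "h (game_quantile h R u) < h c" by simp
      from order_tendstoD(2)[OF hl this] show "\<forall>\<^sub>F n in sequentially. Q n u < c" by simp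
    qed
  qed
  show "weak_conv_m (\<lambda>n. game_law h (?Rn n)) (game_law h R)"
    unfolding weak_conv_m_def weak_conv_def
  proof (intro allI impI)
    fix x assume "isCont (cdf (game_law h R)) x"
    then have "(\<lambda>n. cdf (distr uniform01 borel (Q n)) x) \<longlonglongrightarrow> cdf (game_law h R) x"
      unfolding game_law_def by (intro cdf_tendsto_of_AE Qm G.game_quantile_meas Ql)
    moreover have "\<forall>\<^sub>F n in sequentially. cdf (distr uniform01 borel (Q n)) x = cdf (game_law h (?Rn n)) x"
      using eventually_ge_at_top[of N] by eventually_elim (simp add: Q_def game_law_def)
    ultimately show "(\<lambda>n. cdf (game_law h (?Rn n)) x) \<longlonglongrightarrow> cdf (game_law h R) x"
      by (rule Lim_transform_eventually)
  qed
  assume K: "compact K"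
  have "continuous_on K h" using h_cont by (rule continuous_on_subset) simp
  then have "bounded (h ` K)" using K by (intro compact_imp_bounded compact_continuous_image)
  then obtain H where H: "0 < H" "\<And>x. x \<in> K \<Longrightarrow> \<bar>h x\<bar> \<le> H" by (auto simp: bounded_pos)
  \<comment> \<open>Error bound uniform on \<open>K\<close>: the minimum is 1-Lipschitz in each
    argument, |h| is at most \<open>H\<close>, and only the coefficients depend on n.\<close>
  let ?a = "\<lambda>n. \<bar>?Rn n 1 - R 1\<bar> + \<bar>(integral {0..1} (?Rn n) - ?Rn n 1) - (integral {0..1} R - R 1)\<bar> * H + \<bar>?Rn n 0 - R 0\<bar>"
  have "?a \<longlonglongrightarrow> \<bar>R 1 - R 1\<bar> + \<bar>(integral {0..1} R - R 1) - (integral {0..1} R - R 1)\<bar> * H + \<bar>R 0 - R 0\<bar>"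
    by (intro tendsto_intros G.sampled_game_0_tendsto G.sampled_game_1_tendsto b)
  then have a0: "?a \<longlonglongrightarrow> 0" by simp
  show "uniform_limit K (\<lambda>n. game_value h (?Rn n)) (game_value h R) sequentially"
  proof (rule uniform_limitI)
    fix e :: real assume "0 < e"
    from order_tendstoD(2)[OF a0 this]
    show "\<forall>\<^sub>F n in sequentially. \<forall>x\<in>K. dist (game_value h (?Rn n) x) (game_value h R x) < e"
    proof eventually_elim
      case (elim n)
      show ?case
      proof
        fix x assume x: "x \<in> K"
        let ?s = "integral {0..1} (?Rn n) - ?Rn n 1" and ?t = "integral {0..1} R - R 1"
        have "\<bar>game_value h (?Rn n) x - game_value h R x\<bar> \<le> \<bar>(?Rn n 1 + ?s * h x) - (R 1 + ?t * h x)\<bar> + \<bar>?Rn n 0 - R 0\<bar>"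
        proof -
          have "\<bar>min a b - min c d\<bar> \<le> \<bar>a - c\<bar> + \<bar>b - d\<bar>" for a b c d :: real by (auto simp: min_def)
          then show ?thesis unfolding game_value_def .
        qed
        also have "(?Rn n 1 + ?s * h x) - (R 1 + ?t * h x) = (?Rn n 1 - R 1) + (?s - ?t) * h x"
          by (simp add: algebra_simps)
        also have "\<bar>\<dots>\<bar> \<le> \<bar>?Rn n 1 - R 1\<bar> + \<bar>?s - ?t\<bar> * \<bar>h x\<bar>"
          using abs_triangle_ineq[of "?Rn n 1 - R 1" "(?s - ?t) * h x"] by (simp only: abs_mult)
        also have "\<dots> \<le> \<bar>?Rn n 1 - R 1\<bar> + \<bar>?s - ?t\<bar> * H"
          using H(2)[OF x] by (intro add_left_mono mult_left_mono) auto
        finally show "dist (game_value h (?Rn n) x) (game_value h R x) < e"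
          using elim unfolding dist_real_def by linarith
      qed
    qed
  qed
qed

theorem theorem5p1:
  fixes M :: "'a measure" and W :: "real \<Rightarrow> 'a \<Rightarrow> real"
    and R :: "real \<Rightarrow> real" and x0 \<mu> \<sigma> :: real
  assumes "brownian_motion M W"
    and "x0 > 0" and "\<sigma> > 0"
    and "reward_function R"
    and "\<mu> < critical_drift R \<sigma> x0"
  shows "(\<exists>!F. mean_field_equilibrium M W \<mu> \<sigma> x0 R F) \<and>
    (\<forall>\<^sub>F n in sequentially. \<exists>!F. n_player_equilibrium M W \<mu> \<sigma> x0 n (sampled_rewards R n) F) \<and>
    (\<forall>F_star F_n.
      mean_field_equilibrium M W \<mu> \<sigma> x0 R F_star \<longrightarrow>
      (\<forall>\<^sub>F n in sequentially.
        n_player_equilibrium M W \<mu> \<sigma> x0 n (sampled_rewards R n) (F_n n)) \<longrightarrow>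
      weak_conv_m F_n F_star \<and>
      (\<forall>K. compact K \<longrightarrow> K \<subseteq> {0..} \<longrightarrow>
        uniform_limit K
          (\<lambda>n. n_player_value M W \<mu> \<sigma> n (sampled_rewards R n) (F_n n))
          (mean_field_value M W \<mu> \<sigma> R F_star)
          sequentially))"
proof -
  define \<theta> where "\<theta> = 2 * \<mu> / \<sigma>\<^sup>2"
  define h where "h = normalized_scale \<theta> x0"
  let ?L = "attainable_laws M W \<mu> \<sigma>"
  interpret P: stopping_problem h ?L x0
    unfolding h_def by (rule drifted_stopping_problem[OF assms(1-3) \<theta>_def])
  interpret R: reward R using assms(4) by unfold_locales
  obtain B where "(R 0 - R 1) / (R.Rbar - R 1) < h B"
    unfolding h_def by (rule R.normalized_scale_exceeds[OF assms(2,3) \<theta>_def assms(5)])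
  then have B: "(R 0 - R 1) / (integral {0..1} R - R 1) < h B" by (simp add: R.Rbar_def)
  note lim = P.limit_of_games[OF assms(4) B]
  interpret G: stopping_game h ?L x0 R by (rule lim(1))
  have mf: "mean_field_equilibrium M W \<mu> \<sigma> x0 R F \<longleftrightarrow> F = game_law h R" for F
    unfolding mean_field_equilibrium_def by (rule G.game_equilibrium_iff)
  \<comment> \<open>The two payoff functions are known to agree for distributions; this covers every
    candidate, as an equilibrium has to be an attainable law.\<close>
  have np: "n_player_equilibrium M W \<mu> \<sigma> x0 n (sampled_rewards R n) F \<longleftrightarrow> F = game_law h (sampled_game R n)"
    if "stopping_game h ?L x0 (sampled_game R n)" for n F
  proof -
    have "n_player_payoff n (sampled_rewards R n) F = mean_field_payoff (sampled_game R n) F" if "F \<in> ?L x0"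
      using n_player_payoff_eq[OF P.L_distribution[OF _ that]] assms(2) by auto
    then show ?thesis
      unfolding n_player_equilibrium_def stopping_game.game_equilibrium_iff[OF \<open>stopping_game h ?L x0 (sampled_game R n)\<close>, symmetric]
      by (auto simp: equilibrium_def)
  qed
  have nv: "n_player_value M W \<mu> \<sigma> n (sampled_rewards R n) (game_law h (sampled_game R n)) x = game_value h (sampled_game R n) x"
    if "stopping_game h ?L x0 (sampled_game R n)" "0 \<le> x" for n x
  proof -
    have "n_player_payoff n (sampled_rewards R n) (game_law h (sampled_game R n)) = mean_field_payoff (sampled_game R n) (game_law h (sampled_game R n))"
      using n_player_payoff_eq[OF stopping_game.game_law_distribution[OF that(1)]] by auto
    then show ?thesis
      using stopping_game.game_value_eq[OF that] by (simp add: n_player_value_def)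
  qed
  have "\<exists>!F. mean_field_equilibrium M W \<mu> \<sigma> x0 R F" by (simp add: mf)
  moreover have "\<forall>\<^sub>F n in sequentially. \<exists>!F. n_player_equilibrium M W \<mu> \<sigma> x0 n (sampled_rewards R n) F"
    using lim(2) by eventually_elim (simp add: np)
  moreover have "weak_conv_m F_n F_star \<and>
      (\<forall>K. compact K \<longrightarrow> K \<subseteq> {0..} \<longrightarrow>
        uniform_limit K (\<lambda>n. n_player_value M W \<mu> \<sigma> n (sampled_rewards R n) (F_n n)) (mean_field_value M W \<mu> \<sigma> R F_star) sequentially)"
    if F_star: "mean_field_equilibrium M W \<mu> \<sigma> x0 R F_star"
      and F_n: "\<forall>\<^sub>F n in sequentially. n_player_equilibrium M W \<mu> \<sigma> x0 n (sampled_rewards R n) (F_n n)" for F_star F_n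
  proof (intro conjI allI impI)
    have Fs: "F_star = game_law h R" using F_star by (simp add: mf)
    \<comment> \<open>\<open>F_n\<close> is determined for large n only; both modes of convergence
      disregard the remaining indices.\<close>
    have Fn: "\<forall>\<^sub>F n in sequentially. stopping_game h ?L x0 (sampled_game R n) \<and> F_n n = game_law h (sampled_game R n)"
      using F_n lim(2) by eventually_elim (simp add: np)
    show "weak_conv_m F_n F_star"
      unfolding weak_conv_m_def weak_conv_def
    proof (intro allI impI)
      fix x assume "isCont (cdf F_star) x"
      then have "(\<lambda>n. cdf (game_law h (sampled_game R n)) x) \<longlonglongrightarrow> cdf F_star x"
        using lim(3) by (simp add: Fs weak_conv_m_def weak_conv_def)
      moreover have "\<forall>\<^sub>F n in sequentially. cdf (game_law h (sampled_game R n)) x = cdf (F_n n) x"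
        using Fn by eventually_elim simp
      ultimately show "(\<lambda>n. cdf (F_n n) x) \<longlonglongrightarrow> cdf F_star x" by (rule Lim_transform_eventually)
    qed
    fix K :: "real set" assume K: "compact K" "K \<subseteq> {0..}"
    have "\<forall>\<^sub>F n in sequentially. \<forall>x\<in>K. game_value h (sampled_game R n) x = n_player_value M W \<mu> \<sigma> n (sampled_rewards R n) (F_n n) x"
      using Fn
    proof eventually_elim
      case (elim n)
      then show ?case using nv[of n] K(2) by auto
    qed
    moreover have "game_value h R x = mean_field_value M W \<mu> \<sigma> R F_star x" if "x \<in> K" for x
      using G.game_value_eq[of x] that K(2) by (auto simp: Fs mean_field_value_def)
    ultimately show "uniform_limit K (\<lambda>n. n_player_value M W \<mu> \<sigma> n (sampled_rewards R n) (F_n n)) (mean_field_value M W \<mu> \<sigma> R F_star) sequentially"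
      using lim(4)[OF K(1)] by (simp add: uniform_limit_cong)
  qed
  ultimately show ?thesis by blast
qed

end
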